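(* Fix positive integers $n$ and $d$, and let $k=\delta(n,d-1)^2$. Then there is a $k$-dimensional convex family of proper polynomial mappings from $B_n$ of generic degree $d$ and of rank $\delta(n,d)$. Furthermore, for every convex family of origin-preserving polynomial proper mappings from $B_n$ of degree $d$, the dimension of the family is at most this number $k$.
   Context: $B_n$ is the open unit ball in $\mathbb{C}^n$ and $\|\cdot\|$ is the Euclidean norm. $V(n,d)$ denotes the complex vector space of polynomials of degree at most $d$ in $n$ complex variables with no constant term, and $\delta(n,d)$ is its dimension. A map $f$ is origin-preserving if $f(0)=0$; a family is origin-preserving if all its members are. Two proper holomorphic maps $f,g$ from $B_n$ to possibly different balls are norm-equivalent if $\|f\|^2=\|g\|^2$ as functions on $B_n$; norm-equivalent maps are identified. A real-valued real-analytic function $R(z,\bar z)$ on $B_n$ belongs to $\mathcal{P}_\infty$ if $R=\|f\|^2$ for some holomorphic map $f$ on $B_n$ with values in a Hilbert space (here always finite-dimensional). Writing $R(z,\bar z)=\sum_{\alpha,\beta}c_{\alpha\beta}z^\alpha\bar z^\beta$, the Hermitian matrix $(c_{\alpha\beta})$ is called the underlying Hermitian form of $R$. The rank of a proper map $f$ is the rank of the underlying Hermitian form of $\|f\|^2$. Convex families: a zero-dimensional family is a single proper map $f:B_n\to B_N$ for some $N$. For $k\ge 1$, let $f_i:B_n\to B_{N_i}$, $1\le i\le k+1$, be proper holomorphic maps whose squared norms $\|f_i\|^2$ define linearly independent Hermitian forms. For $\lambda\in\mathbb{R}^k$ put $$R_\lambda=\sum_{j=1}^k\lambda_j\|f_j\|^2+\Big(1-\sum_{j=1}^k\lambda_j\Big)\|f_{k+1}\|^2,$$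 and let $K\subset\mathbb{R}^k$ be the largest convex set such that $\lambda\in K$ implies $R_\lambda\in\mathcal{P}_\infty$. The $k$-dimensional convex family determined by these data consists of the proper maps $f$ (up to norm equivalence) with $\|f\|^2=R_\lambda$ for some $\lambda\in K$. The rank of a family is the maximum of the ranks of its members. The (generic) degree of a family is the degree of its member for generic $\lambda\in K$. *)

theory Defs
  imports "HOL-Analysis.Analysis" "HOL-Library.Function_Algebras"
begin

section \<open>Source and target balls\<close>

text \<open>
  The source \<open>\<complex>\<^sup>n\<close> is \<open>complex ^ 'n\<close>, so \<open>B\<^sub>n\<close> is \<open>ball 0 1\<close>. Target dimensions, and the dimension of
  the parameter space of a family, vary inside the statement. Hence \<open>\<complex>\<^sup>N\<close> and \<open>\<real>\<^sup>k\<close> are spaces of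
  sequences that vanish off \<open>{1..N}\<close>, resp. \<open>{1..k}\<close>. The product topology on sequences induces the
  Euclidean topology on them.
\<close>

definition coord_space :: "nat \<Rightarrow> (nat \<Rightarrow> 'a::zero) set" where
  "coord_space m = {v. \<forall>i. i \<notin> {1..m} \<longrightarrow> v i = 0}"

definition sqnorm :: "nat \<Rightarrow> (nat \<Rightarrow> complex) \<Rightarrow> real" where
  "sqnorm N w = (\<Sum>i=1..N. (cmod (w i))\<^sup>2)"

definition target_ball :: "nat \<Rightarrow> (nat \<Rightarrow> complex) set" where
  "target_ball N = {w \<in> coord_space N. sqnorm N w < 1}"

text \<open>
  Only values on \<open>ball 0 1\<close> are ever used of a map \<open>complex ^ 'n \<Rightarrow> nat \<Rightarrow> complex\<close>.
\<close>

section \<open>Proper holomorphic maps\<close>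

definition holomorphic_several :: "(complex ^ 'n::finite \<Rightarrow> complex) \<Rightarrow> (complex ^ 'n) set \<Rightarrow> bool" where
  "holomorphic_several g S \<longleftrightarrow>
     (\<forall>z\<in>S. \<exists>D. (g has_derivative D) (at z) \<and> (\<forall>c v. D (c *s v) = c * D v))"

definition holomorphic_map :: "nat \<Rightarrow> (complex ^ 'n::finite \<Rightarrow> nat \<Rightarrow> complex) \<Rightarrow> bool" where
  "holomorphic_map N f \<longleftrightarrow> (\<forall>i\<in>{1..N}. holomorphic_several (\<lambda>z. f z i) (ball 0 1))"

definition proper_holomorphic_map :: "nat \<Rightarrow> (complex ^ 'n::finite \<Rightarrow> nat \<Rightarrow> complex) \<Rightarrow> bool" where
  "proper_holomorphic_map N f \<longleftrightarrow>
     holomorphic_map N f \<and>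
     f ` ball 0 1 \<subseteq> target_ball N \<and>
     proper_map (top_of_set (ball 0 1)) (top_of_set (target_ball N)) f"

text \<open>
  The library notion \<open>proper_map\<close> (closed with compact fibres) amounts here to compactness of
  preimages of compact sets.
\<close>

lemma proper_holomorphic_map_iff_compact_preimages:
  fixes f :: "complex ^ 'n::finite \<Rightarrow> nat \<Rightarrow> complex"
  shows "proper_holomorphic_map N f \<longleftrightarrow>
     holomorphic_map N f \<and> f ` ball 0 1 \<subseteq> target_ball N \<and>
     (\<forall>C. C \<subseteq> target_ball N \<longrightarrow> compact C \<longrightarrow> compact {z \<in> ball 0 1. f z \<in> C})"
proof (cases "f ` ball 0 1 \<subseteq> target_ball N")
  case True
  let ?X = "top_of_set (ball 0 1 :: (complex ^ 'n) set)"
  let ?Y = "top_of_set (target_ball N)"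
  have Y: "metrizable_space ?Y"
    by (simp add: metrizable_space_euclidean metrizable_space_subtopology)
  have kcY: "kc_space ?Y"
    using Y by (intro Hausdorff_imp_kc_space metrizable_imp_Hausdorff_space)
  have kcX: "kc_space ?X"
    by (intro Hausdorff_imp_kc_space metrizable_imp_Hausdorff_space)
       (simp add: metrizable_space_euclidean metrizable_space_subtopology)
  have "proper_map ?X ?Y f \<longleftrightarrow>
      (\<forall>C. compactin ?Y C \<longrightarrow> compactin ?X {z \<in> topspace ?X. f z \<in> C})" (is "_ \<longleftrightarrow> ?C")
  proof
    assume "proper_map ?X ?Y f"
    then show ?C by (blast intro: compactin_proper_map_preimage)
  next
    assume ?C
    then show "proper_map ?X ?Y f"
      using True kcX kcY metrizable_imp_k_space[OF Y] by (intro compact_imp_proper_map) auto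
  qed
  also have "\<dots> \<longleftrightarrow> (\<forall>C. C \<subseteq> target_ball N \<longrightarrow> compact C \<longrightarrow> compact {z \<in> ball 0 1. f z \<in> C})"
    by (auto simp: compactin_subtopology)
  finally show ?thesis
    using True by (simp add: proper_holomorphic_map_def)
qed (simp add: proper_holomorphic_map_def)

section \<open>Polynomials and polynomial maps\<close>

definition zpow :: "complex ^ 'n::finite \<Rightarrow> ('n \<Rightarrow> nat) \<Rightarrow> complex" where
  "zpow z \<alpha> = (\<Prod>i\<in>UNIV. (z $ i) ^ \<alpha> i)"

definition polys_upto :: "nat \<Rightarrow> (complex ^ 'n::finite \<Rightarrow> complex) set" where
  "polys_upto d = {p. \<exists>c. p = (\<lambda>z. \<Sum>\<alpha> | (\<Sum>i\<in>UNIV. \<alpha> i) \<le> d. c \<alpha> * zpow z \<alpha>)}"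

definition V :: "nat \<Rightarrow> (complex ^ 'n::finite \<Rightarrow> complex) set" where
  "V d = {p \<in> polys_upto d. p 0 = 0}"

definition fun_scale :: "complex \<Rightarrow> ('a \<Rightarrow> complex) \<Rightarrow> 'a \<Rightarrow> complex" where
  "fun_scale a p = (\<lambda>x. a * p x)"

lemma vector_space_fun_scale: "vector_space fun_scale"
  by unfold_locales (auto simp: fun_scale_def fun_eq_iff algebra_simps)

definition delta :: "'n::finite itself \<Rightarrow> nat \<Rightarrow> nat" where
  "delta T d = vector_space.dim fun_scale (V d :: (complex ^ 'n \<Rightarrow> complex) set)"

definition polynomial_map_upto :: "nat \<Rightarrow> nat \<Rightarrow> (complex ^ 'n::finite \<Rightarrow> nat \<Rightarrow> complex) \<Rightarrow> bool" where
  "polynomial_map_upto d N f \<longleftrightarrow>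
     (\<forall>i\<in>{1..N}. \<exists>p\<in>polys_upto d. \<forall>z\<in>ball 0 1. f z i = p z)"

definition polynomial_map :: "nat \<Rightarrow> (complex ^ 'n::finite \<Rightarrow> nat \<Rightarrow> complex) \<Rightarrow> bool" where
  "polynomial_map N f \<longleftrightarrow> (\<exists>d. polynomial_map_upto d N f)"

text \<open>Only meaningful for polynomial maps.\<close>

definition map_degree :: "nat \<Rightarrow> (complex ^ 'n::finite \<Rightarrow> nat \<Rightarrow> complex) \<Rightarrow> nat" where
  "map_degree N f = (LEAST d. polynomial_map_upto d N f)"

section \<open>Squared norms and their Hermitian forms\<close>

definition P_inf :: "(complex ^ 'n::finite \<Rightarrow> real) set" where
  "P_inf = {R. \<exists>N f. holomorphic_map N f \<and> (\<forall>z\<in>ball 0 1. R z = sqnorm N (f z))}"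

text \<open>
  The expansion of a real-analytic function about the origin is only required to converge
  (unconditionally) near the origin; this already determines the coefficients.
\<close>

definition hermitian_expansion ::
    "(complex ^ 'n::finite \<Rightarrow> real) \<Rightarrow> (('n \<Rightarrow> nat) \<Rightarrow> ('n \<Rightarrow> nat) \<Rightarrow> complex) \<Rightarrow> bool" where
  "hermitian_expansion R c \<longleftrightarrow>
     (\<exists>r>0. \<forall>z\<in>ball 0 r.
        ((\<lambda>(\<alpha>, \<beta>). c \<alpha> \<beta> * zpow z \<alpha> * cnj (zpow z \<beta>)) has_sum complex_of_real (R z)) UNIV)"

definition underlying_form ::
    "(complex ^ 'n::finite \<Rightarrow> real) \<Rightarrow> ('n \<Rightarrow> nat) \<Rightarrow> ('n \<Rightarrow> nat) \<Rightarrow> complex" where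
  "underlying_form R = (THE c. hermitian_expansion R c)"

text \<open>
  The rank of a possibly infinite matrix is the dimension of its row space. It is finite for squared
  norms of maps into a ball \<open>B\<^sub>N\<close>.
\<close>

definition form_rank :: "('a \<Rightarrow> 'b \<Rightarrow> complex) \<Rightarrow> nat" where
  "form_rank c = vector_space.dim fun_scale (range c)"

definition map_rank :: "nat \<Rightarrow> (complex ^ 'n::finite \<Rightarrow> nat \<Rightarrow> complex) \<Rightarrow> nat" where
  "map_rank N f = form_rank (underlying_form (\<lambda>z. sqnorm N (f z)))"

section \<open>Convex families\<close>

text \<open>
  A family is given by its dimension \<open>k\<close> and the maps \<open>f i : B\<^sub>n \<rightarrow> B\<^bsub>N i\<^esub>\<close> for \<open>1 \<le> i \<le> k + 1\<close>. For
  \<open>k = 0\<close> the parameter space is a point, independence is automatic, and the family is the single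
  map \<open>f 1\<close> up to norm equivalence.
\<close>

definition convex_family ::
    "nat \<Rightarrow> (nat \<Rightarrow> nat) \<Rightarrow> (nat \<Rightarrow> complex ^ 'n::finite \<Rightarrow> nat \<Rightarrow> complex) \<Rightarrow> bool" where
  "convex_family k N f \<longleftrightarrow>
     (\<forall>i\<in>{1..k+1}. proper_holomorphic_map (N i) (f i)) \<and>
     (\<forall>a :: nat \<Rightarrow> real.
        (\<forall>\<alpha> \<beta>. (\<Sum>i=1..k+1. of_real (a i) * underlying_form (\<lambda>z. sqnorm (N i) (f i z)) \<alpha> \<beta>) = 0)
        \<longrightarrow> (\<forall>i\<in>{1..k+1}. a i = 0))"

definition family_R ::
    "nat \<Rightarrow> (nat \<Rightarrow> nat) \<Rightarrow> (nat \<Rightarrow> complex ^ 'n::finite \<Rightarrow> nat \<Rightarrow> complex)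
      \<Rightarrow> (nat \<Rightarrow> real) \<Rightarrow> complex ^ 'n \<Rightarrow> real" where
  "family_R k N f lam z =
     (\<Sum>j=1..k. lam j * sqnorm (N j) (f j z))
     + (1 - (\<Sum>j=1..k. lam j)) * sqnorm (N (k+1)) (f (k+1) z)"

text \<open>The library predicate \<open>convex\<close> needs \<open>real_vector\<close>, which sequences do not instantiate.\<close>

definition convex_seqs :: "(nat \<Rightarrow> real) set \<Rightarrow> bool" where
  "convex_seqs K \<longleftrightarrow>
     (\<forall>x\<in>K. \<forall>y\<in>K. \<forall>t\<in>{0..1}. (\<lambda>i. (1 - t) * x i + t * y i) \<in> K)"

text \<open>
  \<open>P_inf\<close> is closed under convex combinations, so the greatest set below exists: it consists of all
  admissible parameters.
\<close>

definition family_K ::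
    "nat \<Rightarrow> (nat \<Rightarrow> nat) \<Rightarrow> (nat \<Rightarrow> complex ^ 'n::finite \<Rightarrow> nat \<Rightarrow> complex) \<Rightarrow> (nat \<Rightarrow> real) set" where
  "family_K k N f =
     (GREATEST K. K \<subseteq> coord_space k \<and> convex_seqs K \<and> (\<forall>lam\<in>K. family_R k N f lam \<in> P_inf))"

text \<open>
  A member is a proper map together with its target dimension. All members with the same parameter
  are norm-equivalent.
\<close>

definition members_at ::
    "nat \<Rightarrow> (nat \<Rightarrow> nat) \<Rightarrow> (nat \<Rightarrow> complex ^ 'n::finite \<Rightarrow> nat \<Rightarrow> complex)
      \<Rightarrow> (nat \<Rightarrow> real) \<Rightarrow> (nat \<times> (complex ^ 'n \<Rightarrow> nat \<Rightarrow> complex)) set" where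
  "members_at k N f lam =
     {(M, g). proper_holomorphic_map M g \<and> (\<forall>z\<in>ball 0 1. sqnorm M (g z) = family_R k N f lam z)}"

definition members ::
    "nat \<Rightarrow> (nat \<Rightarrow> nat) \<Rightarrow> (nat \<Rightarrow> complex ^ 'n::finite \<Rightarrow> nat \<Rightarrow> complex)
      \<Rightarrow> (nat \<times> (complex ^ 'n \<Rightarrow> nat \<Rightarrow> complex)) set" where
  "members k N f = (\<Union>lam\<in>family_K k N f. members_at k N f lam)"

definition polynomial_family ::
    "nat \<Rightarrow> (nat \<Rightarrow> nat) \<Rightarrow> (nat \<Rightarrow> complex ^ 'n::finite \<Rightarrow> nat \<Rightarrow> complex) \<Rightarrow> bool" where
  "polynomial_family k N f \<longleftrightarrow> (\<forall>(M, g)\<in>members k N f. polynomial_map M g)"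

definition origin_preserving_family ::
    "nat \<Rightarrow> (nat \<Rightarrow> nat) \<Rightarrow> (nat \<Rightarrow> complex ^ 'n::finite \<Rightarrow> nat \<Rightarrow> complex) \<Rightarrow> bool" where
  "origin_preserving_family k N f \<longleftrightarrow> (\<forall>(M, g)\<in>members k N f. g 0 = (\<lambda>i. 0))"

definition family_rank ::
    "nat \<Rightarrow> (nat \<Rightarrow> nat) \<Rightarrow> (nat \<Rightarrow> complex ^ 'n::finite \<Rightarrow> nat \<Rightarrow> complex) \<Rightarrow> nat" where
  "family_rank k N f = Max ((\<lambda>(M, g). map_rank M g) ` members k N f)"

text \<open>A property holds for generic \<open>\<lambda> \<in> K\<close> if it holds on a relatively open dense subset of \<open>K\<close>.\<close>

definition has_generic_degree ::
    "nat \<Rightarrow> (nat \<Rightarrow> nat) \<Rightarrow> (nat \<Rightarrow> complex ^ 'n::finite \<Rightarrow> nat \<Rightarrow> complex) \<Rightarrow> nat \<Rightarrow> bool" where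
  "has_generic_degree k N f d \<longleftrightarrow>
     (\<exists>G. openin (top_of_set (family_K k N f)) G \<and> family_K k N f \<subseteq> closure G \<and>
          (\<forall>lam\<in>G. (\<lambda>(M, g). map_degree M g) ` members_at k N f lam = {d}))"

end

theory Submission
  imports Defs "HOL-Complex_Analysis.Complex_Analysis"
begin

text \<open>
  Write \<open>A\<^sub>d\<close> for the set of multi-indices \<open>\<alpha>\<close> with \<open>1 \<le> |\<alpha>| \<le> d\<close>; the monomials \<open>z\<^sup>\<alpha>\<close> with \<open>\<alpha> \<in> A\<^sub>d\<close> are
  a basis of \<open>V(n,d)\<close>, so \<open>\<delta>(n,d) = |A\<^sub>d|\<close>. The link between maps and matrices is that the coefficients
  of an expansion in the monomials \<open>z\<^sup>\<alpha>\<close> and their conjugates are unique: these products are distinct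
  multiplicative characters, so they are linearly independent by Dedekind's argument. Two more facts are
  needed. A polynomial map that sends the ball into the target ball is proper exactly when
  its squared norm is 1 on the unit sphere (for maps that vanish at the origin, Schwarz's lemma provides
  that the ball goes into the ball). And a holomorphic map whose squared norm is a polynomial of
  bidegree at most \<open>(d,d)\<close> is itself a polynomial map of degree at most \<open>d\<close>: along each coordinate line
  this follows from comparing power series, and a function that is polynomial in each variable
  separately is polynomial.

  Upper bound (\<open>convex_family_dimension_le\<close>). A generic degree bound passes to all members, since the
  coefficients are continuous in the parameter. So all forms of the family are supported in
  \<open>A\<^sub>d \<times> A\<^sub>d\<close>; pure terms do not occur because the maps preserve the origin. The difference of two of them
  vanishes on the sphere. Such a difference is determined by its entries in \<open>A\<^bsub>d-1\<^esub> \<times> A\<^bsub>d-1\<^esub>\<close>: if those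
  vanish, then only terms with \<open>max |\<alpha>| |\<beta>| = d\<close> are left, and comparing Fourier coefficients under
  \<open>z \<mapsto> e\<^sup>i\<^sup>\<theta> z\<close> splits the form into bihomogeneous pieces that vanish on the sphere and hence everywhere
  (\<open>top_degree_form_vanishing_on_sphere\<close>). Hermitian matrices indexed by \<open>A\<^bsub>d-1\<^esub>\<close> form a real vector
  space of dimension \<open>|A\<^bsub>d-1\<^esub>|\<^sup>2\<close>, so at most that many differences are independent.

  Existence (\<open>extremal_family_exists\<close>). Averaging \<open>\<parallel>z\<parallel>\<^sup>2\<^sup>j\<close> over \<open>1 \<le> j \<le> d\<close> gives a diagonal form \<open>R\<^sub>0\<close> that
  equals 1 on the sphere and has positive entries on all of \<open>A\<^sub>d\<close>. For \<open>\<alpha>, \<beta> \<in> A\<^bsub>d-1\<^esub>\<close> let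
  \<open>q = z\<^sup>\<alpha> + (1 + i) z\<^sup>\<beta>\<close>. Tensoring the component \<open>q\<close> of the base map by \<open>z\<close>, with a small factor \<open>\<epsilon>\<close>,
  gives \<open>R\<^sub>0 + \<epsilon>(\<parallel>z\<parallel>\<^sup>2 - 1)|q|\<^sup>2\<close>, again the squared norm of a proper map (\<open>tensored_map_exists\<close>). The
  forms \<open>|q|\<^sup>2\<close> are a basis of the Hermitian forms on \<open>A\<^bsub>d-1\<^esub>\<close> (\<open>pencil_forms_independent\<close>), so these maps
  together with the base map define a convex family of dimension \<open>|A\<^bsub>d-1\<^esub>|\<^sup>2\<close>. All its forms live on
  \<open>A\<^sub>d \<times> A\<^sub>d\<close>, which bounds the rank by \<open>\<delta>(n,d)\<close>, and the base map attains this bound. A diagonal entry of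
  top degree is nonnegative on the convex parameter set, affine, and positive at the base map; hence
  it is positive on a dense open subset, where the degree is exactly \<open>d\<close>.
\<close>

(* x $ i always denotes a coordinate of a vector. *)
no_notation fps_nth (infixl "$" 75)

section \<open>Independence of characters and of graded expansions\<close>

text \<open>
  Dedekind's argument. Evaluating a vanishing combination at \<open>w \<cdot> z\<close> and subtracting \<open>\<phi>\<^sub>y(w)\<close> times its
  value at \<open>z\<close> removes the character \<open>\<phi>\<^sub>y\<close>, and multiplies the coefficient of every \<open>\<phi>\<^sub>x\<close> by
  \<open>\<phi>\<^sub>x(w) - \<phi>\<^sub>y(w)\<close>, which is nonzero for a suitable \<open>w\<close>. The product on the domain is an arbitrary
  operation: multiplication of numbers, componentwise multiplication of vectors and addition of
  angles all occur.
\<close>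

lemma characters_independent:
  fixes \<phi> :: "'x \<Rightarrow> 'a \<Rightarrow> complex"
  assumes "finite X"
    and "\<And>x w z. x \<in> X \<Longrightarrow> \<phi> x (mul w z) = \<phi> x w * \<phi> x z"
    and "\<And>x. x \<in> X \<Longrightarrow> \<phi> x e = 1"
    and "\<And>x y. x \<in> X \<Longrightarrow> y \<in> X \<Longrightarrow> x \<noteq> y \<Longrightarrow> \<exists>w. \<phi> x w \<noteq> \<phi> y w"
    and "\<And>z. (\<Sum>x\<in>X. c x * \<phi> x z) = 0"
    and "x \<in> X"
  shows "c x = 0"
  using assms
proof (induction X arbitrary: c x rule: finite_induct)
  case empty
  then show ?case by simp
next
  case (insert y X)
  have other: "c x = 0" if xX: "x \<in> X" for x
  proof -
    obtain w where w: "\<phi> x w \<noteq> \<phi> y w"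
      using insert.prems(3)[of x y] insert.hyps xX by blast
    have "(\<Sum>x\<in>X. (c x * (\<phi> x w - \<phi> y w)) * \<phi> x z) = 0" for z
    proof -
      have "0 = (\<Sum>x\<in>insert y X. c x * \<phi> x (mul w z)) - \<phi> y w * (\<Sum>x\<in>insert y X. c x * \<phi> x z)"
        using insert.prems(4) by simp
      also have "\<dots> = (\<Sum>x\<in>insert y X. (c x * (\<phi> x w - \<phi> y w)) * \<phi> x z)"
        unfolding sum_distrib_left sum_subtractf[symmetric]
        by (intro sum.cong refl) (simp add: insert.prems(1) algebra_simps)
      also have "\<dots> = (\<Sum>x\<in>X. (c x * (\<phi> x w - \<phi> y w)) * \<phi> x z)"
        using insert.hyps by simp
      finally show ?thesis by simp
    qed
    with insert.IH[of "\<lambda>x. c x * (\<phi> x w - \<phi> y w)" x] insert.prems(1-3) xX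
    have "c x * (\<phi> x w - \<phi> y w) = 0" by blast
    with w show ?thesis by simp
  qed
  have "c y = 0"
  proof -
    have "(\<Sum>x\<in>insert y X. c x * \<phi> x e) = c y"
      using insert.hyps other insert.prems(2) by simp
    with insert.prems(4)[of e] show ?thesis by simp
  qed
  with other insert.prems(5) show ?case by auto
qed

lemma power_series_zero_near_0:
  fixes a :: "nat \<Rightarrow> real"
  assumes "r > 0" and "\<And>t. \<bar>t\<bar> < r \<Longrightarrow> (\<lambda>n. a n * t ^ n) sums 0"
  shows "a n = 0"
proof (cases "n = 0")
  case True
  have "(\<lambda>n. a n * 0 ^ n) sums 0" using assms(2)[of 0] assms(1) by simp
  then show ?thesis using powser_sums_zero_iff[of a 0] True by simp
next
  case False
  show ?thesis
  proof (rule ccontr)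
    assume n: "a n \<noteq> 0"
    have r: "(\<lambda>n. a n * (x - 0) ^ n) sums (\<lambda>_. 0) x" if "norm (x - 0) < r" for x :: real
      using assms(2)[of x] that by simp
    obtain s where "0 < s" "\<And>z. z \<in> cball (0::real) s - {0} \<Longrightarrow> (\<lambda>_. 0::real) z \<noteq> 0"
      using powser_0_nonzero[where f = "\<lambda>_. 0::real" and a = a, OF assms(1) r refl n] False by auto
    from this(2)[of s] this(1) show False by simp
  qed
qed

text \<open>
  Along the line \<open>t \<mapsto> t z\<close> a series of homogeneous functions is a power series in \<open>t\<close> whose coefficients
  are the (finite) homogeneous parts at \<open>z\<close>.
\<close>

lemma homogeneous_parts_vanish:
  fixes \<phi> :: "'x \<Rightarrow> 'a::real_vector \<Rightarrow> complex"
  assumes fin: "\<And>m. finite {x. g x = m}"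
    and hom: "\<And>x t. \<phi> x (t *\<^sub>R z) = of_real t ^ g x * \<phi> x z"
    and r: "r > 0" and zero: "\<And>t. \<bar>t\<bar> < r \<Longrightarrow> ((\<lambda>x. c x * \<phi> x (t *\<^sub>R z)) has_sum 0) UNIV"
  shows "(\<Sum>x | g x = m. c x * \<phi> x z) = 0"
proof -
  define P where "P = (\<lambda>m. \<Sum>x | g x = m. c x * \<phi> x z)"
  have s: "(\<lambda>m. P m * of_real t ^ m) sums 0" if "\<bar>t\<bar> < r" for t
  proof -
    have bij: "bij_betw snd (Sigma UNIV (\<lambda>m. {x. g x = m})) UNIV"
      by (auto simp: bij_betw_def inj_on_def image_iff)
    have "((\<lambda>p. c (snd p) * \<phi> (snd p) (t *\<^sub>R z)) has_sum 0) (Sigma UNIV (\<lambda>m. {x. g x = m}))"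
      using has_sum_reindex_bij_betw[OF bij, of "\<lambda>x. c x * \<phi> x (t *\<^sub>R z)"] zero[OF that] by simp
    moreover have "((\<lambda>x. c (snd (m, x)) * \<phi> (snd (m, x)) (t *\<^sub>R z)) has_sum P m * of_real t ^ m) {x. g x = m}" for m
      unfolding P_def sum_distrib_right
      by (rule has_sum_finiteI[OF fin], rule sum.cong) (auto simp: hom)
    ultimately have "((\<lambda>m. P m * of_real t ^ m) has_sum 0) UNIV"
      by (rule has_sum_SigmaD)
    then show ?thesis by (rule has_sum_imp_sums)
  qed
  have "Re (P m) = 0"
  proof (rule power_series_zero_near_0[OF r])
    fix t :: real assume "\<bar>t\<bar> < r"
    from sums_Re[OF s[OF this]] show "(\<lambda>n. Re (P n) * t ^ n) sums 0"
      by (simp flip: of_real_power)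
  qed
  moreover have "Im (P m) = 0"
  proof (rule power_series_zero_near_0[OF r])
    fix t :: real assume "\<bar>t\<bar> < r"
    from sums_Im[OF s[OF this]] show "(\<lambda>n. Im (P n) * t ^ n) sums 0"
      by (simp flip: of_real_power)
  qed
  ultimately show ?thesis by (simp add: P_def complex_eq_iff)
qed

text \<open>
  The homogeneous parts reduce an infinite expansion to finite linear combinations of characters. The
  radius of convergence may depend on \<open>z\<close>.
\<close>

lemma graded_characters_expansion_unique:
  fixes \<phi> :: "'x \<Rightarrow> 'a::real_vector \<Rightarrow> complex"
  assumes fin: "\<And>m. finite {x. g x = m}"
    and hom: "\<And>x t z. \<phi> x (t *\<^sub>R z) = of_real t ^ g x * \<phi> x z"
    and mult: "\<And>x w z. \<phi> x (mul w z) = \<phi> x w * \<phi> x z" and one: "\<And>x. \<phi> x e = 1"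
    and dist: "\<And>x y. x \<noteq> y \<Longrightarrow> \<exists>w. \<phi> x w \<noteq> \<phi> y w"
    and zero: "\<And>z. \<exists>r>0. \<forall>t. \<bar>t\<bar> < r \<longrightarrow> ((\<lambda>x. c x * \<phi> x (t *\<^sub>R z)) has_sum 0) UNIV"
  shows "c x = 0"
proof (rule characters_independent[where X = "{y. g y = g x}" and \<phi> = \<phi> and mul = mul and e = e])
  fix z
  obtain r where "r > 0" "\<forall>t. \<bar>t\<bar> < r \<longrightarrow> ((\<lambda>x. c x * \<phi> x (t *\<^sub>R z)) has_sum 0) UNIV"
    using zero by blast
  then show "(\<Sum>y | g y = g x. c y * \<phi> y z) = 0"
    using homogeneous_parts_vanish[of g \<phi> z r c "g x"] fin hom by blast
qed (use assms in auto)

lemma cis_characters_distinct: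
  fixes m n :: int
  assumes "m \<noteq> n"
  shows "\<exists>\<theta>. cis (of_int m * \<theta>) \<noteq> cis (of_int n * \<theta>)"
proof (intro exI notI)
  define \<theta> where "\<theta> = pi / of_int (m - n)"
  assume "cis (of_int m * \<theta>) = cis (of_int n * \<theta>)"
  then have "cis (of_int m * \<theta> - of_int n * \<theta>) = 1"
    by (simp flip: cis_divide)
  moreover have "of_int m * \<theta> - of_int n * \<theta> = pi"
    using assms by (simp add: \<theta>_def flip: left_diff_distrib diff_divide_distrib)
  ultimately show False by (simp add: cis.ctr complex_eq_iff)
qed

text \<open>
  The modulus of \<open>s\<close> detects \<open>p + q\<close>, its argument detects \<open>p - q\<close>.
\<close>

lemma monomial_characters_distinct:
  fixes p q p' q' :: nat
  assumes "(p, q) \<noteq> (p', q')"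
  shows "\<exists>s::complex. s ^ p * cnj s ^ q \<noteq> s ^ p' * cnj s ^ q'"
proof (rule ccontr)
  assume "\<not> ?thesis"
  then have eq: "s ^ p * cnj s ^ q = s ^ p' * cnj s ^ q'" for s by blast
  from eq[of 2] have "of_nat (2 ^ (p + q)) = (of_nat (2 ^ (p' + q')) :: complex)"
    by (simp add: power_add)
  then have 1: "p + q = p' + q'" by (simp only: of_nat_eq_iff) simp
  have "cis (of_int (int p - int q) * \<theta>) = cis (of_int (int p' - int q') * \<theta>)" for \<theta>
  proof -
    have "cis \<theta> ^ a * cnj (cis \<theta>) ^ b = cis (of_int (int a - int b) * \<theta>)" for a b
      by (simp add: cis_cnj Complex.DeMoivre cis_mult algebra_simps)
    with eq[of "cis \<theta>"] show ?thesis by simp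
  qed
  then have "int p - int q = int p' - int q'"
    using cis_characters_distinct[of "int p - int q" "int p' - int q'"] by blast
  with 1 assms show False by auto
qed

section \<open>Multi-indices and Hermitian forms\<close>

definition mdeg :: "('n::finite \<Rightarrow> nat) \<Rightarrow> nat" where
  "mdeg \<alpha> = (\<Sum>i\<in>UNIV. \<alpha> i)"

lemma finite_mdeg_le: "finite {\<alpha> :: 'n::finite \<Rightarrow> nat. mdeg \<alpha> \<le> d}"
proof (rule finite_subset)
  show "{\<alpha> :: 'n \<Rightarrow> nat. mdeg \<alpha> \<le> d} \<subseteq> PiE UNIV (\<lambda>_. {..d})"
  proof (auto simp: mdeg_def)
    fix \<alpha> :: "'n \<Rightarrow> nat" and i
    assume "(\<Sum>i\<in>UNIV. \<alpha> i) \<le> d"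
    moreover have "\<alpha> i \<le> (\<Sum>i\<in>UNIV. \<alpha> i)" by (rule member_le_sum) auto
    ultimately show "\<alpha> i \<le> d" by simp
  qed
qed (auto intro: finite_PiE)

lemma mdeg_add: "mdeg (\<alpha> + \<beta>) = mdeg \<alpha> + mdeg \<beta>"
  by (simp add: mdeg_def sum.distrib)

lemma zpow_add: "zpow z (\<alpha> + \<beta>) = zpow z \<alpha> * zpow z \<beta>"
  by (simp add: zpow_def power_add prod.distrib)

lemma zpow_scale: "zpow (s *s z) \<alpha> = s ^ mdeg \<alpha> * zpow z \<alpha>"
  by (simp add: zpow_def mdeg_def power_mult_distrib prod.distrib power_sum)

lemma zpow_scaleR: "zpow (t *\<^sub>R z) \<alpha> = of_real t ^ mdeg \<alpha> * zpow z \<alpha>"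
  by (simp add: zpow_def mdeg_def scaleR_conv_of_real[where 'a = complex] power_mult_distrib prod.distrib power_sum)

lemma zpow_0: "zpow 0 \<alpha> = (if mdeg \<alpha> = 0 then 1 else 0)"
  by (auto simp: zpow_def mdeg_def prod_zero_iff)

definition hterm :: "('n::finite \<Rightarrow> nat) \<times> ('n \<Rightarrow> nat) \<Rightarrow> complex ^ 'n \<Rightarrow> complex" where
  "hterm p z = zpow z (fst p) * cnj (zpow z (snd p))"

text \<open>
  The products of a monomial and a conjugate monomial are multiplicative for the componentwise product
  of vectors. They are distinguished on vectors with all coordinates but one equal to 1.
\<close>

lemma hterm_characters:
  fixes p q :: "('n::finite \<Rightarrow> nat) \<times> ('n \<Rightarrow> nat)"
  shows "hterm p (\<chi> i. w $ i * z $ i) = hterm p w * hterm p z"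
    and "hterm p (\<chi> i. 1) = 1"
    and "p \<noteq> q \<Longrightarrow> \<exists>w. hterm p w \<noteq> hterm q w"
proof -
  show "hterm p (\<chi> i. w $ i * z $ i) = hterm p w * hterm p z"
    by (simp add: hterm_def zpow_def power_mult_distrib prod.distrib)
  show "hterm p (\<chi> i. 1) = 1"
    by (simp add: hterm_def zpow_def)
  show "\<exists>w. hterm p w \<noteq> hterm q w" if ne: "p \<noteq> q"
  proof -
    obtain i where i: "(fst p i, snd p i) \<noteq> (fst q i, snd q i)"
      using ne by (metis ext fst_conv prod_eqI snd_conv)
    obtain s :: complex where s: "s ^ fst p i * cnj s ^ snd p i \<noteq> s ^ fst q i * cnj s ^ snd q i"
      using monomial_characters_distinct[OF i] by blast
    have z: "zpow (\<chi> j. if j = i then s else 1) \<alpha> = s ^ \<alpha> i" for \<alpha> :: "'n \<Rightarrow> nat"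
    proof -
      have "zpow (\<chi> j. if j = i then s else 1) \<alpha> = (\<Prod>j\<in>UNIV. if j = i then s ^ \<alpha> j else 1)"
        unfolding zpow_def by (rule prod.cong) auto
      then show ?thesis by simp
    qed
    from s show ?thesis
      by (intro exI[of _ "\<chi> j. if j = i then s else 1"]) (simp add: hterm_def z)
  qed
qed

lemma hermitian_expansion_unique:
  fixes R :: "complex ^ 'n::finite \<Rightarrow> real"
  assumes "hermitian_expansion R c" and "hermitian_expansion R c'"
  shows "c = c'"
proof -
  obtain r r' where r: "r > 0" "r' > 0"
    and c: "\<And>z. z \<in> ball 0 r \<Longrightarrow> ((\<lambda>(\<alpha>, \<beta>). c \<alpha> \<beta> * zpow z \<alpha> * cnj (zpow z \<beta>)) has_sum of_real (R z)) UNIV"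
    and c': "\<And>z. z \<in> ball 0 r' \<Longrightarrow> ((\<lambda>(\<alpha>, \<beta>). c' \<alpha> \<beta> * zpow z \<alpha> * cnj (zpow z \<beta>)) has_sum of_real (R z)) UNIV"
    using assms unfolding hermitian_expansion_def by blast
  define b where "b = (\<lambda>p. c (fst p) (snd p) - c' (fst p) (snd p))"
  have "b p = 0" for p
  proof (rule graded_characters_expansion_unique[where \<phi> = hterm and g = "\<lambda>p. mdeg (fst p) + mdeg (snd p)" and e = "\<chi> i. 1" and mul = "\<lambda>w z. \<chi> i. w $ i * z $ i"])
    show "finite {p :: ('n \<Rightarrow> nat) \<times> ('n \<Rightarrow> nat). mdeg (fst p) + mdeg (snd p) = m}" for m
      by (rule finite_subset[of _ "{\<alpha>. mdeg \<alpha> \<le> m} \<times> {\<alpha>. mdeg \<alpha> \<le> m}"])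
        (auto simp: finite_mdeg_le)
    show "hterm p (t *\<^sub>R z) = of_real t ^ (mdeg (fst p) + mdeg (snd p)) * hterm p z"
      for p :: "('n \<Rightarrow> nat) \<times> ('n \<Rightarrow> nat)" and t z
      by (simp add: hterm_def zpow_scaleR power_add)
    fix z :: "complex ^ 'n"
    define \<rho> where "\<rho> = min r r' / (1 + norm z)"
    have "((\<lambda>p. b p * hterm p (t *\<^sub>R z)) has_sum 0) UNIV" if "\<bar>t\<bar> < \<rho>" for t
    proof -
      have "\<bar>t\<bar> * norm z \<le> \<bar>t\<bar> * (1 + norm z)" by (simp add: mult_left_mono)
      also have "\<dots> < min r r'"
        using that unfolding \<rho>_def by (subst (asm) pos_less_divide_eq) (auto simp: add_pos_nonneg)
      finally have "t *\<^sub>R z \<in> ball 0 r" "t *\<^sub>R z \<in> ball 0 r'" by auto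
      from has_sum_add[OF c[OF this(1)] has_sum_cmult_right[OF c'[OF this(2)], of "-1"]] show ?thesis
        by (simp add: b_def hterm_def case_prod_unfold algebra_simps)
    qed
    moreover have "\<rho> > 0" using r by (simp add: \<rho>_def add_pos_nonneg)
    ultimately show "\<exists>r>0. \<forall>t. \<bar>t\<bar> < r \<longrightarrow> ((\<lambda>p. b p * hterm p (t *\<^sub>R z)) has_sum 0) UNIV"
      by blast
  qed (simp_all add: hterm_characters)
  from this[of "(_, _)"] show ?thesis by (auto simp: b_def fun_eq_iff)
qed

lemma underlying_form_eqI: "hermitian_expansion R c \<Longrightarrow> underlying_form R = c"
  unfolding underlying_form_def using hermitian_expansion_unique by blast

text \<open>
  For a matrix \<open>c\<close> supported in degrees at most \<open>d\<close> this is the value at \<open>z\<close> of the Hermitian form of \<open>c\<close>;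
  the truncation keeps the sum finite for every \<open>c\<close>.
\<close>

definition hform :: "nat \<Rightarrow> (('n::finite \<Rightarrow> nat) \<Rightarrow> ('n \<Rightarrow> nat) \<Rightarrow> complex) \<Rightarrow> complex ^ 'n \<Rightarrow> complex" where
  "hform d c z = (\<Sum>\<alpha> | mdeg \<alpha> \<le> d. \<Sum>\<beta> | mdeg \<beta> \<le> d. c \<alpha> \<beta> * zpow z \<alpha> * cnj (zpow z \<beta>))"

text \<open>
  Forms of bidegree at most \<open>(d,d)\<close>. The equation is required on the unit ball only, because the values of
  the maps outside the ball are arbitrary.
\<close>

definition polynomial_form ::
    "nat \<Rightarrow> (complex ^ 'n::finite \<Rightarrow> real) \<Rightarrow> (('n \<Rightarrow> nat) \<Rightarrow> ('n \<Rightarrow> nat) \<Rightarrow> complex) \<Rightarrow> bool" where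
  "polynomial_form d R c \<longleftrightarrow>
     (\<forall>\<alpha> \<beta>. c \<alpha> \<beta> \<noteq> 0 \<longrightarrow> mdeg \<alpha> \<le> d \<and> mdeg \<beta> \<le> d) \<and>
     (\<forall>z\<in>ball 0 1. of_real (R z) = hform d c z)"

lemma underlying_form_polynomial:
  assumes "polynomial_form d R c"
  shows "underlying_form R = c"
proof (rule underlying_form_eqI)
  let ?M = "{\<alpha> :: 'a \<Rightarrow> nat. mdeg \<alpha> \<le> d}"
  have "((\<lambda>(\<alpha>, \<beta>). c \<alpha> \<beta> * zpow z \<alpha> * cnj (zpow z \<beta>)) has_sum of_real (R z)) UNIV"
    if "z \<in> ball 0 1" for z
  proof -
    have "of_real (R z) = (\<Sum>(\<alpha>, \<beta>)\<in>?M \<times> ?M. c \<alpha> \<beta> * zpow z \<alpha> * cnj (zpow z \<beta>))"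
      using assms that by (simp add: polynomial_form_def hform_def sum.cartesian_product)
    then have "((\<lambda>(\<alpha>, \<beta>). c \<alpha> \<beta> * zpow z \<alpha> * cnj (zpow z \<beta>)) has_sum of_real (R z)) (?M \<times> ?M)"
      by (intro has_sum_finiteI) (simp_all add: finite_mdeg_le)
    then show ?thesis
      by (rule iffD1[OF has_sum_cong_neutral, rotated -1])
        (use assms in \<open>auto simp: polynomial_form_def\<close>)
  qed
  then show "hermitian_expansion R c"
    unfolding hermitian_expansion_def by (intro exI[of _ 1]) auto
qed

lemma hform_eq_0_imp_coeffs_0:
  fixes c :: "('n::finite \<Rightarrow> nat) \<Rightarrow> ('n \<Rightarrow> nat) \<Rightarrow> complex"
  assumes "\<And>\<alpha> \<beta>. c \<alpha> \<beta> \<noteq> 0 \<Longrightarrow> mdeg \<alpha> \<le> d \<and> mdeg \<beta> \<le> d"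
    and "\<And>z. z \<in> ball 0 1 \<Longrightarrow> hform d c z = 0"
  shows "c \<alpha> \<beta> = 0"
proof -
  have "polynomial_form d (\<lambda>_. 0) c" using assms by (simp add: polynomial_form_def)
  moreover have "polynomial_form d (\<lambda>_. 0) (\<lambda>\<alpha> \<beta> :: 'n \<Rightarrow> nat. 0)"
    by (simp add: polynomial_form_def hform_def)
  ultimately have "c = (\<lambda>\<alpha> \<beta>. 0)" using underlying_form_polynomial by metis
  then show ?thesis by simp
qed

lemma polynomial_form_cong:
  "polynomial_form d R c \<Longrightarrow> (\<And>z. z \<in> ball 0 1 \<Longrightarrow> R' z = R z) \<Longrightarrow> polynomial_form d R' c"
  by (simp add: polynomial_form_def)

lemma hform_sum:
  "hform d (\<lambda>\<alpha> \<beta>. \<Sum>i\<in>I. a i * c i \<alpha> \<beta>) z = (\<Sum>i\<in>I. a i * hform d (c i) z)"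
proof -
  have "hform d (\<lambda>\<alpha> \<beta>. \<Sum>i\<in>I. a i * c i \<alpha> \<beta>) z =
      (\<Sum>\<alpha> | mdeg \<alpha> \<le> d. \<Sum>\<beta> | mdeg \<beta> \<le> d. \<Sum>i\<in>I. a i * (c i \<alpha> \<beta> * zpow z \<alpha> * cnj (zpow z \<beta>)))"
    by (simp add: hform_def sum_distrib_right mult.assoc)
  also have "\<dots> = (\<Sum>\<alpha> | mdeg \<alpha> \<le> d. \<Sum>i\<in>I. \<Sum>\<beta> | mdeg \<beta> \<le> d. a i * (c i \<alpha> \<beta> * zpow z \<alpha> * cnj (zpow z \<beta>)))"
    by (intro sum.cong refl sum.swap)
  also have "\<dots> = (\<Sum>i\<in>I. \<Sum>\<alpha> | mdeg \<alpha> \<le> d. \<Sum>\<beta> | mdeg \<beta> \<le> d. a i * (c i \<alpha> \<beta> * zpow z \<alpha> * cnj (zpow z \<beta>)))"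
    by (rule sum.swap)
  finally show ?thesis by (simp add: hform_def sum_distrib_left)
qed

section \<open>Dimension of the polynomial space\<close>

interpretation fs: vector_space fun_scale
  by (rule vector_space_fun_scale)

text \<open>
  A basis given as an indexed family. Independence is stated by coefficients, so it includes that the
  members of the family are distinct.
\<close>

lemma dim_eq_card_basis_family:
  fixes b :: "'x \<Rightarrow> 'a \<Rightarrow> complex"
  assumes fin: "finite A" and sub: "b ` A \<subseteq> S"
    and span: "\<And>p. p \<in> S \<Longrightarrow> \<exists>c. p = (\<lambda>z. \<Sum>x\<in>A. c x * b x z)"
    and indep: "\<And>c x. (\<And>z. (\<Sum>x\<in>A. c x * b x z) = 0) \<Longrightarrow> x \<in> A \<Longrightarrow> c x = 0"
  shows "vector_space.dim fun_scale S = card A"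
proof (rule fs.dim_unique[OF sub])
  have inj: "inj_on b A"
  proof (rule inj_onI, rule ccontr)
    fix x y assume xy: "x \<in> A" "y \<in> A" "b x = b y" "x \<noteq> y"
    have "(\<Sum>u\<in>A. ((if u = x then 1 else 0) - (if u = y then 1 else 0)) * b u z) = 0" for z
      using xy fin by (simp add: left_diff_distrib sum_subtractf if_distrib[of "\<lambda>x. x * _"] cong: if_cong)
    from indep[OF this xy(1)] xy(4) show False by simp
  qed
  then show "card (b ` A) = card A" by (rule card_image)
  have scale_sum: "(\<Sum>x\<in>X. fun_scale (c x) (b x)) = (\<lambda>z. \<Sum>x\<in>X. c x * b x z)" for c and X :: "'x set"
    by (induction X rule: infinite_finite_induct) (auto simp: fun_scale_def fun_eq_iff)
  show "S \<subseteq> fs.span (b ` A)"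
  proof
    fix p assume "p \<in> S"
    then obtain c where "p = (\<lambda>z. \<Sum>x\<in>A. c x * b x z)" using span by blast
    then have "p = (\<Sum>x\<in>A. fun_scale (c x) (b x))" by (simp add: scale_sum)
    then show "p \<in> fs.span (b ` A)"
      by (auto intro: fs.span_sum fs.span_scale fs.span_base)
  qed
  show "fs.independent (b ` A)"
  proof (rule fs.independent_if_scalars_zero)
    fix f v assume f: "(\<Sum>x\<in>b ` A. fun_scale (f x) x) = 0" and v: "v \<in> b ` A"
    then obtain x where x: "x \<in> A" "v = b x" by blast
    have "(\<lambda>z. \<Sum>x\<in>A. f (b x) * b x z) = (\<lambda>_. 0)"
      using f by (simp add: sum.reindex[OF inj] scale_sum zero_fun_def)
    then have "f (b x) = 0" using indep[of "\<lambda>x. f (b x)", OF _ x(1)] by meson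
    then show "f v = 0" by (simp add: x)
  qed (simp add: fin)
qed

lemma zpow_independent:
  fixes c :: "('n::finite \<Rightarrow> nat) \<Rightarrow> complex"
  assumes "finite X" "\<And>z. (\<Sum>\<alpha>\<in>X. c \<alpha> * zpow z \<alpha>) = 0" "\<alpha> \<in> X"
  shows "c \<alpha> = 0"
proof -
  have h: "hterm (\<alpha>, \<lambda>_. 0) z = zpow z \<alpha>" for \<alpha> :: "'n \<Rightarrow> nat" and z
    by (simp add: hterm_def zpow_def)
  show ?thesis
    by (rule characters_independent[OF assms(1), where \<phi> = "\<lambda>\<alpha>. hterm (\<alpha>, \<lambda>_. 0)" and e = "\<chi> i. 1"
          and mul = "\<lambda>w z. \<chi> i. w $ i * z $ i"])
      (use assms in \<open>simp_all add: h hterm_characters(3) flip: hterm_characters(1)\<close>,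
       simp_all add: hterm_characters flip: h)
qed

lemma polys_upto_eq: "polys_upto d = {p. \<exists>c. p = (\<lambda>z. \<Sum>\<alpha> | mdeg \<alpha> \<le> d. c \<alpha> * zpow z \<alpha>)}"
  by (simp add: polys_upto_def mdeg_def)

lemma sum_mdeg_le_split:
  fixes h :: "('n::finite \<Rightarrow> nat) \<Rightarrow> complex"
  shows "(\<Sum>\<alpha> | mdeg \<alpha> \<le> d. h \<alpha>) = h (\<lambda>_. 0) + (\<Sum>\<alpha> | 1 \<le> mdeg \<alpha> \<and> mdeg \<alpha> \<le> d. h \<alpha>)"
proof -
  have "{\<alpha> :: 'n \<Rightarrow> nat. mdeg \<alpha> \<le> d} = insert (\<lambda>_. 0) {\<alpha>. 1 \<le> mdeg \<alpha> \<and> mdeg \<alpha> \<le> d}"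
    by (auto simp: mdeg_def Suc_le_eq fun_eq_iff)
  moreover have "(\<lambda>_. 0) \<notin> {\<alpha> :: 'n \<Rightarrow> nat. 1 \<le> mdeg \<alpha> \<and> mdeg \<alpha> \<le> d}" by (simp add: mdeg_def)
  moreover have "finite {\<alpha> :: 'n \<Rightarrow> nat. 1 \<le> mdeg \<alpha> \<and> mdeg \<alpha> \<le> d}"
    by (rule finite_subset[OF _ finite_mdeg_le[of d]]) auto
  ultimately show ?thesis by simp
qed

text \<open>
  A polynomial without constant term is a combination of the monomials of degree between 1 and \<open>d\<close>,
  because only the constant monomial is nonzero at the origin.
\<close>

lemma delta_eq_card: "delta TYPE('n::finite) d = card {\<alpha> :: 'n \<Rightarrow> nat. 1 \<le> mdeg \<alpha> \<and> mdeg \<alpha> \<le> d}"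
  unfolding delta_def
proof (rule dim_eq_card_basis_family[where b = "\<lambda>\<alpha> z. zpow z \<alpha>"])
  show fin: "finite {\<alpha> :: 'n \<Rightarrow> nat. 1 \<le> mdeg \<alpha> \<and> mdeg \<alpha> \<le> d}"
    by (rule finite_subset[OF _ finite_mdeg_le[of d]]) auto
  show "(\<lambda>\<alpha> z. zpow z \<alpha>) ` {\<alpha> :: 'n \<Rightarrow> nat. 1 \<le> mdeg \<alpha> \<and> mdeg \<alpha> \<le> d} \<subseteq> V d"
  proof clarify
    fix \<alpha> :: "'n \<Rightarrow> nat" assume \<alpha>: "1 \<le> mdeg \<alpha>" "mdeg \<alpha> \<le> d"
    have "(\<lambda>z. zpow z \<alpha>) = (\<lambda>z. \<Sum>\<beta> | mdeg \<beta> \<le> d. (if \<beta> = \<alpha> then 1 else 0) * zpow z \<beta>)"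
      using \<alpha> by (simp add: finite_mdeg_le if_distrib[of "\<lambda>x. x * _"] cong: if_cong)
    then have "(\<lambda>z. zpow z \<alpha>) \<in> polys_upto d" unfolding polys_upto_eq
      by (intro CollectI exI[of _ "\<lambda>\<beta>. if \<beta> = \<alpha> then 1 else 0"])
    then show "(\<lambda>z. zpow z \<alpha>) \<in> V d" using \<alpha> by (simp add: V_def zpow_0)
  qed
  show "c \<alpha> = 0" if "\<And>z. (\<Sum>\<alpha> | 1 \<le> mdeg \<alpha> \<and> mdeg \<alpha> \<le> d. c \<alpha> * zpow z \<alpha>) = 0"
    "\<alpha> \<in> {\<alpha>. 1 \<le> mdeg \<alpha> \<and> mdeg \<alpha> \<le> d}" for c and \<alpha> :: "'n \<Rightarrow> nat"
    using zpow_independent[OF fin] that by blast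
  fix p :: "complex ^ 'n \<Rightarrow> complex" assume "p \<in> V d"
  then obtain c where p: "p = (\<lambda>z. \<Sum>\<alpha> | mdeg \<alpha> \<le> d. c \<alpha> * zpow z \<alpha>)" and p0: "p 0 = 0"
    by (auto simp: V_def polys_upto_eq)
  have p': "p z = c (\<lambda>_. 0) + (\<Sum>\<alpha> | 1 \<le> mdeg \<alpha> \<and> mdeg \<alpha> \<le> d. c \<alpha> * zpow z \<alpha>)" for z
    unfolding p sum_mdeg_le_split by (simp add: zpow_def)
  have "(\<Sum>\<alpha> | 1 \<le> mdeg \<alpha> \<and> mdeg \<alpha> \<le> d. c \<alpha> * zpow 0 \<alpha>) = (0::complex)"
    by (rule sum.neutral) (auto simp: zpow_0)
  with p0 p'[of 0] have "c (\<lambda>_. 0) = 0" by simp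
  with p' show "\<exists>c. p = (\<lambda>z. \<Sum>\<alpha> | 1 \<le> mdeg \<alpha> \<and> mdeg \<alpha> \<le> d. c \<alpha> * zpow z \<alpha>)" by auto
qed

section \<open>Polynomial functions\<close>

text \<open>
  Collects equal exponents; this makes sums over any index set, such as the pairs arising in a product,
  polynomials in the required form.
\<close>

lemma polys_upto_sumI:
  fixes e :: "'x \<Rightarrow> 'n::finite \<Rightarrow> nat"
  assumes "finite I" "\<And>i. i \<in> I \<Longrightarrow> mdeg (e i) \<le> d"
  shows "(\<lambda>z. \<Sum>i\<in>I. c i * zpow z (e i)) \<in> polys_upto d"
proof -
  have "(\<Sum>i\<in>I. c i * zpow z (e i)) = (\<Sum>\<alpha> | mdeg \<alpha> \<le> d. (\<Sum>i\<in>{i \<in> I. e i = \<alpha>}. c i) * zpow z \<alpha>)" for z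
  proof -
    have "(\<Sum>i\<in>I. c i * zpow z (e i)) = (\<Sum>\<alpha> | mdeg \<alpha> \<le> d. \<Sum>i\<in>{i \<in> I. e i = \<alpha>}. c i * zpow z (e i))"
      by (rule sum.group[symmetric]) (use assms in \<open>auto simp: finite_mdeg_le\<close>)
    then show ?thesis by (simp add: sum_distrib_right)
  qed
  then show ?thesis by (auto simp: polys_upto_eq)
qed

lemma polys_upto_mono: "p \<in> polys_upto d \<Longrightarrow> d \<le> d' \<Longrightarrow> p \<in> polys_upto d'"
  unfolding polys_upto_eq[of d] by (auto intro!: polys_upto_sumI simp: finite_mdeg_le)

lemma polys_upto_mult:
  assumes "p \<in> polys_upto d" "q \<in> polys_upto d'"
  shows "(\<lambda>z. p z * q z) \<in> polys_upto (d + d')"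
proof -
  obtain a b where p: "p = (\<lambda>z. \<Sum>\<alpha> | mdeg \<alpha> \<le> d. a \<alpha> * zpow z \<alpha>)"
    and q: "q = (\<lambda>z. \<Sum>\<alpha> | mdeg \<alpha> \<le> d'. b \<alpha> * zpow z \<alpha>)"
    using assms by (auto simp: polys_upto_eq)
  have "(\<lambda>z. p z * q z) = (\<lambda>z. \<Sum>x\<in>{\<alpha>. mdeg \<alpha> \<le> d} \<times> {\<alpha>. mdeg \<alpha> \<le> d'}. (a (fst x) * b (snd x)) * zpow z (fst x + snd x))"
    by (simp add: p q sum_product sum.cartesian_product zpow_add case_prod_unfold algebra_simps)
  also have "\<dots> \<in> polys_upto (d + d')"
    by (rule polys_upto_sumI) (auto simp: finite_mdeg_le mdeg_add)
  finally show ?thesis .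
qed

lemma polys_upto_zpow: "mdeg \<alpha> \<le> d \<Longrightarrow> (\<lambda>z. zpow z \<alpha>) \<in> polys_upto d"
  using polys_upto_sumI[of "{()}" "\<lambda>_. \<alpha>" d "\<lambda>_. 1"] by simp

lemma polys_upto_const: "(\<lambda>z. c) \<in> polys_upto d"
  using polys_upto_sumI[of "{()}" "\<lambda>_ _. 0" d "\<lambda>_. c"] by (simp add: mdeg_def zpow_def)

lemma polys_upto_cmult: "p \<in> polys_upto d \<Longrightarrow> (\<lambda>z. c * p z) \<in> polys_upto d"
  using polys_upto_mult[OF polys_upto_const[of c 0]] by simp

lemma polys_upto_add:
  assumes "p \<in> polys_upto d" "q \<in> polys_upto d"
  shows "(\<lambda>z. p z + q z) \<in> polys_upto d"
proof -
  obtain a b where p: "p = (\<lambda>z. \<Sum>\<alpha> | mdeg \<alpha> \<le> d. a \<alpha> * zpow z \<alpha>)"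
    and q: "q = (\<lambda>z. \<Sum>\<alpha> | mdeg \<alpha> \<le> d. b \<alpha> * zpow z \<alpha>)"
    using assms by (auto simp: polys_upto_eq)
  have "(\<lambda>z. p z + q z) = (\<lambda>z. \<Sum>\<alpha> | mdeg \<alpha> \<le> d. (a \<alpha> + b \<alpha>) * zpow z \<alpha>)"
    by (simp add: p q sum.distrib algebra_simps)
  also have "\<dots> \<in> polys_upto d" by (rule polys_upto_sumI) (auto simp: finite_mdeg_le)
  finally show ?thesis .
qed

lemma zpow_unit: "zpow z (\<lambda>j. if j = i then m else 0) = (z $ i) ^ m"
proof -
  have "zpow z (\<lambda>j. if j = i then m else 0) = (\<Prod>j\<in>UNIV. if j = i then (z $ j) ^ m else 1)"
    unfolding zpow_def by (rule prod.cong) auto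
  then show ?thesis by simp
qed

lemma mdeg_unit: "mdeg (\<lambda>j. if j = i then m else 0) = m"
  by (simp add: mdeg_def)

lemma polys_upto_coord: "1 \<le> d \<Longrightarrow> (\<lambda>z. z $ i) \<in> polys_upto d"
  using polys_upto_zpow[of "\<lambda>j. if j = i then 1 else 0" d] by (simp add: zpow_unit mdeg_unit)

definition polyfun :: "(complex ^ 'n::finite \<Rightarrow> complex) set" where
  "polyfun = (\<Union>d. polys_upto d)"

lemma polyfun_const: "(\<lambda>z. c) \<in> polyfun"
  by (auto simp: polyfun_def polys_upto_const)

lemma polyfun_coord: "(\<lambda>z. z $ i) \<in> polyfun"
  unfolding polyfun_def using polys_upto_coord[of 1 i] by blast

lemma polyfun_mult: "p \<in> polyfun \<Longrightarrow> q \<in> polyfun \<Longrightarrow> (\<lambda>z. p z * q z) \<in> polyfun"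
  unfolding polyfun_def using polys_upto_mult by blast

lemma polyfun_add:
  assumes "p \<in> polyfun" "q \<in> polyfun"
  shows "(\<lambda>z. p z + q z) \<in> polyfun"
proof -
  obtain d d' where "p \<in> polys_upto d" "q \<in> polys_upto d'" using assms by (auto simp: polyfun_def)
  then have "p \<in> polys_upto (max d d')" "q \<in> polys_upto (max d d')" by (auto intro: polys_upto_mono)
  from polys_upto_add[OF this] show ?thesis by (auto simp: polyfun_def)
qed

lemma polyfun_sum: "(\<And>i. i \<in> I \<Longrightarrow> p i \<in> polyfun) \<Longrightarrow> (\<lambda>z. \<Sum>i\<in>I. p i z) \<in> polyfun"
  by (induction I rule: infinite_finite_induct) (auto intro: polyfun_const polyfun_add)

lemma polyfun_power: "p \<in> polyfun \<Longrightarrow> (\<lambda>z. p z ^ n) \<in> polyfun"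
  by (induction n) (auto intro: polyfun_const polyfun_mult)

lemma continuous_on_zpow: "continuous_on S (\<lambda>z. zpow z \<alpha>)"
  unfolding zpow_def by (intro continuous_intros)

lemma continuous_on_polys_upto: "p \<in> polys_upto d \<Longrightarrow> continuous_on S p"
  by (auto simp: polys_upto_eq intro!: continuous_intros continuous_on_zpow)

lemma holomorphic_several_mult:
  assumes "holomorphic_several f S" "holomorphic_several g S"
  shows "holomorphic_several (\<lambda>z. f z * g z) S"
  unfolding holomorphic_several_def
proof
  fix z assume "z \<in> S"
  then obtain D E where D: "(f has_derivative D) (at z)" "\<And>c v. D (c *s v) = c * D v"
    and E: "(g has_derivative E) (at z)" "\<And>c v. E (c *s v) = c * E v"
    using assms unfolding holomorphic_several_def by meson
  show "\<exists>D. ((\<lambda>z. f z * g z) has_derivative D) (at z) \<and> (\<forall>c v. D (c *s v) = c * D v)"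
    by (intro exI conjI, rule has_derivative_mult[OF D(1) E(1)]) (simp add: D(2) E(2) algebra_simps)
qed

lemma holomorphic_several_add:
  assumes "holomorphic_several f S" "holomorphic_several g S"
  shows "holomorphic_several (\<lambda>z. f z + g z) S"
  unfolding holomorphic_several_def
proof
  fix z assume "z \<in> S"
  then obtain D E where D: "(f has_derivative D) (at z)" "\<And>c v. D (c *s v) = c * D v"
    and E: "(g has_derivative E) (at z)" "\<And>c v. E (c *s v) = c * E v"
    using assms unfolding holomorphic_several_def by meson
  show "\<exists>D. ((\<lambda>z. f z + g z) has_derivative D) (at z) \<and> (\<forall>c v. D (c *s v) = c * D v)"
    by (intro exI conjI, rule has_derivative_add[OF D(1) E(1)]) (simp add: D(2) E(2) algebra_simps)
qed

lemma holomorphic_several_const: "holomorphic_several (\<lambda>z. c) S"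
  unfolding holomorphic_several_def by (auto intro!: exI[of _ "\<lambda>_. 0"])

lemma holomorphic_several_coord: "holomorphic_several (\<lambda>z. z $ i) S"
  unfolding holomorphic_several_def
  by (intro ballI exI[of _ "\<lambda>v. v $ i"]) (auto intro: bounded_linear_imp_has_derivative bounded_linear_vec_nth)

lemma holomorphic_several_power: "holomorphic_several f S \<Longrightarrow> holomorphic_several (\<lambda>z. f z ^ n) S"
  by (induction n) (auto intro: holomorphic_several_const holomorphic_several_mult)

lemma holomorphic_several_zpow: "holomorphic_several (\<lambda>z. zpow z \<alpha>) S"
proof -
  have "holomorphic_several (\<lambda>z :: complex ^ 'a. \<Prod>i\<in>I. (z $ i) ^ \<alpha> i) S" if "finite I" for I
    using that
    by induction (auto intro!: holomorphic_several_const holomorphic_several_mult holomorphic_several_power holomorphic_several_coord)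
  from this[of UNIV] show ?thesis by (simp add: zpow_def)
qed

lemma holomorphic_several_polys_upto:
  assumes "p \<in> polys_upto d" shows "holomorphic_several p S"
proof -
  have "holomorphic_several (\<lambda>z :: complex ^ 'a. \<Sum>\<alpha>\<in>I. c \<alpha> * zpow z \<alpha>) S" if "finite I" for I c
    using that
    by induction (auto intro!: holomorphic_several_const holomorphic_several_mult holomorphic_several_add holomorphic_several_zpow)
  with assms show ?thesis by (auto simp: polys_upto_eq finite_mdeg_le)
qed

text \<open>
  Restricting to a complex line reduces questions about several variables to one complex variable.
\<close>

lemma holomorphic_several_slice:
  assumes "holomorphic_several f S" and "\<And>s. s \<in> T \<Longrightarrow> a + s *s v \<in> S"
  shows "(\<lambda>s. f (a + s *s v)) holomorphic_on T"
  unfolding holomorphic_on_def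
proof
  fix s assume "s \<in> T"
  then obtain D where D: "(f has_derivative D) (at (a + s *s v))" "\<And>c v. D (c *s v) = c * D v"
    using assms unfolding holomorphic_several_def by meson
  have "((\<lambda>s. a + s *s v) has_derivative (\<lambda>h. h *s v)) (at s within T)"
  proof -
    have bl: "bounded_linear (\<lambda>h. h *s v)"
      unfolding linear_conv_bounded_linear[symmetric]
      by (rule linearI) (simp_all add: vec_eq_iff algebra_simps)
    show ?thesis by (auto intro!: derivative_eq_intros bounded_linear_imp_has_derivative bl)
  qed
  from has_derivative_compose[OF this D(1)[THEN has_derivative_at_withinI]]
  show "(\<lambda>s. f (a + s *s v)) field_differentiable at s within T"
    unfolding field_differentiable_def has_field_derivative_def
    by (intro exI[of _ "D v"]) (simp add: D(2) mult_commute_abs)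
qed

section \<open>Holomorphic maps with polynomial squared norm\<close>

text \<open>
  The Cauchy product without rearrangement: as a sum over pairs it converges unconditionally.
\<close>

lemma has_sum_times:
  fixes u v :: "nat \<Rightarrow> complex"
  assumes u: "summable (\<lambda>n. norm (u n))" "u sums a" and v: "summable (\<lambda>n. norm (v n))" "v sums b"
  shows "((\<lambda>(p, q). u p * v q) has_sum a * b) UNIV"
proof -
  have nn: "((\<lambda>n. norm (f n)) has_sum (\<Sum>n. norm (f n))) UNIV" if "summable (\<lambda>n. norm (f n))" for f :: "nat \<Rightarrow> complex"
    using that by (intro norm_summable_imp_has_sum) (auto simp: summable_sums)
  have "(\<lambda>p. norm (u (fst p) * v (snd p))) summable_on (UNIV \<times> UNIV)"
  proof (rule summable_on_SigmaI)
    show "((\<lambda>y. norm (u (fst (x, y)) * v (snd (x, y)))) has_sum norm (u x) * (\<Sum>n. norm (v n))) UNIV" for x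
      using has_sum_cmult_right[OF nn[OF v(1)], of "norm (u x)"] by (simp add: norm_mult)
    show "(\<lambda>x. norm (u x) * (\<Sum>n. norm (v n))) summable_on UNIV"
      using has_sum_cmult_left[OF nn[OF u(1)]] by (auto simp: summable_on_def)
  qed simp
  then have s: "(\<lambda>p. u (fst p) * v (snd p)) summable_on (UNIV \<times> UNIV)"
    by (rule abs_summable_summable)
  have "((\<lambda>p. u (fst p) * v (snd p)) has_sum a * b) (UNIV \<times> UNIV)"
  proof (rule has_sum_SigmaI[OF _ _ s])
    show "((\<lambda>y. u (fst (x, y)) * v (snd (x, y))) has_sum u x * b) UNIV" for x
      using has_sum_cmult_right[OF norm_summable_imp_has_sum[OF v], of "u x"] by simp
    show "((\<lambda>x. u x * b) has_sum a * b) UNIV"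
      by (rule has_sum_cmult_left[OF norm_summable_imp_has_sum[OF u]])
  qed
  then show ?thesis by (simp add: case_prod_unfold)
qed

lemma has_sum_finite_sum:
  fixes f :: "'j \<Rightarrow> 'a \<Rightarrow> complex"
  assumes "\<And>j. j \<in> J \<Longrightarrow> (f j has_sum b j) A"
  shows "((\<lambda>x. \<Sum>j\<in>J. f j x) has_sum (\<Sum>j\<in>J. b j)) A"
  using assms by (induction J rule: infinite_finite_induct) (auto intro: has_sum_add)

lemma sum_cmod_sq_eq_0: "finite J \<Longrightarrow> (\<Sum>j\<in>J. x j * cnj (x j)) = 0 \<Longrightarrow> j \<in> J \<Longrightarrow> x j = 0"
proof -
  assume J: "finite J" and s: "(\<Sum>j\<in>J. x j * cnj (x j)) = 0" and j: "j \<in> J"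
  have "of_real (\<Sum>j\<in>J. (cmod (x j))\<^sup>2) = (0::complex)"
    using s by (simp only: of_real_sum complex_norm_square)
  then have "(\<Sum>j\<in>J. (cmod (x j))\<^sup>2) = 0" by (simp only: of_real_eq_0_iff)
  then have "\<forall>j\<in>J. (cmod (x j))\<^sup>2 = 0"
    using J by (subst (asm) sum_nonneg_eq_0_iff) auto
  with j show "x j = 0" by auto
qed

text \<open>
  Let \<open>g\<^sub>j(s) = \<Sum> a\<^sub>j\<^sub>p s\<^sup>p\<close>. The coefficient of \<open>s\<^sup>p\<close> times its conjugate in \<open>\<Sum> |g\<^sub>j|\<^sup>2\<close> is \<open>\<Sum>\<^sub>j |a\<^sub>j\<^sub>p|\<^sup>2\<close>,
  and by uniqueness of the expansion it is 0 for \<open>p > d\<close>.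
\<close>

lemma holomorphic_polynomial_if_sqnorm_polynomial:
  fixes g :: "'j \<Rightarrow> complex \<Rightarrow> complex"
  assumes J: "finite J" and \<rho>: "\<rho> > 0" and hol: "\<And>j. j \<in> J \<Longrightarrow> g j holomorphic_on ball 0 \<rho>"
    and sq: "\<And>s. s \<in> ball 0 \<rho> \<Longrightarrow>
      of_real (\<Sum>j\<in>J. (cmod (g j s))\<^sup>2) = (\<Sum>(p, q)\<in>{..d} \<times> {..d}. c p q * s ^ p * cnj s ^ q)"
  shows "\<exists>P. \<forall>j\<in>J. degree (P j) \<le> d \<and> (\<forall>s\<in>ball 0 \<rho>. g j s = poly (P j) s)"
proof -
  define a where "a = (\<lambda>j n. (deriv ^^ n) (g j) 0 / fact n)"
  have a: "(\<lambda>n. a j n * s ^ n) sums g j s" if "j \<in> J" "s \<in> ball 0 \<rho>" for j s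
    using holomorphic_power_series[OF hol[OF that(1)] that(2)] by (simp add: a_def)
  have an: "summable (\<lambda>n. norm (a j n * s ^ n))" if j: "j \<in> J" and s: "s \<in> ball 0 \<rho>" for j s
  proof -
    define t where "t = complex_of_real ((norm s + \<rho>) / 2)"
    have nt: "norm t = (norm s + \<rho>) / 2"
      unfolding t_def norm_of_real using \<rho> by simp
    have "t \<in> ball 0 \<rho>" "norm s < norm t" using s unfolding mem_ball_0 nt by auto
    with a[OF j] show ?thesis by (intro powser_insidea[of "a j" t s]) (auto simp: sums_iff)
  qed
  define b where "b = (\<lambda>p q. (\<Sum>j\<in>J. a j p * cnj (a j q)) - (if (p, q) \<in> {..d} \<times> {..d} then c p q else 0))"
  have expansion: "((\<lambda>(p, q). b p q * (s ^ p * cnj s ^ q)) has_sum 0) UNIV" if s: "s \<in> ball 0 \<rho>" for s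
  proof -
    have "((\<lambda>x. \<Sum>j\<in>J. (\<lambda>(p, q). (a j p * s ^ p) * cnj (a j q * s ^ q)) x) has_sum (\<Sum>j\<in>J. g j s * cnj (g j s))) UNIV"
    proof (rule has_sum_finite_sum)
      fix j assume j: "j \<in> J"
      show "((\<lambda>(p, q). (a j p * s ^ p) * cnj (a j q * s ^ q)) has_sum g j s * cnj (g j s)) UNIV"
        using an[OF j s] a[OF j s]
        by (intro has_sum_times) (auto simp flip: complex_cnj_mult complex_cnj_power simp: sums_cnj complex_mod_cnj)
    qed
    moreover have "((\<lambda>(p, q). if (p, q) \<in> {..d} \<times> {..d} then c p q * s ^ p * cnj s ^ q else 0) has_sum
        (\<Sum>j\<in>J. g j s * cnj (g j s))) UNIV"
    proof -
      have "(\<Sum>j\<in>J. g j s * cnj (g j s)) = (\<Sum>(p, q)\<in>{..d} \<times> {..d}. c p q * s ^ p * cnj s ^ q)"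
        using sq[OF s] by (simp only: of_real_sum complex_norm_square)
      then have "((\<lambda>(p, q). c p q * s ^ p * cnj s ^ q) has_sum (\<Sum>j\<in>J. g j s * cnj (g j s))) ({..d} \<times> {..d})"
        by (intro has_sum_finiteI) auto
      then show ?thesis
        by (rule iffD1[OF has_sum_cong_neutral, rotated -1]) (auto split: if_splits)
    qed
    ultimately have hs: "((\<lambda>x. (\<Sum>j\<in>J. (\<lambda>(p, q). (a j p * s ^ p) * cnj (a j q * s ^ q)) x)
        + (-1) * (\<lambda>(p, q). if (p, q) \<in> {..d} \<times> {..d} then c p q * s ^ p * cnj s ^ q else 0) x) has_sum
        (\<Sum>j\<in>J. g j s * cnj (g j s)) + (-1) * (\<Sum>j\<in>J. g j s * cnj (g j s))) UNIV"
      by (intro has_sum_add has_sum_cmult_right)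
    have eq: "(\<lambda>x. (\<Sum>j\<in>J. (\<lambda>(p, q). (a j p * s ^ p) * cnj (a j q * s ^ q)) x)
        + (-1) * (\<lambda>(p, q). if (p, q) \<in> {..d} \<times> {..d} then c p q * s ^ p * cnj s ^ q else 0) x)
        = (\<lambda>(p, q). b p q * (s ^ p * cnj s ^ q))"
    proof
      fix x :: "nat \<times> nat"
      obtain p q where x: "x = (p, q)" by (cases x)
      have "(\<Sum>j\<in>J. a j p * s ^ p * cnj (a j q * s ^ q)) = (\<Sum>j\<in>J. a j p * cnj (a j q)) * (s ^ p * cnj s ^ q)"
        unfolding sum_distrib_right by (intro sum.cong refl) simp
      then show "(\<Sum>j\<in>J. (\<lambda>(p, q). a j p * s ^ p * cnj (a j q * s ^ q)) x)
          + (-1) * (\<lambda>(p, q). if (p, q) \<in> {..d} \<times> {..d} then c p q * s ^ p * cnj s ^ q else 0) x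
          = (\<lambda>(p, q). b p q * (s ^ p * cnj s ^ q)) x"
        unfolding b_def left_diff_distrib x by simp
    qed
    show ?thesis using hs unfolding eq by simp
  qed
  have b: "b p q = 0" for p q
  proof -
    have "(\<lambda>(p, q). b p q) (p, q) = 0"
    proof (rule graded_characters_expansion_unique[where \<phi> = "\<lambda>(p, q) s. s ^ p * cnj s ^ q"
          and g = "\<lambda>(p, q). p + q" and e = 1 and mul = "(*)"])
      show "finite {x. (\<lambda>(p, q). p + q) x = m}" for m :: nat
        by (rule finite_subset[of _ "{..m} \<times> {..m}"]) auto
      fix z :: complex
      define r where "r = \<rho> / (1 + norm z)"
      have "((\<lambda>x. (\<lambda>(p, q). b p q) x * (\<lambda>(p, q) s. s ^ p * cnj s ^ q) x (t *\<^sub>R z)) has_sum 0) UNIV" if "\<bar>t\<bar> < r" for t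
      proof -
        have "\<bar>t\<bar> * norm z \<le> \<bar>t\<bar> * (1 + norm z)" by (simp add: mult_left_mono)
        also have "\<dots> < \<rho>"
          using that unfolding r_def by (subst (asm) pos_less_divide_eq) (auto simp: add_pos_nonneg)
        finally have "t *\<^sub>R z \<in> ball 0 \<rho>" by simp
        from expansion[OF this] show ?thesis by (simp add: case_prod_unfold)
      qed
      moreover have "r > 0" using \<rho> by (simp add: r_def add_pos_nonneg)
      ultimately show "\<exists>r>0. \<forall>t. \<bar>t\<bar> < r \<longrightarrow>
          ((\<lambda>x. (\<lambda>(p, q). b p q) x * (\<lambda>(p, q) s. s ^ p * cnj s ^ q) x (t *\<^sub>R z)) has_sum 0) UNIV"
        by blast
    next
      fix x y :: "nat \<times> nat" assume "x \<noteq> y"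
      then show "\<exists>w. (\<lambda>(p, q) s. s ^ p * cnj s ^ q) x w \<noteq> (\<lambda>(p, q) s. s ^ p * cnj s ^ q) y w"
        using monomial_characters_distinct[of "fst x" "snd x" "fst y" "snd y"] by (simp add: case_prod_unfold)
    qed (simp_all add: case_prod_unfold power_add power_mult_distrib scaleR_conv_of_real)
    then show ?thesis by simp
  qed
  have a0: "a j p = 0" if "j \<in> J" "p > d" for j p
    using b[of p p] that sum_cmod_sq_eq_0[OF J _ that(1), of "\<lambda>j. a j p"] by (simp add: b_def)
  show ?thesis
  proof (intro exI ballI conjI)
    fix j assume j: "j \<in> J"
    show "degree (\<Sum>p\<le>d. monom (a j p) p) \<le> d"
      by (rule degree_sum_le) (auto intro: order_trans[OF degree_monom_le])
    fix s :: complex assume s: "s \<in> ball 0 \<rho>"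
    have "(\<lambda>n. a j n * s ^ n) sums (\<Sum>p\<le>d. a j p * s ^ p)"
      by (rule sums_finite) (auto simp: a0[OF j])
    from sums_unique2[OF a[OF j s] this] show "g j s = poly (\<Sum>p\<le>d. monom (a j p) p) s"
      by (simp add: poly_sum poly_monom)
  qed
qed

section \<open>From polynomial slices to polynomial maps\<close>

text \<open>
  The same interpolating polynomials serve all \<open>P\<close>. This turns the coefficients of a polynomial slice into
  fixed combinations of its values at the nodes.
\<close>

lemma lagrange_interpolation:
  fixes T :: "complex set"
  assumes "finite T" "card T = Suc d"
  obtains L where "\<And>P. degree P \<le> d \<Longrightarrow> P = (\<Sum>t\<in>T. smult (poly P t) (L t))"
proof
  define L where "L = (\<lambda>t. \<Prod>u\<in>T - {t}. smult (1 / (t - u)) [:-u, 1:])"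
  have deg: "degree (L t) \<le> d" if "t \<in> T" for t
  proof -
    have "degree (L t) \<le> (\<Sum>u\<in>T - {t}. degree (smult (1 / (t - u)) [:-u, 1:]))"
      unfolding L_def using degree_prod_sum_le[of "T - {t}" "\<lambda>u. smult (1 / (t - u)) [:-u, 1:]"] assms(1)
      by (simp only: o_def finite_Diff)
    also have "\<dots> \<le> (\<Sum>u\<in>T - {t}. 1)" by (rule sum_mono) auto
    also have "\<dots> = d" using assms that by simp
    finally show ?thesis .
  qed
  have val: "poly (L t) u = (if u = t then 1 else 0)" if tu: "t \<in> T" "u \<in> T" for t u
  proof -
    have L: "poly (L t) u = (\<Prod>v\<in>T - {t}. (u - v) / (t - v))"
      unfolding L_def poly_prod by (rule prod.cong) (auto simp: diff_divide_distrib)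
    show ?thesis
    proof (cases "u = t")
      case True
      have "(\<Prod>v\<in>T - {t}. (t - v) / (t - v)) = 1" by (rule prod.neutral) auto
      then show ?thesis using L True by simp
    next
      case False
      then have "(\<Prod>v\<in>T - {t}. (u - v) / (t - v)) = 0"
        using tu assms(1) by (intro prod_zero) auto
      then show ?thesis using L False by simp
    qed
  qed
  fix P :: "complex poly" assume P: "degree P \<le> d"
  show "P = (\<Sum>t\<in>T. smult (poly P t) (L t))"
  proof (rule poly_eqI_degree[of T])
    have "degree (\<Sum>t\<in>T. smult (poly P t) (L t)) \<le> d"
      by (rule degree_sum_le) (use assms deg in \<open>auto intro: order_trans[OF degree_smult_le]\<close>)
    then show "degree (\<Sum>t\<in>T. smult (poly P t) (L t)) < card T" using assms by simp
    show "degree P < card T" using P assms by simp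
    show "poly P u = poly (\<Sum>t\<in>T. smult (poly P t) (L t)) u" if "u \<in> T" for u
      using that assms(1) by (simp add: poly_sum val if_distrib[of "\<lambda>x. _ * x"] cong: if_cong)
  qed
qed

definition upd :: "complex ^ 'n::finite \<Rightarrow> 'n \<Rightarrow> complex \<Rightarrow> complex ^ 'n" where
  "upd z i s = (\<chi> j. if j = i then s else z $ j)"

text \<open>
  Interpolation in the coordinate \<open>i\<close> gives \<open>f(z) = \<Sum>\<^sub>t f(z with z\<^sub>i = t) L\<^sub>t(z\<^sub>i)\<close>, where the values at the
  nodes no longer depend on \<open>z\<^sub>i\<close>. Induction on the set of coordinates on which \<open>f\<close> depends finishes the
  argument; on a polydisc the substituted points stay in the domain.
\<close>

lemma separately_polynomial:
  fixes f :: "complex ^ 'n::finite \<Rightarrow> complex"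
  assumes \<rho>: "\<rho> > 0"
    and sep: "\<And>z i. (\<forall>i. cmod (z $ i) < \<rho>) \<Longrightarrow>
      \<exists>P. degree P \<le> d \<and> (\<forall>s\<in>ball 0 \<rho>. f (upd z i s) = poly P s)"
  shows "\<exists>p\<in>polyfun. \<forall>z. (\<forall>i. cmod (z $ i) < \<rho>) \<longrightarrow> f z = p z"
proof -
  define D where "D = {z :: complex ^ 'n. \<forall>i. cmod (z $ i) < \<rho>}"
  have updD: "upd z i s \<in> D" if "z \<in> D" "s \<in> ball 0 \<rho>" for z i s
    using that by (simp add: D_def upd_def)
  obtain T :: "complex set" where T: "finite T" "card T = Suc d" "T \<subseteq> ball 0 \<rho>"
  proof -
    have "infinite (ball (0::complex) \<rho>)"
      using uncountable_ball[OF \<rho>, of "0::complex"] countable_finite by auto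
    from infinite_arbitrarily_large[OF this, of "Suc d"] show ?thesis using that by blast
  qed
  obtain L where L: "\<And>P. degree P \<le> d \<Longrightarrow> P = (\<Sum>t\<in>T. smult (poly P t) (L t))"
    using lagrange_interpolation[OF T(1,2)] by blast
  have poly_coord: "(\<lambda>z :: complex ^ 'n. poly P (z $ i)) \<in> polyfun" for P i
    unfolding poly_altdef
    by (rule polyfun_sum, rule polyfun_mult, rule polyfun_const, rule polyfun_power, rule polyfun_coord)
  have "\<exists>p\<in>polyfun. \<forall>z\<in>D. f z = p z"
    if "finite S"
      "\<And>z i. z \<in> D \<Longrightarrow> \<exists>P. degree P \<le> d \<and> (\<forall>s\<in>ball 0 \<rho>. f (upd z i s) = poly P s)"
      "\<And>z w. z \<in> D \<Longrightarrow> w \<in> D \<Longrightarrow> (\<And>i. i \<in> S \<Longrightarrow> z $ i = w $ i) \<Longrightarrow> f z = f w" for S f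
    using that
  proof (induction S arbitrary: f rule: finite_induct)
    case empty
    have "0 \<in> D" using \<rho> by (simp add: D_def)
    then have "\<forall>z\<in>D. f z = f 0" using empty.prems(2)[of _ 0] by blast
    then show ?case by (intro bexI[of _ "\<lambda>_. f 0"] polyfun_const)
  next
    case (insert i S)
    have "\<exists>p. p \<in> polyfun \<and> (\<forall>z\<in>D. f (upd z i t) = p z)" if t: "t \<in> T" for t
      unfolding Bex_def[symmetric]
    proof (rule insert.IH)
      fix z j assume z: "z \<in> D"
      show "\<exists>P. degree P \<le> d \<and> (\<forall>s\<in>ball 0 \<rho>. f (upd (upd z j s) i t) = poly P s)"
      proof (cases "j = i")
        case True
        then have "upd (upd z j s) i t = upd z i t" for s by (simp add: upd_def vec_eq_iff)
        then show ?thesis by (intro exI[of _ "[:f (upd z i t):]"]) auto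
      next
        case False
        then have "upd (upd z j s) i t = upd (upd z i t) j s" for s by (simp add: upd_def vec_eq_iff)
        then show ?thesis using insert.prems(1)[of "upd z i t" j] updD z t T by auto
      qed
    next
      fix z w assume zw: "z \<in> D" "w \<in> D" "\<And>i. i \<in> S \<Longrightarrow> z $ i = w $ i"
      show "f (upd z i t) = f (upd w i t)"
        using zw t T by (intro insert.prems(2) updD) (auto simp: upd_def)
    qed
    then have "\<forall>t\<in>T. \<exists>p. p \<in> polyfun \<and> (\<forall>z\<in>D. f (upd z i t) = p z)" by blast
    from bchoice[OF this] obtain p where "\<forall>t\<in>T. p t \<in> polyfun \<and> (\<forall>z\<in>D. f (upd z i t) = p t z)" ..
    then have p: "\<And>t. t \<in> T \<Longrightarrow> p t \<in> polyfun"
      "\<And>t z. t \<in> T \<Longrightarrow> z \<in> D \<Longrightarrow> f (upd z i t) = p t z"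
      by auto
    have "f z = (\<Sum>t\<in>T. p t z * poly (L t) (z $ i))" if z: "z \<in> D" for z
    proof -
      obtain P where P: "degree P \<le> d" "\<And>s. s \<in> ball 0 \<rho> \<Longrightarrow> f (upd z i s) = poly P s"
        using insert.prems(1)[OF z, of i] by blast
      have "f z = f (upd z i (z $ i))"
        by (rule arg_cong[where f = f]) (simp add: upd_def vec_eq_iff)
      also have "\<dots> = poly P (z $ i)" using z by (intro P) (simp add: D_def)
      also have "\<dots> = (\<Sum>t\<in>T. poly P t * poly (L t) (z $ i))"
        by (subst L[OF P(1)]) (simp add: poly_sum)
      also have "\<dots> = (\<Sum>t\<in>T. p t z * poly (L t) (z $ i))"
      proof (rule sum.cong[OF refl])
        fix t assume t: "t \<in> T"
        then have "poly P t = p t z" using P(2)[of t] p(2)[OF t z] T(3) by auto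
        then show "poly P t * poly (L t) (z $ i) = p t z * poly (L t) (z $ i)" by simp
      qed
      finally show ?thesis .
    qed
    note eq = this
    have pf: "(\<lambda>z. \<Sum>t\<in>T. p t z * poly (L t) (z $ i)) \<in> polyfun"
      by (rule polyfun_sum, rule polyfun_mult[OF p(1) poly_coord])
    show ?case by (rule bexI[OF _ pf], rule ballI, rule eq)
  qed
  note main = this
  have "\<exists>p\<in>polyfun. \<forall>z\<in>D. f z = p z"
  proof (rule main[of UNIV])
    show "\<exists>P. degree P \<le> d \<and> (\<forall>s\<in>ball 0 \<rho>. f (upd z i s) = poly P s)" if "z \<in> D" for z i
      using sep that by (simp add: D_def)
    show "f z = f w" if "\<And>i. i \<in> UNIV \<Longrightarrow> z $ i = w $ i" for z w
      using that by (intro arg_cong[where f = f]) (simp add: vec_eq_iff)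
  qed simp
  then show ?thesis by (simp add: D_def)
qed

lemma norm_vector_smult: "norm (s *s (z :: complex ^ 'n::finite)) = cmod s * norm z"
  by (simp add: norm_vec_def norm_mult L2_set_right_distrib)

text \<open>
  The identity theorem on the complex line through 0 and \<open>z\<close>, which meets the ball in a disc.
\<close>

lemma identity_from_neighbourhood_of_0:
  fixes f p :: "complex ^ 'n::finite \<Rightarrow> complex"
  assumes f: "holomorphic_several f (ball 0 1)" and p: "holomorphic_several p (ball 0 1)"
    and r: "r > 0" and eq: "\<And>z. z \<in> ball 0 1 \<Longrightarrow> norm z < r \<Longrightarrow> f z = p z" and z: "z \<in> ball 0 1"
  shows "f z = p z"
proof (cases "z = 0")
  case True
  then show ?thesis using eq[of 0] r by simp
next
  case False
  then have nz: "norm z > 0" by simp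
  obtain r' where r': "0 < r'" "r' \<le> 1" "r' \<le> r"
    using r by (metis min.cobounded1 min.cobounded2 min_less_iff_conj zero_less_one)
  define S where "S = ball (0::complex) (1 / norm z)"
  define U where "U = ball (0::complex) (r' / norm z)"
  have S: "s *s z \<in> ball 0 1" if "s \<in> S" for s
    using that pos_less_divide_eq[OF nz] by (simp add: S_def norm_vector_smult)
  have hol: "(\<lambda>s. f (0 + s *s z) - p (0 + s *s z)) holomorphic_on S"
    by (rule holomorphic_on_diff; rule holomorphic_several_slice, rule f p, subst add_0_left, erule S)
  have US: "U \<subseteq> S"
    unfolding U_def S_def by (rule subset_ball) (use r' nz in \<open>simp add: divide_right_mono\<close>)
  have zero: "f (0 + s *s z) - p (0 + s *s z) = 0" if s: "s \<in> U" for s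
  proof -
    have "norm (s *s z) < r'" using s pos_less_divide_eq[OF nz] by (simp add: U_def norm_vector_smult)
    moreover have "s *s z \<in> ball 0 1" using S US s by blast
    ultimately show ?thesis using eq[of "s *s z"] r' by simp
  qed
  have lim: "0 islimpt U"
    by (rule interior_limit_point) (use nz r' in \<open>simp add: U_def interior_open\<close>)
  have "f (0 + 1 *s z) - p (0 + 1 *s z) = 0"
    by (rule analytic_continuation[OF hol _ _ US _ lim zero])
      (use nz z in \<open>auto simp: S_def\<close>)
  then show ?thesis by simp
qed

lemma upd_slice: "upd z i s = upd z i 0 + s *s axis i 1"
  by (simp add: upd_def axis_def vec_eq_iff)

lemma zpow_upd: "zpow (upd z i s) \<alpha> = s ^ \<alpha> i * zpow (upd z i 1) \<alpha>"
proof -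
  have "zpow (upd z i s) \<alpha> = s ^ \<alpha> i * (\<Prod>j\<in>UNIV - {i}. (z $ j) ^ \<alpha> j)" for s
  proof -
    have "zpow (upd z i s) \<alpha> = (upd z i s $ i) ^ \<alpha> i * (\<Prod>j\<in>UNIV - {i}. (upd z i s $ j) ^ \<alpha> j)"
      unfolding zpow_def by (rule prod.remove) auto
    also have "(\<Prod>j\<in>UNIV - {i}. (upd z i s $ j) ^ \<alpha> j) = (\<Prod>j\<in>UNIV - {i}. (z $ j) ^ \<alpha> j)"
      by (rule prod.cong) (auto simp: upd_def)
    finally show ?thesis by (simp add: upd_def)
  qed
  from this[of s] this[of 1] show ?thesis by simp
qed

lemma component_le_mdeg: "\<alpha> i \<le> mdeg \<alpha>"
  unfolding mdeg_def by (rule member_le_sum) auto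

text \<open>
  Along this line only the exponents of the coordinate \<open>i\<close> matter, and they are at most \<open>d\<close>. This is the
  shape in which the one-variable result on squared norms applies to slices.
\<close>

lemma hform_upd:
  fixes z :: "complex ^ 'n::finite"
  shows "\<exists>b. \<forall>s. hform d c (upd z i s) = (\<Sum>(p, q)\<in>{..d} \<times> {..d}. b p q * s ^ p * cnj s ^ q)"
proof -
  let ?M = "{\<alpha> :: 'n \<Rightarrow> nat. mdeg \<alpha> \<le> d} \<times> {\<alpha> :: 'n \<Rightarrow> nat. mdeg \<alpha> \<le> d}"
  let ?h = "\<lambda>x :: ('n \<Rightarrow> nat) \<times> ('n \<Rightarrow> nat). (fst x i, snd x i)"
  define w where "w = (\<lambda>x. c (fst x) (snd x) * zpow (upd z i 1) (fst x) * cnj (zpow (upd z i 1) (snd x)))"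
  have "hform d c (upd z i s) =
      (\<Sum>(p, q)\<in>{..d} \<times> {..d}. (\<Sum>x\<in>{x \<in> ?M. ?h x = (p, q)}. w x) * s ^ p * cnj s ^ q)" for s
  proof -
    have "hform d c (upd z i s) = (\<Sum>x\<in>?M. w x * s ^ fst x i * cnj s ^ snd x i)"
      unfolding hform_def sum.cartesian_product
      by (intro sum.cong refl) (auto simp: zpow_upd[of z i s] w_def)
    also have "\<dots> = (\<Sum>y\<in>{..d} \<times> {..d}. \<Sum>x\<in>{x \<in> ?M. ?h x = y}. w x * s ^ fst x i * cnj s ^ snd x i)"
    proof (rule sum.group[symmetric])
      show "?h ` ?M \<subseteq> {..d} \<times> {..d}"
        using component_le_mdeg[of _ i] by (fastforce intro: order_trans)
    qed (simp_all add: finite_mdeg_le)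
    also have "\<dots> = (\<Sum>(p, q)\<in>{..d} \<times> {..d}. (\<Sum>x\<in>{x \<in> ?M. ?h x = (p, q)}. w x) * s ^ p * cnj s ^ q)"
      unfolding sum_distrib_right by (intro sum.cong refl) (auto intro!: sum.cong)
    finally show ?thesis .
  qed
  then show ?thesis by (intro exI[of _ "\<lambda>p q. \<Sum>x\<in>{x \<in> ?M. ?h x = (p, q)}. w x"]) blast
qed

lemma norm_le_sum_components: "norm (z :: complex ^ 'n::finite) \<le> (\<Sum>i\<in>UNIV. cmod (z $ i))"
  unfolding norm_vec_def by (rule L2_set_le_sum) auto

text \<open>
  Members of a convex family are only known through their squared norm. This makes them polynomial:
  the slices are polynomials of degree at most \<open>d\<close>, so the map is polynomial on a small polydisc, and
  the identity theorem extends this to the ball.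
\<close>

theorem polynomial_map_if_polynomial_form:
  fixes g :: "complex ^ 'n::finite \<Rightarrow> nat \<Rightarrow> complex"
  assumes hol: "holomorphic_map N g" and c: "polynomial_form d (\<lambda>z. sqnorm N (g z)) c"
  shows "polynomial_map N g"
proof -
  \<comment> \<open>The largest radius for which the triangle inequality puts the polydisc inside the unit ball.\<close>
  define \<rho> :: real where "\<rho> = 1 / CARD('n)"
  have \<rho>: "\<rho> > 0" by (simp add: \<rho>_def)
  have D: "z \<in> ball 0 1" if "\<forall>i. cmod (z $ i) < \<rho>" for z :: "complex ^ 'n"
  proof -
    have "norm z \<le> (\<Sum>i\<in>UNIV. cmod (z $ i))" by (rule norm_le_sum_components)
    also have "\<dots> < (\<Sum>i\<in>(UNIV :: 'n set). \<rho>)" using that by (intro sum_strict_mono) auto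
    also have "\<dots> = 1" by (simp add: \<rho>_def)
    finally show ?thesis by simp
  qed
  have "\<exists>p\<in>polyfun. \<forall>z\<in>ball 0 1. g z j = p z" if j: "j \<in> {1..N}" for j
  proof -
    have "\<exists>P. degree P \<le> d \<and> (\<forall>s\<in>ball 0 \<rho>. g (upd z i s) j = poly P s)"
      if z: "\<forall>i. cmod (z $ i) < \<rho>" for z i
    proof -
      have inD: "upd z i s \<in> ball 0 1" if "s \<in> ball 0 \<rho>" for s
        by (rule D) (use that z in \<open>auto simp: upd_def\<close>)
      obtain b where b: "\<forall>s. hform d c (upd z i s) = (\<Sum>(p, q)\<in>{..d} \<times> {..d}. b p q * s ^ p * cnj s ^ q)"
        using hform_upd by blast
      have "\<exists>P. \<forall>j\<in>{1..N}. degree (P j) \<le> d \<and> (\<forall>s\<in>ball 0 \<rho>. g (upd z i s) j = poly (P j) s)"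
      proof (rule holomorphic_polynomial_if_sqnorm_polynomial[OF _ \<rho>])
        show "(\<lambda>s. g (upd z i s) j) holomorphic_on ball 0 \<rho>" if "j \<in> {1..N}" for j
          using holomorphic_several_slice[of "\<lambda>z. g z j" "ball 0 1" "ball 0 \<rho>" "upd z i 0" "axis i 1"]
            hol inD that by (simp add: holomorphic_map_def flip: upd_slice)
        fix s :: complex assume s: "s \<in> ball 0 \<rho>"
        have "of_real (sqnorm N (g (upd z i s))) = hform d c (upd z i s)"
          using c inD[OF s] by (simp add: polynomial_form_def)
        then show "of_real (\<Sum>j\<in>{1..N}. (cmod (g (upd z i s) j))\<^sup>2) =
            (\<Sum>(p, q)\<in>{..d} \<times> {..d}. b p q * s ^ p * cnj s ^ q)"
          using b by (simp add: sqnorm_def)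
      qed simp
      with j show ?thesis by blast
    qed
    from separately_polynomial[OF \<rho>, of d "\<lambda>z. g z j", OF this]
    obtain p where p: "p \<in> polyfun" "\<And>z. (\<forall>i. cmod (z $ i) < \<rho>) \<Longrightarrow> g z j = p z" by blast
    have "g z j = p z" if "z \<in> ball 0 1" for z
    proof (rule identity_from_neighbourhood_of_0[OF _ _ \<rho> _ that])
      show "holomorphic_several (\<lambda>z. g z j) (ball 0 1)" using hol j by (simp add: holomorphic_map_def)
      show "holomorphic_several p (ball 0 1)"
        using p(1) holomorphic_several_polys_upto by (auto simp: polyfun_def)
      show "g z j = p z" if "norm z < \<rho>" for z
        by (intro p(2) allI) (rule le_less_trans[OF Finite_Cartesian_Product.norm_nth_le that])
    qed
    with p(1) show ?thesis by blast
  qed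
  then have "\<forall>j\<in>{1..N}. \<exists>e p. p \<in> polys_upto e \<and> (\<forall>z\<in>ball 0 1. g z j = p z)"
    unfolding polyfun_def by blast
  from bchoice[OF this] obtain e where e: "\<forall>j\<in>{1..N}. \<exists>p. p \<in> polys_upto (e j) \<and> (\<forall>z\<in>ball 0 1. g z j = p z)" ..
  have "polynomial_map_upto (\<Sum>j=1..N. e j) N g"
    unfolding polynomial_map_upto_def
  proof
    fix j assume j: "j \<in> {1..N}"
    have "e j \<le> (\<Sum>j=1..N. e j)" by (rule member_le_sum) (use j in auto)
    with e j show "\<exists>p\<in>polys_upto (\<Sum>j=1..N. e j). \<forall>z\<in>ball 0 1. g z j = p z"
      by (meson polys_upto_mono)
  qed
  then show ?thesis unfolding polynomial_map_def by blast
qed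

section \<open>Coefficients of polynomial maps\<close>

lemma sqnorm_coeffs_hform:
  fixes a :: "nat \<Rightarrow> ('n::finite \<Rightarrow> nat) \<Rightarrow> complex"
  assumes "\<And>i. i \<in> {1..N} \<Longrightarrow> w i = (\<Sum>\<alpha> | mdeg \<alpha> \<le> d. a i \<alpha> * zpow z \<alpha>)"
  shows "of_real (sqnorm N w) = hform d (\<lambda>\<alpha> \<beta>. \<Sum>i=1..N. a i \<alpha> * cnj (a i \<beta>)) z"
proof -
  have "of_real (sqnorm N w) = (\<Sum>i=1..N. w i * cnj (w i))"
    unfolding sqnorm_def of_real_sum complex_norm_square ..
  also have "\<dots> = (\<Sum>i=1..N. 1 * hform d (\<lambda>\<alpha> \<beta>. a i \<alpha> * cnj (a i \<beta>)) z)"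
  proof (rule sum.cong[OF refl])
    fix i assume i: "i \<in> {1..N}"
    show "w i * cnj (w i) = 1 * hform d (\<lambda>\<alpha> \<beta>. a i \<alpha> * cnj (a i \<beta>)) z"
      unfolding assms[OF i] hform_def cnj_sum sum_product mult_1
      by (intro sum.cong refl) (simp add: mult_ac)
  qed
  also have "\<dots> = hform d (\<lambda>\<alpha> \<beta>. \<Sum>i=1..N. 1 * (a i \<alpha> * cnj (a i \<beta>))) z"
    by (rule hform_sum[symmetric])
  finally show ?thesis by simp
qed

text \<open>
  The form of a polynomial map is a Gram matrix of its coefficient vectors.
\<close>

lemma polynomial_map_upto_coeffs:
  fixes f :: "complex ^ 'n::finite \<Rightarrow> nat \<Rightarrow> complex"
  assumes "polynomial_map_upto d N f"
  shows "\<exists>a. (\<forall>i \<alpha>. d < mdeg \<alpha> \<longrightarrow> a i \<alpha> = 0) \<and>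
    (\<forall>i\<in>{1..N}. \<forall>z\<in>ball 0 1. f z i = (\<Sum>\<alpha> | mdeg \<alpha> \<le> d. a i \<alpha> * zpow z \<alpha>)) \<and>
    polynomial_form d (\<lambda>z. sqnorm N (f z)) (\<lambda>\<alpha> \<beta>. \<Sum>i=1..N. a i \<alpha> * cnj (a i \<beta>))"
proof -
  have "\<forall>i\<in>{1..N}. \<exists>a. \<forall>z\<in>ball 0 1. f z i = (\<Sum>\<alpha> | mdeg \<alpha> \<le> d. a \<alpha> * zpow z \<alpha>)"
    using assms unfolding polynomial_map_upto_def polys_upto_eq by fastforce
  from bchoice[OF this] obtain a0
    where a0: "\<forall>i\<in>{1..N}. \<forall>z\<in>ball 0 1. f z i = (\<Sum>\<alpha> | mdeg \<alpha> \<le> d. a0 i \<alpha> * zpow z \<alpha>)" ..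
  define a where "a = (\<lambda>i \<alpha>. if mdeg \<alpha> \<le> d then a0 i \<alpha> else 0)"
  have a: "a i \<alpha> = 0" if "d < mdeg \<alpha>" for i \<alpha> using that by (simp add: a_def)
  have f: "f z i = (\<Sum>\<alpha> | mdeg \<alpha> \<le> d. a i \<alpha> * zpow z \<alpha>)" if "i \<in> {1..N}" "z \<in> ball 0 1" for i z
    using a0 that by (simp add: a_def)
  have "polynomial_form d (\<lambda>z. sqnorm N (f z)) (\<lambda>\<alpha> \<beta>. \<Sum>i=1..N. a i \<alpha> * cnj (a i \<beta>))"
    unfolding polynomial_form_def
  proof (intro conjI allI impI ballI)
    show "of_real (sqnorm N (f z)) = hform d (\<lambda>\<alpha> \<beta>. \<Sum>i=1..N. a i \<alpha> * cnj (a i \<beta>)) z" if "z \<in> ball 0 1" for z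
      by (rule sqnorm_coeffs_hform) (use f that in auto)
    fix \<alpha> \<beta> assume ne: "(\<Sum>i=1..N. a i \<alpha> * cnj (a i \<beta>)) \<noteq> 0"
    show "mdeg \<alpha> \<le> d"
    proof (rule ccontr)
      assume "\<not> mdeg \<alpha> \<le> d" with ne a show False by simp
    qed
    show "mdeg \<beta> \<le> d"
    proof (rule ccontr)
      assume "\<not> mdeg \<beta> \<le> d" with ne a show False by simp
    qed
  qed
  with a f show ?thesis by (intro exI[of _ a]) simp
qed

text \<open>
  The diagonal entry at \<open>\<alpha>\<close> is the sum of the squared moduli of all coefficients of \<open>z\<^sup>\<alpha>\<close>. So the degree of
  the map can be read off from the form, although the map is not determined by it.
\<close>

lemma polynomial_map_upto_iff_diagonal:
  fixes f :: "complex ^ 'n::finite \<Rightarrow> nat \<Rightarrow> complex"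
  assumes f: "polynomial_map N f" and c: "polynomial_form D (\<lambda>z. sqnorm N (f z)) c"
  shows "polynomial_map_upto d N f \<longleftrightarrow> (\<forall>\<alpha>. d < mdeg \<alpha> \<longrightarrow> c \<alpha> \<alpha> = 0)"
proof
  assume "polynomial_map_upto d N f"
  then obtain a where a: "\<forall>i \<alpha>. d < mdeg \<alpha> \<longrightarrow> a i \<alpha> = 0"
    and "\<forall>i\<in>{1..N}. \<forall>z\<in>ball 0 1. f z i = (\<Sum>\<alpha> | mdeg \<alpha> \<le> d. a i \<alpha> * zpow z \<alpha>)"
    and form: "polynomial_form d (\<lambda>z. sqnorm N (f z)) (\<lambda>\<alpha> \<beta>. \<Sum>i=1..N. a i \<alpha> * cnj (a i \<beta>))"
    by (elim exE conjE polynomial_map_upto_coeffs[elim_format])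
  have "c = (\<lambda>\<alpha> \<beta>. \<Sum>i=1..N. a i \<alpha> * cnj (a i \<beta>))"
    using underlying_form_polynomial[OF c] underlying_form_polynomial[OF form] by simp
  with a show "\<forall>\<alpha>. d < mdeg \<alpha> \<longrightarrow> c \<alpha> \<alpha> = 0" by simp
next
  assume z: "\<forall>\<alpha>. d < mdeg \<alpha> \<longrightarrow> c \<alpha> \<alpha> = 0"
  obtain e where "polynomial_map_upto e N f" using f by (auto simp: polynomial_map_def)
  then obtain a where "\<forall>i \<alpha>. e < mdeg \<alpha> \<longrightarrow> a i \<alpha> = 0"
    and f: "\<forall>i\<in>{1..N}. \<forall>z\<in>ball 0 1. f z i = (\<Sum>\<alpha> | mdeg \<alpha> \<le> e. a i \<alpha> * zpow z \<alpha>)"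
    and form: "polynomial_form e (\<lambda>z. sqnorm N (f z)) (\<lambda>\<alpha> \<beta>. \<Sum>i=1..N. a i \<alpha> * cnj (a i \<beta>))"
    by (elim exE conjE polynomial_map_upto_coeffs[elim_format])
  have ca: "c = (\<lambda>\<alpha> \<beta>. \<Sum>i=1..N. a i \<alpha> * cnj (a i \<beta>))"
    using underlying_form_polynomial[OF c] underlying_form_polynomial[OF form] by simp
  have a: "a i \<alpha> = 0" if "d < mdeg \<alpha>" "i \<in> {1..N}" for i \<alpha>
    by (rule sum_cmod_sq_eq_0[of "{1..N}" "\<lambda>i. a i \<alpha>"]) (use z that ca in auto)
  show "polynomial_map_upto d N f"
    unfolding polynomial_map_upto_def
  proof
    fix i assume i: "i \<in> {1..N}"
    have a2: "mdeg \<alpha> \<le> d" if "a i \<alpha> \<noteq> 0" for \<alpha>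
      by (rule ccontr) (use that a[OF _ i, of \<alpha>] in simp)
    define p where "p = (\<lambda>z :: complex ^ 'n. \<Sum>\<alpha>\<in>{\<alpha>. mdeg \<alpha> \<le> e \<and> mdeg \<alpha> \<le> d}. a i \<alpha> * zpow z \<alpha>)"
    have "p \<in> polys_upto d"
      unfolding p_def by (rule polys_upto_sumI) (auto intro: finite_subset[OF _ finite_mdeg_le[of e]])
    moreover have "f z i = p z" if "z \<in> ball 0 1" for z
      unfolding f[rule_format, OF i that] p_def
      by (rule sum.mono_neutral_right) (auto simp: finite_mdeg_le dest: a2)
    ultimately show "\<exists>p\<in>polys_upto d. \<forall>z\<in>ball 0 1. f z i = p z" by blast
  qed
qed

section \<open>Properness and the unit sphere\<close>

lemma continuous_on_sqnorm: "continuous_on S (\<lambda>w. sqnorm N w)"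
proof -
  have c: "continuous_on S (\<lambda>w :: nat \<Rightarrow> complex. w i)" for i
    by (rule continuous_on_subset[OF continuous_on_product_coordinates]) simp
  show ?thesis unfolding sqnorm_def by (intro continuous_intros c)
qed

text \<open>
  Closed balls of the target are the compact sets that test properness. In the product topology they are
  closed subsets of a product of discs and points.
\<close>

lemma compact_sqnorm_le: "compact {w \<in> coord_space N. sqnorm N w \<le> r}"
proof -
  define B where "B = (\<lambda>i::nat. if i \<in> {1..N} then cball (0::complex) (sqrt r) else {0})"
  have "compactin (product_topology (\<lambda>i. euclidean) UNIV) (PiE UNIV B)"
    by (subst compactin_PiE) (auto simp: B_def)
  then have cpt: "compact (Pi UNIV B)"
    by (simp add: euclidean_product_topology PiE_UNIV_domain)
  have "closed {w :: nat \<Rightarrow> complex. sqnorm N w \<le> r}"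
    by (intro closed_Collect_le continuous_on_sqnorm continuous_intros)
  from compact_Int_closed[OF cpt this]
  have "compact (Pi UNIV B \<inter> {w. sqnorm N w \<le> r})" .
  moreover have "Pi UNIV B \<inter> {w. sqnorm N w \<le> r} = {w \<in> coord_space N. sqnorm N w \<le> r}"
  proof (intro set_eqI iffI)
    fix w assume w: "w \<in> {w \<in> coord_space N. sqnorm N w \<le> r}"
    have "cmod (w i) \<le> sqrt r" if "i \<in> {1..N}" for i
    proof -
      have "(cmod (w i))\<^sup>2 \<le> sqnorm N w"
        unfolding sqnorm_def using that by (intro member_le_sum) auto
      then show ?thesis using w by (intro real_le_rsqrt) simp
    qed
    with w show "w \<in> Pi UNIV B \<inter> {w. sqnorm N w \<le> r}"
      by (auto simp: B_def coord_space_def)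
  qed (auto simp: B_def coord_space_def Pi_def split: if_splits)
  ultimately show ?thesis by simp
qed

lemma continuous_on_hform: "continuous_on S (hform d c)"
  unfolding hform_def[abs_def] by (intro continuous_intros continuous_on_zpow)

lemma approach_sphere: "(\<lambda>n. (1 - inverse (real (Suc n))) *\<^sub>R \<zeta>) \<longlonglongrightarrow> (\<zeta> :: 'a::real_normed_vector)"
proof -
  have "(\<lambda>n. (1 - inverse (real (Suc n))) *\<^sub>R \<zeta>) \<longlonglongrightarrow> (1 - 0) *\<^sub>R \<zeta>"
    by (intro tendsto_intros LIMSEQ_inverse_real_of_nat)
  then show ?thesis by simp
qed

lemma approach_sphere_in_ball:
  "norm \<zeta> = 1 \<Longrightarrow> (1 - inverse (real (Suc n))) *\<^sub>R \<zeta> \<in> ball 0 1"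
proof -
  assume \<zeta>: "norm \<zeta> = 1"
  define i where "i = inverse (real (Suc n))"
  have "0 < i" "i \<le> 1" by (simp_all add: i_def field_simps)
  then show ?thesis unfolding i_def[symmetric] using \<zeta> by simp
qed

text \<open>
  A map is only given on the open ball; the values of its form on the sphere are radial limits.
\<close>

lemma hform_sphere_limit:
  assumes "polynomial_form d R c" "norm \<zeta> = 1"
  shows "(\<lambda>n. complex_of_real (R ((1 - inverse (real (Suc n))) *\<^sub>R \<zeta>))) \<longlonglongrightarrow> hform d c \<zeta>"
proof -
  have "isCont (hform d c) \<zeta>"
    using continuous_on_hform[of UNIV d c] by (simp add: continuous_on_eq_continuous_at)
  from isCont_tendsto_compose[OF this approach_sphere]
  moreover have "complex_of_real (R ((1 - inverse (real (Suc n))) *\<^sub>R \<zeta>)) =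
      hform d c ((1 - inverse (real (Suc n))) *\<^sub>R \<zeta>)" for n
    using assms(1) approach_sphere_in_ball[OF assms(2)] unfolding polynomial_form_def by blast
  ultimately show ?thesis by (simp only:)
qed

text \<open>
  If the radial limit at \<open>\<zeta>\<close> were less than \<open>r < 1\<close>, then the preimage of the closed ball of squared radius
  \<open>r\<close> would contain points of the ball converging to \<open>\<zeta>\<close>, and would not be compact.
\<close>

lemma proper_imp_hform_1_on_sphere:
  assumes f: "proper_holomorphic_map N f" and c: "polynomial_form d (\<lambda>z. sqnorm N (f z)) c"
    and \<zeta>: "norm \<zeta> = 1"
  shows "hform d c \<zeta> = 1"
proof -
  define X where "X = (\<lambda>n. (1 - inverse (real (Suc n))) *\<^sub>R \<zeta>)"
  define u where "u = (\<lambda>n. sqnorm N (f (X n)))"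
  have X: "X n \<in> ball 0 1" for n using approach_sphere_in_ball[OF \<zeta>] by (simp add: X_def)
  have Xlim: "X \<longlonglongrightarrow> \<zeta>" unfolding X_def by (rule approach_sphere)
  have lim: "(\<lambda>n. complex_of_real (u n)) \<longlonglongrightarrow> hform d c \<zeta>"
    using hform_sphere_limit[OF c \<zeta>] by (simp add: u_def X_def)
  have Im: "Im (hform d c \<zeta>) = 0"
    using tendsto_Im[OF lim] by (simp add: LIMSEQ_const_iff)
  have Re: "u \<longlonglongrightarrow> Re (hform d c \<zeta>)"
    using tendsto_Re[OF lim] by simp
  have fX: "f (X n) \<in> target_ball N" for n
    using f X by (auto simp: proper_holomorphic_map_def)
  then have "u n \<le> 1" for n using fX[of n] by (simp add: u_def target_ball_def less_imp_le)
  then have le: "Re (hform d c \<zeta>) \<le> 1"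
    using Re by (intro LIMSEQ_le_const2) auto
  have "\<not> Re (hform d c \<zeta>) < 1"
  proof
    assume "Re (hform d c \<zeta>) < 1"
    then obtain r where r: "Re (hform d c \<zeta>) < r" "r < 1" using dense by blast
    define C where "C = {w \<in> coord_space N. sqnorm N w \<le> r}"
    have "C \<subseteq> target_ball N" using r by (auto simp: C_def target_ball_def)
    moreover have "compact C" unfolding C_def by (rule compact_sqnorm_le)
    ultimately have "compact {z \<in> ball 0 1. f z \<in> C}"
      using f by (simp add: proper_holomorphic_map_iff_compact_preimages)
    then have cl: "closed {z \<in> ball 0 1. f z \<in> C}" by (rule compact_imp_closed)
    have "\<forall>\<^sub>F n in sequentially. u n < r" using order_tendstoD(2)[OF Re r(1)] .
    then have "\<forall>\<^sub>F n in sequentially. X n \<in> {z \<in> ball 0 1. f z \<in> C}"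
      by eventually_elim (use X fX in \<open>auto simp: C_def u_def target_ball_def\<close>)
    from Lim_in_closed_set[OF cl this _ Xlim] have "\<zeta> \<in> ball 0 1" by simp
    with \<zeta> show False by simp
  qed
  with le have "Re (hform d c \<zeta>) = 1" by simp
  with Im show ?thesis by (simp add: complex_eq_iff)
qed

lemma cmod_sum_mult_cnj_le:
  "cmod (\<Sum>i=1..N. x i * cnj (y i)) \<le> sqrt (sqnorm N x) * sqrt (sqnorm N y)"
proof -
  have "cmod (\<Sum>i=1..N. x i * cnj (y i)) \<le> (\<Sum>i=1..N. \<bar>cmod (x i)\<bar> * \<bar>cmod (y i)\<bar>)"
    by (rule order_trans[OF norm_sum]) (simp add: norm_mult)
  also have "\<dots> \<le> L2_set (\<lambda>i. cmod (x i)) {1..N} * L2_set (\<lambda>i. cmod (y i)) {1..N}"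
    by (rule L2_set_mult_ineq)
  finally show ?thesis by (simp add: L2_set_def sqnorm_def)
qed

lemma sqnorm_nonneg: "sqnorm N w \<ge> 0"
  unfolding sqnorm_def by (intro sum_nonneg) auto

text \<open>
  Restrict to the disc through \<open>z\<close> and pair \<open>F\<close> with the fixed vector \<open>F(z)\<close>. By the maximum principle the
  resulting function \<open>h\<close> is bounded by \<open>B = \<parallel>F(z)\<parallel>\<close>, and it vanishes at 0, so Schwarz's lemma gives
  \<open>B\<^sup>2 = |h(\<parallel>z\<parallel>)| \<le> B\<parallel>z\<parallel>\<close>.
\<close>

lemma sqnorm_less_1_in_ball:
  fixes F :: "complex ^ 'n::finite \<Rightarrow> nat \<Rightarrow> complex"
  assumes hol: "\<And>i. holomorphic_several (\<lambda>z. F z i) UNIV"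
    and F0: "sqnorm N (F 0) = 0" and sphere: "\<And>\<zeta>. norm \<zeta> = 1 \<Longrightarrow> sqnorm N (F \<zeta>) = 1"
    and z: "z \<in> ball 0 1"
  shows "sqnorm N (F z) < 1"
proof (cases "z = 0")
  case True
  then show ?thesis using F0 by simp
next
  case False
  then have nz: "norm z > 0" by simp
  define u where "u = of_real (1 / norm z) *s z"
  have nu: "norm u = 1" using nz by (simp add: u_def norm_vector_smult norm_divide)
  have uz: "of_real (norm z) *s u = z" using nz by (simp add: u_def)
  define B where "B = sqrt (sqnorm N (F z))"
  have B: "B \<ge> 0" "B\<^sup>2 = sqnorm N (F z)" by (simp_all add: B_def sqnorm_nonneg)
  define h where "h = (\<lambda>s. \<Sum>i=1..N. F (s *s u) i * cnj (F z i))"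
  have holh: "h holomorphic_on S" for S
  proof -
    have "(\<lambda>s. F (0 + s *s u) i) holomorphic_on S" for i
      by (rule holomorphic_several_slice[OF hol]) simp
    then show ?thesis unfolding h_def by (auto intro!: holomorphic_intros)
  qed
  have h0: "h 0 = 0"
  proof -
    have "cmod (h 0) \<le> sqrt (sqnorm N (F (0 *s u))) * sqrt (sqnorm N (F z))"
      unfolding h_def by (rule cmod_sum_mult_cnj_le)
    then show ?thesis using F0 by simp
  qed
  have hz: "h (of_real (norm z)) = of_real (B\<^sup>2)"
    unfolding h_def uz B(2) sqnorm_def of_real_sum complex_norm_square ..
  have bound: "cmod (h s) \<le> B" if "cmod s < 1" for s
  proof (rule maximum_modulus_frontier[of h "ball 0 1"])
    show "continuous_on (closure (ball 0 1)) h" by (rule holomorphic_on_imp_continuous_on[OF holh])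
    fix s :: complex assume "s \<in> frontier (ball 0 1)"
    then have "norm (s *s u) = 1" by (simp add: norm_vector_smult nu)
    then have "sqnorm N (F (s *s u)) = 1" by (rule sphere)
    then show "cmod (h s) \<le> B"
      using cmod_sum_mult_cnj_le[where N = N and x = "F (s *s u)" and y = "F z"] by (simp add: h_def B_def)
  qed (use holh that in auto)
  show ?thesis
  proof (rule ccontr)
    assume "\<not> sqnorm N (F z) < 1"
    then have B1: "B \<ge> 1" by (simp add: B_def)
    \<comment> \<open>Schwarz's lemma needs a strict bound, so \<open>h\<close> is divided by a number slightly larger than \<open>B\<close>.\<close>
    have "B * norm z < B * 1" using B1 z by (intro mult_strict_left_mono) auto
    then have "B < B * (B / norm z)" using nz B1 by (simp add: field_simps)
    then obtain B' where B': "B < B'" "B' < B * (B / norm z)" using dense by blast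
    have "norm ((\<lambda>s. h s / of_real B') (of_real (norm z))) \<le> norm (of_real (norm z) :: complex)"
    proof (rule Schwarz_Lemma(1))
      show "(\<lambda>s. h s / of_real B') holomorphic_on ball 0 1"
        using B' B1 by (intro holomorphic_intros holh) auto
      show "norm (h s / of_real B') < 1" if "norm s < 1" for s
        using bound[OF that] B' B1 by (simp add: norm_divide field_simps)
    qed (use h0 z in auto)
    then have "B\<^sup>2 \<le> norm z * B'" using B' B1 unfolding hz by (simp add: norm_divide norm_power field_simps)
    moreover have "norm z * B' < B\<^sup>2" using B' nz by (simp add: field_simps power2_eq_square)
    ultimately show False by simp
  qed
qed

text \<open>
  The polynomial extension of \<open>f\<close> to the closed ball maps the sphere outside the open target ball. So the
  preimage of a compact set is a closed subset of the closed ball.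
\<close>

lemma proper_if_hform_1_on_sphere:
  fixes f :: "complex ^ 'n::finite \<Rightarrow> nat \<Rightarrow> complex"
  assumes poly: "polynomial_map_upto d N f" and c: "polynomial_form D (\<lambda>z. sqnorm N (f z)) c"
    and sphere: "\<And>\<zeta>. norm \<zeta> = 1 \<Longrightarrow> hform D c \<zeta> = 1"
    and f0: "sqnorm N (f 0) = 0" and coord: "\<And>z. z \<in> ball 0 1 \<Longrightarrow> f z \<in> coord_space N"
  shows "proper_holomorphic_map N f"
proof -
  obtain a where a: "\<forall>i\<in>{1..N}. \<forall>z\<in>ball 0 1. f z i = (\<Sum>\<alpha> | mdeg \<alpha> \<le> d. a i \<alpha> * zpow z \<alpha>)"
    and form: "polynomial_form d (\<lambda>z. sqnorm N (f z)) (\<lambda>\<alpha> \<beta>. \<Sum>i=1..N. a i \<alpha> * cnj (a i \<beta>))"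
    using polynomial_map_upto_coeffs[OF poly] by (elim exE conjE)
  define F where "F = (\<lambda>z i. if i \<in> {1..N} then \<Sum>\<alpha> | mdeg \<alpha> \<le> d. a i \<alpha> * zpow z \<alpha> else 0)"
  have Fp: "(\<lambda>z. F z i) \<in> polys_upto d" for i
  proof (cases "i \<in> {1..N}")
    case True
    then have "(\<lambda>z. F z i) = (\<lambda>z. \<Sum>\<alpha> | mdeg \<alpha> \<le> d. a i \<alpha> * zpow z \<alpha>)" by (auto simp: F_def)
    then show ?thesis using polys_upto_sumI[OF finite_mdeg_le, of d "\<lambda>\<alpha>. \<alpha>" d] by simp
  next
    case False
    then have "(\<lambda>z. F z i) = (\<lambda>z. 0)" by (auto simp: F_def)
    then show ?thesis by (simp add: polys_upto_const)
  qed
  have fF: "f z = F z" if "z \<in> ball 0 1" for z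
  proof
    fix i show "f z i = F z i"
    proof (cases "i \<in> {1..N}")
      case False
      with coord[OF that] have "f z i = 0" by (simp add: coord_space_def)
      moreover have "F z i = 0" unfolding F_def using False by (simp only: if_False)
      ultimately show ?thesis by simp
    qed (use a that in \<open>simp add: F_def\<close>)
  qed
  have Fs: "sqnorm N (F \<zeta>) = 1" if \<zeta>: "norm \<zeta> = 1" for \<zeta>
  proof -
    have "of_real (sqnorm N (F \<zeta>)) = hform d (\<lambda>\<alpha> \<beta>. \<Sum>i=1..N. a i \<alpha> * cnj (a i \<beta>)) \<zeta>"
      by (rule sqnorm_coeffs_hform) (simp add: F_def)
    also have "\<dots> = hform D c \<zeta>"
      using hform_sphere_limit[OF form \<zeta>] hform_sphere_limit[OF c \<zeta>] LIMSEQ_unique by blast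
    also have "\<dots> = of_real 1" using sphere[OF \<zeta>] by simp
    finally show ?thesis by (simp only: of_real_eq_iff)
  qed
  have Fb: "sqnorm N (F z) < 1" if "z \<in> ball 0 1" for z
    by (rule sqnorm_less_1_in_ball[OF _ _ Fs that])
      (use f0 fF[of 0] holomorphic_several_polys_upto[OF Fp] in auto)
  have Fc: "F z \<in> coord_space N" for z by (simp add: F_def coord_space_def)
  have cont: "continuous_on S F" for S
    by (intro continuous_on_coordinatewise_then_product continuous_on_polys_upto[OF Fp])
  show ?thesis
    unfolding proper_holomorphic_map_iff_compact_preimages
  proof (intro conjI allI impI)
    show "holomorphic_map N f"
      unfolding holomorphic_map_def
    proof
      fix i assume i: "i \<in> {1..N}"
      show "holomorphic_several (\<lambda>z. f z i) (ball 0 1)"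
        unfolding holomorphic_several_def
      proof
        fix z :: "complex ^ 'n" assume z: "z \<in> ball 0 1"
        obtain D where D: "((\<lambda>z. F z i) has_derivative D) (at z)" "\<forall>c v. D (c *s v) = c * D v"
          using holomorphic_several_polys_upto[OF Fp[of i], of UNIV] unfolding holomorphic_several_def by blast
        have "((\<lambda>z. f z i) has_derivative D) (at z)"
          by (rule has_derivative_transform_within_open[OF D(1), of "ball 0 1"]) (use z fF in auto)
        with D(2) show "\<exists>D. ((\<lambda>z. f z i) has_derivative D) (at z) \<and> (\<forall>c v. D (c *s v) = c * D v)"
          by blast
      qed
    qed
    show "f ` ball 0 1 \<subseteq> target_ball N"
      using Fb Fc fF by (auto simp: target_ball_def)
    fix C assume C: "C \<subseteq> target_ball N" "compact C"
    have "{z \<in> ball 0 1. f z \<in> C} = cball 0 1 \<inter> F -` C"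
    proof (intro set_eqI iffI)
      fix z assume z: "z \<in> cball 0 1 \<inter> F -` C"
      have "norm z \<noteq> 1"
      proof
        assume "norm z = 1"
        with Fs[of z] z C show False by (auto simp: target_ball_def)
      qed
      then have "z \<in> ball 0 1" using z by simp
      with z fF show "z \<in> {z \<in> ball 0 1. f z \<in> C}" by simp
    qed (use fF in auto)
    moreover have "closed (cball 0 1 \<inter> F -` C)"
      by (rule continuous_closed_preimage[OF cont]) (use C compact_imp_closed in auto)
    then have "compact (cball 0 1 \<inter> F -` C)"
      by (metis compact_Int_closed compact_cball Int_left_absorb)
    ultimately show "compact {z \<in> ball 0 1. f z \<in> C}" by simp
  qed
qed

section \<open>Parameters and members of a convex family\<close>

lemma sqnorm_add_split:
  "sqnorm (N + M) w = sqnorm N w + sqnorm M (\<lambda>i. w (i + N))"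
proof -
  have split: "{1..N + M} = {1..N} \<union> (\<lambda>i. i + N) ` {1..M}"
  proof (intro set_eqI iffI)
    fix i assume "i \<in> {1..N + M}"
    then show "i \<in> {1..N} \<union> (\<lambda>i. i + N) ` {1..M}"
      by (cases "i \<le> N") (auto intro!: image_eqI[of _ _ "i - N"])
  qed auto
  have disj: "{1..N} \<inter> (\<lambda>i. i + N) ` {1..M} = {}" by auto
  show ?thesis
  proof -
    have "(\<Sum>i=1..N + M. (cmod (w i))\<^sup>2) =
        (\<Sum>i=1..N. (cmod (w i))\<^sup>2) + (\<Sum>i\<in>(\<lambda>i. i + N) ` {1..M}. (cmod (w i))\<^sup>2)"
      unfolding split by (rule sum.union_disjoint) (simp_all only: finite_atLeastAtMost finite_imageI disj)
    also have "(\<Sum>i\<in>(\<lambda>i. i + N) ` {1..M}. (cmod (w i))\<^sup>2) = (\<Sum>i=1..M. (cmod (w (i + N)))\<^sup>2)"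
      by (subst sum.reindex) (auto simp: inj_on_def)
    finally show ?thesis by (simp only: sqnorm_def)
  qed
qed

text \<open>
  The orthogonal sum of the two maps, scaled by \<open>\<surd>(1 - t)\<close> and \<open>\<surd>t\<close>.
\<close>

lemma P_inf_convex:
  fixes R S :: "complex ^ 'n::finite \<Rightarrow> real"
  assumes "R \<in> P_inf" "S \<in> P_inf" "0 \<le> t" "t \<le> 1"
  shows "(\<lambda>z. (1 - t) * R z + t * S z) \<in> P_inf"
proof -
  obtain N f where f: "holomorphic_map N f" "\<And>z. z \<in> ball 0 1 \<Longrightarrow> R z = sqnorm N (f z)"
    using assms(1) unfolding P_inf_def by blast
  obtain M g where g: "holomorphic_map M g" "\<And>z. z \<in> ball 0 1 \<Longrightarrow> S z = sqnorm M (g z)"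
    using assms(2) unfolding P_inf_def by blast
  define h where "h = (\<lambda>z i. if i \<le> N then of_real (sqrt (1 - t)) * f z i else of_real (sqrt t) * g z (i - N))"
  have "holomorphic_map (N + M) h"
    unfolding holomorphic_map_def
  proof
    fix i assume i: "i \<in> {1..N + M}"
    show "holomorphic_several (\<lambda>z. h z i) (ball 0 1)"
    proof (cases "i \<le> N")
      case True
      then have "holomorphic_several (\<lambda>z. f z i) (ball 0 1)" using f(1) i by (simp add: holomorphic_map_def)
      from holomorphic_several_mult[OF holomorphic_several_const this] True show ?thesis by (simp add: h_def)
    next
      case False
      then have "i - N \<in> {1..M}" using i by auto
      then have "holomorphic_several (\<lambda>z. g z (i - N)) (ball 0 1)" using g(1) by (simp only: holomorphic_map_def)
      from holomorphic_several_mult[OF holomorphic_several_const this] False show ?thesis by (simp add: h_def)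
    qed
  qed
  moreover have "(1 - t) * R z + t * S z = sqnorm (N + M) (h z)" if "z \<in> ball 0 1" for z
    unfolding sqnorm_add_split f(2)[OF that] g(2)[OF that]
    using assms(3,4) by (simp add: sqnorm_def h_def norm_mult power_mult_distrib sum_distrib_left)
  ultimately show ?thesis unfolding P_inf_def by blast
qed

text \<open>
  The parameters extended by the coefficient of the last map, so that all maps are treated alike.
\<close>

definition weight :: "nat \<Rightarrow> (nat \<Rightarrow> real) \<Rightarrow> nat \<Rightarrow> real" where
  "weight k lam i = (if i = k + 1 then 1 - (\<Sum>j=1..k. lam j) else lam i)"

lemma family_R_weight: "family_R k N f lam z = (\<Sum>i=1..k+1. weight k lam i * sqnorm (N i) (f i z))"
proof -
  have "(\<Sum>i=1..k. weight k lam i * sqnorm (N i) (f i z)) = (\<Sum>i=1..k. lam i * sqnorm (N i) (f i z))"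
    by (rule sum.cong) (auto simp: weight_def)
  then show ?thesis by (simp add: family_R_def weight_def)
qed

lemma weight_affine:
  "weight k (\<lambda>i. (1 - t) * x i + t * y i) i = (1 - t) * weight k x i + t * weight k y i"
proof (cases "i = k + 1")
  case True
  have "(\<Sum>j=1..k. (1 - t) * x j + t * y j) = (1 - t) * (\<Sum>j=1..k. x j) + t * (\<Sum>j=1..k. y j)"
    by (simp only: sum.distrib sum_distrib_left)
  with True show ?thesis by (simp add: weight_def algebra_simps)
qed (simp add: weight_def)

lemma sum_weight: "(\<Sum>i=1..k+1. weight k lam i) = 1"
proof -
  have "(\<Sum>i=1..k. weight k lam i) = (\<Sum>i=1..k. lam i)"
    by (rule sum.cong) (auto simp: weight_def)
  then show ?thesis by (simp add: weight_def)
qed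

lemma continuous_on_weight: "continuous_on S (\<lambda>lam. weight k lam i)"
proof -
  have "continuous_on S (\<lambda>lam :: nat \<Rightarrow> real. lam i)" for i
    by (rule continuous_on_subset[OF continuous_on_product_coordinates]) simp
  then show ?thesis by (cases "i = k + 1") (auto simp: weight_def intro!: continuous_intros)
qed

lemma family_R_affine:
  "family_R k N f (\<lambda>i. (1 - t) * x i + t * y i) z = (1 - t) * family_R k N f x z + t * family_R k N f y z"
  unfolding family_R_weight weight_affine
  by (simp only: distrib_right sum.distrib sum_distrib_left mult.assoc)

text \<open>
  The greatest set in the definition of the parameter set exists because the set of all admissible
  parameters is itself convex.
\<close>

lemma convex_admissible_parameters:
  "convex_seqs {lam \<in> coord_space k. family_R k N f lam \<in> P_inf}"
  unfolding convex_seqs_def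
proof (intro ballI)
  fix x y :: "nat \<Rightarrow> real" and t :: real
  assume "x \<in> {lam \<in> coord_space k. family_R k N f lam \<in> P_inf}"
    "y \<in> {lam \<in> coord_space k. family_R k N f lam \<in> P_inf}" "t \<in> {0..1}"
  then show "(\<lambda>i. (1 - t) * x i + t * y i) \<in> {lam \<in> coord_space k. family_R k N f lam \<in> P_inf}"
    using P_inf_convex[of "family_R k N f x" "family_R k N f y" t]
    by (auto simp: coord_space_def family_R_affine[abs_def])
qed

lemma family_K_eq: "family_K k N f = {lam \<in> coord_space k. family_R k N f lam \<in> P_inf}"
  unfolding family_K_def
  by (rule Greatest_equality) (use convex_admissible_parameters in auto)

lemma convex_family_K: "convex_seqs (family_K k N f)"
  unfolding family_K_eq by (rule convex_admissible_parameters)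

text \<open>
  The parameter of the \<open>i\<close>-th generating map. For \<open>i = k + 1\<close> this is the origin.
\<close>

definition vertex :: "nat \<Rightarrow> nat \<Rightarrow> nat \<Rightarrow> real" where
  "vertex k i j = (if j = i \<and> j \<in> {1..k} then 1 else 0)"

lemma weight_vertex:
  assumes "i \<in> {1..k+1}" "j \<in> {1..k+1}"
  shows "weight k (vertex k i) j = (if j = i then 1 else 0)"
proof -
  have "(\<Sum>j=1..k. vertex k i j) = (\<Sum>j=1..k. if j = i then 1 else 0)"
    by (rule sum.cong) (auto simp: vertex_def)
  also have "\<dots> = (if i = k + 1 then 0 else 1)" using assms by auto
  finally show ?thesis using assms by (auto simp: weight_def vertex_def)
qed

lemma family_R_vertex:
  assumes "i \<in> {1..k+1}"
  shows "family_R k N f (vertex k i) z = sqnorm (N i) (f i z)"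
proof -
  have "family_R k N f (vertex k i) z = (\<Sum>j=1..k+1. if j = i then sqnorm (N j) (f j z) else 0)"
    unfolding family_R_weight by (rule sum.cong) (use weight_vertex[OF assms] in auto)
  then show ?thesis using assms by simp
qed

lemma vertex_member:
  assumes i: "i \<in> {1..k+1}" and f: "proper_holomorphic_map (N i) (f i)"
  shows "vertex k i \<in> family_K k N f" and "(N i, f i) \<in> members_at k N f (vertex k i)"
proof -
  show "(N i, f i) \<in> members_at k N f (vertex k i)"
    using f by (simp add: members_at_def family_R_vertex[OF i])
  have "family_R k N f (vertex k i) \<in> P_inf"
    unfolding P_inf_def using f family_R_vertex[OF i, of N f]
    by (auto simp: proper_holomorphic_map_def intro!: exI[of _ "N i"] exI[of _ "f i"])
  then show "vertex k i \<in> family_K k N f"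
    by (simp add: family_K_eq coord_space_def vertex_def)
qed

lemma family_R_form:
  assumes "\<And>i. i \<in> {1..k+1} \<Longrightarrow> polynomial_form d (\<lambda>z. sqnorm (N i) (f i z)) (C i)"
  shows "polynomial_form d (family_R k N f lam) (\<lambda>\<alpha> \<beta>. \<Sum>i=1..k+1. of_real (weight k lam i) * C i \<alpha> \<beta>)"
  unfolding polynomial_form_def
proof (intro conjI allI impI ballI)
  fix z :: "complex ^ 'a" assume z: "z \<in> ball 0 1"
  have "of_real (family_R k N f lam z) =
      (\<Sum>i=1..k+1. complex_of_real (weight k lam i) * of_real (sqnorm (N i) (f i z)))"
    unfolding family_R_weight by simp
  also have "\<dots> = (\<Sum>i=1..k+1. of_real (weight k lam i) * hform d (C i) z)"
    using assms z by (intro sum.cong refl) (simp add: polynomial_form_def)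
  finally show "of_real (family_R k N f lam z) =
      hform d (\<lambda>\<alpha> \<beta>. \<Sum>i=1..k+1. of_real (weight k lam i) * C i \<alpha> \<beta>) z"
    by (simp only: hform_sum)
next
  fix \<alpha> \<beta> assume ne: "(\<Sum>i=1..k+1. of_real (weight k lam i) * C i \<alpha> \<beta>) \<noteq> 0"
  obtain i where "i \<in> {1..k+1}" "of_real (weight k lam i) * C i \<alpha> \<beta> \<noteq> 0"
    by (rule sum.not_neutral_contains_not_neutral[OF ne])
  then have "mdeg \<alpha> \<le> d \<and> mdeg \<beta> \<le> d"
    using assms[of i] unfolding polynomial_form_def by force
  then show "mdeg \<alpha> \<le> d" "mdeg \<beta> \<le> d" by auto
qed

section \<open>The upper bound\<close>

text \<open>
  Gaussian elimination: each equation is used up to eliminate one unknown.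
\<close>

lemma exists_linear_relation:
  fixes g :: "'i \<Rightarrow> 's \<Rightarrow> real"
  assumes "finite S" "finite I" "card S < card I"
  shows "\<exists>a. (\<exists>i\<in>I. a i \<noteq> 0) \<and> (\<forall>s\<in>S. (\<Sum>i\<in>I. a i * g i s) = 0)"
  using assms
proof (induction S arbitrary: I g rule: finite_induct)
  case empty
  then have "I \<noteq> {}" by auto
  then show ?case by (intro exI[of _ "\<lambda>_. 1"]) auto
next
  case (insert s S)
  show ?case
  proof (cases "\<forall>i\<in>I. g i s = 0")
    case True
    have "card S < card I" using insert by simp
    from insert.IH[OF insert.prems(1) this, of g] obtain a
      where a: "\<exists>i\<in>I. a i \<noteq> 0" "\<forall>s\<in>S. (\<Sum>i\<in>I. a i * g i s) = 0" by (elim exE conjE)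
    have "(\<Sum>i\<in>I. a i * g i s) = 0" using True by (intro sum.neutral) simp
    with a show ?thesis by (intro exI[of _ a]) simp
  next
    case False
    then obtain i0 where i0: "i0 \<in> I" "g i0 s \<noteq> 0" by blast
    have "card S < card (I - {i0})" "finite (I - {i0})" using insert i0 by simp_all
    from insert.IH[OF this(2,1), of "\<lambda>i x. g i x - g i s / g i0 s * g i0 x"] obtain a
      where a: "\<exists>i\<in>I - {i0}. a i \<noteq> 0"
        "\<forall>x\<in>S. (\<Sum>i\<in>I - {i0}. a i * (g i x - g i s / g i0 s * g i0 x)) = 0" by (elim exE conjE)
    define b where "b = (\<lambda>i. if i = i0 then - (\<Sum>i\<in>I - {i0}. a i * (g i s / g i0 s)) else a i)"
    have sum: "(\<Sum>i\<in>I. b i * g i x) = (\<Sum>i\<in>I - {i0}. a i * (g i x - g i s / g i0 s * g i0 x))" for x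
    proof -
      have "(\<Sum>i\<in>I. b i * g i x) = b i0 * g i0 x + (\<Sum>i\<in>I - {i0}. b i * g i x)"
        by (rule sum.remove[OF insert.prems(1) i0(1)])
      also have "(\<Sum>i\<in>I - {i0}. b i * g i x) = (\<Sum>i\<in>I - {i0}. a i * g i x)"
        by (rule sum.cong) (auto simp: b_def)
      also have "b i0 * g i0 x = - (\<Sum>i\<in>I - {i0}. a i * (g i s / g i0 s) * g i0 x)"
        by (simp add: b_def sum_distrib_right)
      finally show ?thesis by (simp add: sum_subtractf right_diff_distrib mult.assoc)
    qed
    have "\<exists>i\<in>I. b i \<noteq> 0" using a(1) by (auto simp: b_def)
    moreover have "(\<Sum>i\<in>I. b i * g i s) = 0" unfolding sum using i0 by (intro sum.neutral) simp
    moreover have "\<forall>x\<in>S. (\<Sum>i\<in>I. b i * g i x) = 0" unfolding sum by (rule a(2))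
    ultimately show ?thesis by (intro exI[of _ b]) simp
  qed
qed

lemma hform_pairs:
  "hform d c z = (\<Sum>p\<in>{\<alpha>. mdeg \<alpha> \<le> d} \<times> {\<alpha>. mdeg \<alpha> \<le> d}. c (fst p) (snd p) * hterm p z)"
  unfolding hform_def sum.cartesian_product by (simp add: hterm_def case_prod_unfold mult.assoc)

lemma hterm_scaleR: "hterm p (r *\<^sub>R z) = of_real r ^ (mdeg (fst p) + mdeg (snd p)) * hterm p z"
  by (simp add: hterm_def zpow_scaleR power_add)

text \<open>
  Under rotation a term picks up the character \<open>|\<alpha>| - |\<beta>|\<close> of the circle.
\<close>

lemma hterm_rotate:
  "hterm p (cis \<theta> *s z) = cis (of_int (int (mdeg (fst p)) - int (mdeg (snd p))) * \<theta>) * hterm p z"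
proof -
  have "cis \<theta> ^ a * cnj (cis \<theta> ^ b) = cis (of_int (int a - int b) * \<theta>)" for a b :: nat
    by (simp add: cis_cnj Complex.DeMoivre cis_mult algebra_simps)
  from this[symmetric] show ?thesis by (simp add: hterm_def zpow_scale)
qed

text \<open>
  On the part of the form with \<open>|\<alpha>| - |\<beta>| = m\<close> the condition \<open>max |\<alpha>| |\<beta>| = d\<close> fixes the total degree
  \<open>|\<alpha>| + |\<beta>| = 2d - |m|\<close>. So each of these parts is homogeneous; being separated by rotations, it vanishes
  on the sphere and by homogeneity everywhere.
\<close>

lemma top_degree_form_vanishing_on_sphere:
  fixes c :: "('n::finite \<Rightarrow> nat) \<Rightarrow> ('n \<Rightarrow> nat) \<Rightarrow> complex"
  assumes supp: "\<And>\<alpha> \<beta>. c \<alpha> \<beta> \<noteq> 0 \<Longrightarrow> mdeg \<alpha> \<le> d \<and> mdeg \<beta> \<le> d \<and> (mdeg \<alpha> = d \<or> mdeg \<beta> = d)"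
    and sphere: "\<And>\<zeta>. norm \<zeta> = 1 \<Longrightarrow> hform d c \<zeta> = 0"
  shows "c \<alpha> \<beta> = 0"
proof (rule hform_eq_0_imp_coeffs_0)
  show "mdeg \<alpha> \<le> d \<and> mdeg \<beta> \<le> d" if "c \<alpha> \<beta> \<noteq> 0" for \<alpha> \<beta> using supp[OF that] by blast
next
  let ?M = "{\<alpha> :: 'n \<Rightarrow> nat. mdeg \<alpha> \<le> d} \<times> {\<alpha> :: 'n \<Rightarrow> nat. mdeg \<alpha> \<le> d}"
  define e where "e = (\<lambda>p :: ('n \<Rightarrow> nat) \<times> ('n \<Rightarrow> nat). int (mdeg (fst p)) - int (mdeg (snd p)))"
  have group: "(\<Sum>p\<in>?M. h p) = (\<Sum>m\<in>{- int d..int d}. \<Sum>p\<in>{p \<in> ?M. e p = m}. h p)" for h :: "_ \<Rightarrow> complex"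
    by (rule sum.group[symmetric]) (auto simp: finite_mdeg_le e_def)
  fix z :: "complex ^ 'n"
  obtain r \<zeta> where \<zeta>: "norm \<zeta> = 1" and z: "z = r *\<^sub>R \<zeta>"
  proof (cases "z = 0")
    case True
    have "norm (axis undefined 1 :: complex ^ 'n) = 1" by simp
    then show ?thesis using that[of "axis undefined 1" 0] True by simp
  next
    case False
    then show ?thesis using that[of "z /\<^sub>R norm z" "norm z"] by simp
  qed
  \<comment> \<open>The Fourier coefficients of \<open>\<theta> \<mapsto> hform d c (e\<^sup>i\<^sup>\<theta> \<zeta>)\<close>.\<close>
  define B where "B = (\<lambda>m. \<Sum>p\<in>{p \<in> ?M. e p = m}. c (fst p) (snd p) * hterm p \<zeta>)"
  have B: "B m = 0" if "m \<in> {- int d..int d}" for m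
  proof (rule characters_independent[where X = "{- int d..int d}" and \<phi> = "\<lambda>m \<theta>. cis (of_int m * \<theta>)"
        and mul = "(+)" and e = 0, OF _ _ _ _ _ that])
    fix \<theta> :: real
    have "norm (cis \<theta> *s \<zeta>) = 1" using \<zeta> by (simp add: norm_vector_smult)
    note s = sphere[OF this]
    have rot: "hterm p (cis \<theta> *s \<zeta>) = cis (of_int (e p) * \<theta>) * hterm p \<zeta>" for p
      by (simp only: e_def hterm_rotate)
    have "0 = (\<Sum>m\<in>{- int d..int d}. \<Sum>p\<in>{p \<in> ?M. e p = m}. c (fst p) (snd p) * (cis (of_int (e p) * \<theta>) * hterm p \<zeta>))"
      using s unfolding hform_pairs group rot by (rule sym)
    also have "\<dots> = (\<Sum>m\<in>{- int d..int d}. B m * cis (of_int m * \<theta>))"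
      unfolding B_def sum_distrib_right by (intro sum.cong refl) auto
    finally show "(\<Sum>m\<in>{- int d..int d}. B m * cis (of_int m * \<theta>)) = 0" by simp
  qed (auto simp: distrib_left cis_mult intro: cis_characters_distinct)
  have "hform d c z = (\<Sum>m\<in>{- int d..int d}. of_real r ^ nat (2 * int d - \<bar>m\<bar>) * B m)"
    unfolding hform_pairs group B_def sum_distrib_left
  proof (intro sum.cong refl)
    fix m p assume p: "p \<in> {p \<in> ?M. e p = m}"
    show "c (fst p) (snd p) * hterm p z =
        of_real r ^ nat (2 * int d - \<bar>m\<bar>) * (c (fst p) (snd p) * hterm p \<zeta>)"
    proof (cases "c (fst p) (snd p) = 0")
      case False
      have "m = int (mdeg (fst p)) - int (mdeg (snd p))" using p by (simp add: e_def)
      with supp[OF False] have "nat (2 * int d - \<bar>m\<bar>) = mdeg (fst p) + mdeg (snd p)"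
        by linarith
      then show ?thesis by (simp add: z hterm_scaleR)
    qed simp
  qed
  then show "hform d c z = 0" using B by simp
qed

lemma polynomial_map_upto_mono: "polynomial_map_upto d N f \<Longrightarrow> d \<le> e \<Longrightarrow> polynomial_map_upto e N f"
  unfolding polynomial_map_upto_def using polys_upto_mono by blast

lemma polynomial_map_upto_map_degree: "polynomial_map N f \<Longrightarrow> polynomial_map_upto (map_degree N f) N f"
  unfolding polynomial_map_def map_degree_def by (rule LeastI_ex)

text \<open>
  The entries of the form are affine, hence continuous, in the parameter. Those of degree above \<open>d\<close> vanish
  on a dense set of parameters, hence on the whole parameter set, which contains the vertices.
\<close>

lemma generic_degree_bounds_all_maps:
  assumes fam: "convex_family m N f" and poly: "polynomial_family m N f"
    and deg: "has_generic_degree m N f d" and i: "i \<in> {1..m+1}"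
  shows "polynomial_map_upto d (N i) (f i)"
proof -
  have mem: "(N j, f j) \<in> members m N f" "vertex m j \<in> family_K m N f" if "j \<in> {1..m+1}" for j
    using vertex_member[of j m N f] fam that by (auto simp: convex_family_def members_def)
  have pm: "polynomial_map (N j) (f j)" if "j \<in> {1..m+1}" for j
    using poly mem(1)[OF that] by (auto simp: polynomial_family_def)
  define D where "D = (\<Sum>j=1..m+1. map_degree (N j) (f j))"
  have "\<exists>C. polynomial_form D (\<lambda>z. sqnorm (N j) (f j z)) C" if j: "j \<in> {1..m+1}" for j
  proof -
    have "map_degree (N j) (f j) \<le> D" unfolding D_def by (rule member_le_sum) (use j in auto)
    from polynomial_map_upto_coeffs[OF polynomial_map_upto_mono[OF polynomial_map_upto_map_degree[OF pm[OF j]] this]]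
    show ?thesis by blast
  qed
  then have "\<forall>j\<in>{1..m+1}. \<exists>C. polynomial_form D (\<lambda>z. sqnorm (N j) (f j z)) C" ..
  from bchoice[OF this] obtain C where C: "\<And>j. j \<in> {1..m+1} \<Longrightarrow> polynomial_form D (\<lambda>z. sqnorm (N j) (f j z)) (C j)"
    by blast
  obtain G where "openin (top_of_set (family_K m N f)) G" and dense: "family_K m N f \<subseteq> closure G"
    and G: "\<And>lam. lam \<in> G \<Longrightarrow> (\<lambda>(M, g). map_degree M g) ` members_at m N f lam = {d}"
    using deg unfolding has_generic_degree_def by blast
  then have GK: "G \<subseteq> family_K m N f" by (simp add: openin_imp_subset)
  have "C i \<alpha> \<alpha> = 0" if \<alpha>: "d < mdeg \<alpha>" for \<alpha>
  proof -
    define q where "q = (\<lambda>lam. \<Sum>j=1..m+1. of_real (weight m lam j) * C j \<alpha> \<alpha>)"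
    have "q lam = 0" if lam: "lam \<in> G" for lam
    proof -
      obtain M g where g: "(M, g) \<in> members_at m N f lam" "map_degree M g = d"
        using G[OF lam] by (metis (mono_tags, lifting) imageE insertI1 case_prod_unfold prod.collapse)
      then have "(M, g) \<in> members m N f" using lam GK by (auto simp: members_def)
      then have gp: "polynomial_map M g" using poly by (auto simp: polynomial_family_def)
      have "polynomial_form D (\<lambda>z. sqnorm M (g z)) (\<lambda>\<alpha> \<beta>. \<Sum>j=1..m+1. of_real (weight m lam j) * C j \<alpha> \<beta>)"
        by (rule polynomial_form_cong[OF family_R_form[OF C]]) (use g in \<open>auto simp: members_at_def\<close>)
      from polynomial_map_upto_iff_diagonal[OF gp this, of d] polynomial_map_upto_map_degree[OF gp] g(2) \<alpha>
      show ?thesis by (simp add: q_def)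
    qed
    then have "G \<subseteq> {lam. q lam = 0}" by blast
    moreover have "closed {lam. q lam = 0}"
      unfolding q_def by (intro closed_Collect_eq continuous_intros continuous_on_weight)
    ultimately have "closure G \<subseteq> {lam. q lam = 0}" by (rule closure_minimal)
    then have "q (vertex m i) = 0" using dense mem(2)[OF i] by blast
    moreover have "q (vertex m i) = (\<Sum>j=1..m+1. if j = i then C j \<alpha> \<alpha> else 0)"
      unfolding q_def by (rule sum.cong) (use weight_vertex[OF i] in auto)
    moreover have "\<dots> = C i \<alpha> \<alpha>"
      by (simp only: sum.delta finite_atLeastAtMost i if_True)
    ultimately show ?thesis by simp
  qed
  then show ?thesis using polynomial_map_upto_iff_diagonal[OF pm[OF i] C[OF i], of d] by blast
qed

text \<open>
  If \<open>f(0) = 0\<close>, no component has a constant term, so the row and the column of the zero multi-index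
  vanish.
\<close>

lemma origin_preserving_form_no_pure_terms:
  fixes f :: "complex ^ 'n::finite \<Rightarrow> nat \<Rightarrow> complex"
  assumes f: "polynomial_map_upto d N f" and f0: "sqnorm N (f 0) = 0"
  shows "\<exists>c. polynomial_form d (\<lambda>z. sqnorm N (f z)) c \<and> (\<forall>\<alpha> \<beta>. c \<beta> \<alpha> = cnj (c \<alpha> \<beta>)) \<and>
    (\<forall>\<alpha> \<beta>. c \<alpha> \<beta> \<noteq> 0 \<longrightarrow> 1 \<le> mdeg \<alpha> \<and> mdeg \<alpha> \<le> d \<and> 1 \<le> mdeg \<beta> \<and> mdeg \<beta> \<le> d)"
proof -
  obtain a where a0: "\<forall>i \<alpha>. d < mdeg \<alpha> \<longrightarrow> a i \<alpha> = 0"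
    and a: "\<forall>i\<in>{1..N}. \<forall>z\<in>ball 0 1. f z i = (\<Sum>\<alpha> | mdeg \<alpha> \<le> d. a i \<alpha> * zpow z \<alpha>)"
    and form: "polynomial_form d (\<lambda>z. sqnorm N (f z)) (\<lambda>\<alpha> \<beta>. \<Sum>i=1..N. a i \<alpha> * cnj (a i \<beta>))"
    using polynomial_map_upto_coeffs[OF f] by (elim exE conjE)
  have "a i (\<lambda>_. 0) = 0" if i: "i \<in> {1..N}" for i
  proof -
    have "f 0 i = 0"
    proof -
      have "\<forall>i\<in>{1..N}. (cmod (f 0 i))\<^sup>2 = 0"
        using f0 unfolding sqnorm_def by (subst (asm) sum_nonneg_eq_0_iff) auto
      with i show ?thesis by simp
    qed
    moreover have "(\<Sum>\<alpha> | 1 \<le> mdeg \<alpha> \<and> mdeg \<alpha> \<le> d. a i \<alpha> * zpow 0 \<alpha>) = 0"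
      by (rule sum.neutral) (auto simp: zpow_0)
    moreover have "zpow 0 (\<lambda>_ :: 'n. 0) = 1" by (simp add: zpow_def)
    ultimately show ?thesis using a i by (simp add: sum_mdeg_le_split)
  qed
  then have z: "a i \<alpha> = 0" if "i \<in> {1..N}" "mdeg \<alpha> = 0" for i \<alpha>
    using that by (simp add: mdeg_def fun_eq_iff[symmetric])
  let ?c = "\<lambda>\<alpha> \<beta>. \<Sum>i=1..N. a i \<alpha> * cnj (a i \<beta>)"
  show ?thesis
  proof (intro exI[of _ ?c] conjI form allI impI)
    show "?c \<beta> \<alpha> = cnj (?c \<alpha> \<beta>)" for \<alpha> \<beta> by (simp add: mult.commute)
    fix \<alpha> \<beta> assume ne: "?c \<alpha> \<beta> \<noteq> 0"
    obtain i where i: "i \<in> {1..N}" "a i \<alpha> * cnj (a i \<beta>) \<noteq> 0"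
      by (rule sum.not_neutral_contains_not_neutral[OF ne])
    then have "mdeg \<alpha> \<noteq> 0" "mdeg \<beta> \<noteq> 0" "\<not> d < mdeg \<alpha>" "\<not> d < mdeg \<beta>"
      using z a0 by auto
    then show "1 \<le> mdeg \<alpha>" "mdeg \<alpha> \<le> d" "1 \<le> mdeg \<beta>" "mdeg \<beta> \<le> d" by auto
  qed
qed

text \<open>
  With more than \<open>\<delta>(n,d-1)\<^sup>2\<close> differences \<open>C\<^sub>i - C\<^bsub>m+1\<^esub>\<close>, a nontrivial real combination \<open>H\<close> of them
  vanishes on \<open>A\<^bsub>d-1\<^esub> \<times> A\<^bsub>d-1\<^esub>\<close>. As \<open>H\<close> vanishes on the sphere as well, \<open>H = 0\<close>, against the independence of
  the forms of the family.
\<close>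

theorem convex_family_dimension_le:
  fixes f :: "nat \<Rightarrow> complex ^ 'n::finite \<Rightarrow> nat \<Rightarrow> complex"
  assumes fam: "convex_family m N f" and poly: "polynomial_family m N f"
    and orig: "origin_preserving_family m N f" and deg: "has_generic_degree m N f d" and d: "d \<ge> 1"
  shows "m \<le> (delta TYPE('n) (d - 1))\<^sup>2"
proof (rule ccontr)
  assume "\<not> ?thesis"
  then have m: "(delta TYPE('n) (d - 1))\<^sup>2 < m" by simp
  have proper: "proper_holomorphic_map (N i) (f i)" if "i \<in> {1..m+1}" for i
    using fam that by (auto simp: convex_family_def)
  have "\<exists>c. polynomial_form d (\<lambda>z. sqnorm (N i) (f i z)) c \<and> (\<forall>\<alpha> \<beta>. c \<beta> \<alpha> = cnj (c \<alpha> \<beta>)) \<and>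
      (\<forall>\<alpha> \<beta>. c \<alpha> \<beta> \<noteq> 0 \<longrightarrow> 1 \<le> mdeg \<alpha> \<and> mdeg \<alpha> \<le> d \<and> 1 \<le> mdeg \<beta> \<and> mdeg \<beta> \<le> d)"
    if i: "i \<in> {1..m+1}" for i
  proof -
    have "(N i, f i) \<in> members m N f"
      using vertex_member[of i m N f, OF i proper[OF i]] by (auto simp: members_def)
    then have "sqnorm (N i) (f i 0) = 0"
      using orig by (auto simp: origin_preserving_family_def sqnorm_def)
    then show ?thesis
      by (rule origin_preserving_form_no_pure_terms[OF generic_degree_bounds_all_maps[OF fam poly deg i]])
  qed
  then have "\<forall>i\<in>{1..m+1}. \<exists>c. polynomial_form d (\<lambda>z. sqnorm (N i) (f i z)) c \<and> (\<forall>\<alpha> \<beta>. c \<beta> \<alpha> = cnj (c \<alpha> \<beta>)) \<and>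
      (\<forall>\<alpha> \<beta>. c \<alpha> \<beta> \<noteq> 0 \<longrightarrow> 1 \<le> mdeg \<alpha> \<and> mdeg \<alpha> \<le> d \<and> 1 \<le> mdeg \<beta> \<and> mdeg \<beta> \<le> d)" ..
  from bchoice[OF this] obtain C where
    CC: "\<forall>i\<in>{1..m+1}. polynomial_form d (\<lambda>z. sqnorm (N i) (f i z)) (C i) \<and> (\<forall>\<alpha> \<beta>. C i \<beta> \<alpha> = cnj (C i \<alpha> \<beta>)) \<and>
      (\<forall>\<alpha> \<beta>. C i \<alpha> \<beta> \<noteq> 0 \<longrightarrow> 1 \<le> mdeg \<alpha> \<and> mdeg \<alpha> \<le> d \<and> 1 \<le> mdeg \<beta> \<and> mdeg \<beta> \<le> d)" ..
  have C: "polynomial_form d (\<lambda>z. sqnorm (N i) (f i z)) (C i)" if "i \<in> {1..m+1}" for i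
    by (rule CC[rule_format, OF that, THEN conjunct1])
  have herm: "C i \<beta> \<alpha> = cnj (C i \<alpha> \<beta>)" if "i \<in> {1..m+1}" for i \<alpha> \<beta>
    by (rule CC[rule_format, OF that, THEN conjunct2, THEN conjunct1, rule_format])
  have supp: "1 \<le> mdeg \<alpha> \<and> mdeg \<alpha> \<le> d \<and> 1 \<le> mdeg \<beta> \<and> mdeg \<beta> \<le> d"
    if "i \<in> {1..m+1}" "C i \<alpha> \<beta> \<noteq> 0" for i \<alpha> \<beta>
    using CC[rule_format, OF that(1), THEN conjunct2, THEN conjunct2] that(2) by blast
  define A where "A = {\<alpha> :: 'n \<Rightarrow> nat. 1 \<le> mdeg \<alpha> \<and> mdeg \<alpha> \<le> d - 1}"
  have finA: "finite A" unfolding A_def by (rule finite_subset[OF _ finite_mdeg_le[of "d - 1"]]) auto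
  \<comment> \<open>The real part of a Hermitian matrix is symmetric and the imaginary part is antisymmetric, so their
    sum is a real matrix that determines both.\<close>
  define g where "g = (\<lambda>i (\<alpha>, \<beta>). Re (C i \<alpha> \<beta> - C (m + 1) \<alpha> \<beta>) + Im (C i \<alpha> \<beta> - C (m + 1) \<alpha> \<beta>))"
  have "card (A \<times> A) < card {1..m}"
    using m by (simp add: card_cartesian_product A_def delta_eq_card power2_eq_square)
  from exists_linear_relation[OF finite_cartesian_product[OF finA finA] finite_atLeastAtMost this, of g] obtain a
    where a: "\<exists>i\<in>{1..m}. a i \<noteq> 0" "\<forall>s\<in>A \<times> A. (\<Sum>i\<in>{1..m}. a i * g i s) = 0"
    by (elim exE conjE)
  define b where "b = (\<lambda>i. if i = m + 1 then - (\<Sum>i=1..m. a i) else a i)"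
  have sum_b: "(\<Sum>i=1..m+1. b i) = 0"
  proof -
    have "(\<Sum>i=1..m. b i) = (\<Sum>i=1..m. a i)" by (rule sum.cong) (auto simp: b_def)
    then show ?thesis by (simp add: b_def)
  qed
  define H where "H = (\<lambda>\<alpha> \<beta>. \<Sum>i=1..m+1. complex_of_real (b i) * C i \<alpha> \<beta>)"
  have H_alt: "H \<alpha> \<beta> = (\<Sum>i=1..m. complex_of_real (a i) * (C i \<alpha> \<beta> - C (m + 1) \<alpha> \<beta>))" for \<alpha> \<beta>
  proof -
    have "(\<Sum>i=1..m. complex_of_real (b i) * C i \<alpha> \<beta>) = (\<Sum>i=1..m. complex_of_real (a i) * C i \<alpha> \<beta>)"
      by (rule sum.cong) (auto simp: b_def)
    then show ?thesis
      by (simp add: H_def b_def right_diff_distrib sum_subtractf sum_distrib_right)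
  qed
  have H_herm: "H \<beta> \<alpha> = cnj (H \<alpha> \<beta>)" for \<alpha> \<beta>
    unfolding H_def cnj_sum
  proof (rule sum.cong[OF refl])
    fix i assume "i \<in> {1..m+1}"
    then have "C i \<beta> \<alpha> = cnj (C i \<alpha> \<beta>)" by (rule herm)
    then show "complex_of_real (b i) * C i \<beta> \<alpha> = cnj (complex_of_real (b i) * C i \<alpha> \<beta>)" by simp
  qed
  have H_A: "H \<alpha> \<beta> = 0" if "\<alpha> \<in> A" "\<beta> \<in> A" for \<alpha> \<beta>
  proof -
    have "Re (H \<alpha> \<beta>) + Im (H \<alpha> \<beta>) = 0" if "\<alpha> \<in> A" "\<beta> \<in> A" for \<alpha> \<beta>
    proof -
      have "Re (H \<alpha> \<beta>) = (\<Sum>i=1..m. a i * Re (C i \<alpha> \<beta> - C (m + 1) \<alpha> \<beta>))"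
        and "Im (H \<alpha> \<beta>) = (\<Sum>i=1..m. a i * Im (C i \<alpha> \<beta> - C (m + 1) \<alpha> \<beta>))"
        by (simp_all add: H_alt)
      then have "Re (H \<alpha> \<beta>) + Im (H \<alpha> \<beta>) = (\<Sum>i=1..m. a i * g i (\<alpha>, \<beta>))"
        by (simp only: g_def prod.case distrib_left sum.distrib)
      also have "\<dots> = 0" using a(2) that by blast
      finally show ?thesis .
    qed
    from this[OF that] this[OF that(2,1)] show ?thesis
      unfolding H_herm[of \<alpha> \<beta>] complex_eq_iff by simp
  qed
  have H_supp: "1 \<le> mdeg \<alpha> \<and> mdeg \<alpha> \<le> d \<and> 1 \<le> mdeg \<beta> \<and> mdeg \<beta> \<le> d" if ne: "H \<alpha> \<beta> \<noteq> 0" for \<alpha> \<beta>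
  proof -
    obtain i where "i \<in> {1..m+1}" "complex_of_real (b i) * C i \<alpha> \<beta> \<noteq> 0"
      by (rule sum.not_neutral_contains_not_neutral[OF ne[unfolded H_def]])
    then show ?thesis using supp[of i \<alpha> \<beta>] by simp
  qed
  have "H \<alpha> \<beta> = 0" for \<alpha> \<beta>
  proof (rule top_degree_form_vanishing_on_sphere)
    show "mdeg \<alpha> \<le> d \<and> mdeg \<beta> \<le> d \<and> (mdeg \<alpha> = d \<or> mdeg \<beta> = d)" if "H \<alpha> \<beta> \<noteq> 0" for \<alpha> \<beta>
    proof -
      have "\<not> (\<alpha> \<in> A \<and> \<beta> \<in> A)" using H_A that by blast
      then show ?thesis using H_supp[OF that] unfolding A_def mem_Collect_eq by linarith
    qed
    fix \<zeta> :: "complex ^ 'n" assume \<zeta>: "norm \<zeta> = 1"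
    have "hform d H \<zeta> = (\<Sum>i=1..m+1. complex_of_real (b i) * hform d (C i) \<zeta>)"
      unfolding H_def by (rule hform_sum)
    also have "\<dots> = (\<Sum>i=1..m+1. complex_of_real (b i) * 1)"
      by (intro sum.cong refl arg_cong2[where f = "(*)"] proper_imp_hform_1_on_sphere[OF proper C \<zeta>])
    also have "\<dots> = of_real (\<Sum>i=1..m+1. b i)" by simp
    finally show "hform d H \<zeta> = 0" unfolding sum_b by simp
  qed
  then have "(\<Sum>i=1..m+1. of_real (b i) * underlying_form (\<lambda>z. sqnorm (N i) (f i z)) \<alpha> \<beta>) = 0" for \<alpha> \<beta>
    using underlying_form_polynomial[OF C] by (simp add: H_def)
  then have "\<forall>i\<in>{1..m+1}. b i = 0"
    using fam unfolding convex_family_def by blast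
  moreover have "b i = a i" if "i \<in> {1..m}" for i using that by (simp add: b_def)
  ultimately show False using a(1) by auto
qed

section \<open>The base map, its tensored variants and the rank of forms\<close>

lemma norm_sq_eq_sum: "(norm (z :: complex ^ 'n::finite))\<^sup>2 = (\<Sum>i\<in>UNIV. (cmod (z $ i))\<^sup>2)"
  unfolding norm_vec_def L2_set_def by (intro real_sqrt_pow2 sum_nonneg) auto

lemma finite_mdeg_eq: "finite {\<gamma> :: 'n::finite \<Rightarrow> nat. mdeg \<gamma> = j}"
  by (rule finite_subset[OF _ finite_mdeg_le[of j]]) auto

text \<open>
  The weights are the multinomial coefficients; they are positive by the recursion that multiplies by \<open>\<parallel>z\<parallel>\<^sup>2 = \<Sum> |z\<^sub>i|\<^sup>2\<close>.
\<close>

lemma norm_power_eq_positive_monomial_sum: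
  "\<exists>w. (\<forall>\<gamma>. mdeg \<gamma> = j \<longrightarrow> w \<gamma> > 0) \<and>
    (\<forall>z :: complex ^ 'n::finite. (\<Sum>\<gamma> | mdeg \<gamma> = j. w \<gamma> * (cmod (zpow z \<gamma>))\<^sup>2) = (norm z) ^ (2 * j))"
proof (induction j)
  case 0
  have "{\<gamma> :: 'n \<Rightarrow> nat. mdeg \<gamma> = 0} = {\<lambda>_. 0}" by (auto simp: mdeg_def fun_eq_iff)
  then show ?case by (intro exI[of _ "\<lambda>_. 1"]) (simp add: zpow_def)
next
  case (Suc j)
  then obtain w where pos: "\<forall>\<gamma>. mdeg \<gamma> = j \<longrightarrow> w \<gamma> > 0"
    and sum: "\<forall>z :: complex ^ 'n. (\<Sum>\<gamma> | mdeg \<gamma> = j. w \<gamma> * (cmod (zpow z \<gamma>))\<^sup>2) = (norm z) ^ (2 * j)"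
    by (elim exE conjE)
  define u where "u = (\<lambda>(i :: 'n) j. if j = i then 1 else (0::nat))"
  define I where "I = (UNIV :: 'n set) \<times> {\<gamma> :: 'n \<Rightarrow> nat. mdeg \<gamma> = j}"
  define e where "e = (\<lambda>p. snd p + u (fst p))"
  define w' where "w' = (\<lambda>\<gamma>. \<Sum>p\<in>{p \<in> I. e p = \<gamma>}. w (snd p))"
  have fin: "finite I" by (simp add: I_def finite_mdeg_eq)
  have deg: "mdeg (u i) = 1" for i unfolding u_def by (rule mdeg_unit)
  have "w' \<gamma> > 0" if \<gamma>: "mdeg \<gamma> = Suc j" for \<gamma>
  proof -
    obtain i where i: "\<gamma> i \<noteq> 0" using \<gamma> by (fastforce simp: mdeg_def)
    define \<gamma>' where "\<gamma>' = (\<lambda>j. \<gamma> j - u i j)"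
    have split: "\<gamma>' + u i = \<gamma>" using i by (auto simp: \<gamma>'_def u_def fun_eq_iff)
    then have "mdeg \<gamma>' = j" using \<gamma> mdeg_add[of \<gamma>' "u i"] deg[of i] by simp
    then have "(i, \<gamma>') \<in> {p \<in> I. e p = \<gamma>}" using split by (simp add: I_def e_def)
    then show ?thesis
      unfolding w'_def using fin pos by (intro sum_pos) (auto simp: I_def)
  qed
  moreover have "(\<Sum>\<gamma> | mdeg \<gamma> = Suc j. w' \<gamma> * (cmod (zpow z \<gamma>))\<^sup>2) = (norm z) ^ (2 * Suc j)" for z :: "complex ^ 'n"
  proof -
    have "(norm z) ^ (2 * Suc j) = (\<Sum>i\<in>UNIV. (cmod (z $ i))\<^sup>2) * (\<Sum>\<gamma> | mdeg \<gamma> = j. w \<gamma> * (cmod (zpow z \<gamma>))\<^sup>2)"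
      unfolding norm_sq_eq_sum[symmetric] sum[rule_format] by (simp add: power2_eq_square)
    also have "\<dots> = (\<Sum>p\<in>I. w (snd p) * (cmod (zpow z (e p)))\<^sup>2)"
      unfolding sum_product sum.cartesian_product I_def
      by (rule sum.cong) (auto simp: e_def zpow_add u_def zpow_unit norm_mult power_mult_distrib)
    also have "\<dots> = (\<Sum>\<gamma> | mdeg \<gamma> = Suc j. \<Sum>p\<in>{p \<in> I. e p = \<gamma>}. w (snd p) * (cmod (zpow z (e p)))\<^sup>2)"
      by (rule sum.group[symmetric]) (use fin deg in \<open>auto simp: finite_mdeg_eq I_def e_def mdeg_add\<close>)
    also have "\<dots> = (\<Sum>\<gamma> | mdeg \<gamma> = Suc j. w' \<gamma> * (cmod (zpow z \<gamma>))\<^sup>2)"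
      unfolding w'_def sum_distrib_right by (intro sum.cong refl) auto
    finally show ?thesis by simp
  qed
  ultimately show ?case by (intro exI[of _ w']) blast
qed

text \<open>
  The mean of \<open>\<parallel>z\<parallel>\<^sup>2\<^sup>j\<close> over \<open>1 \<le> j \<le> d\<close>. On the sphere each of these powers is 1.
\<close>

lemma positive_diagonal_form_1_on_sphere:
  assumes d: "d \<ge> 1"
  shows "\<exists>w. (\<forall>\<gamma> :: 'n::finite \<Rightarrow> nat. 1 \<le> mdeg \<gamma> \<and> mdeg \<gamma> \<le> d \<longrightarrow> w \<gamma> > 0) \<and>
    (\<forall>z :: complex ^ 'n. norm z = 1 \<longrightarrow> (\<Sum>\<gamma> | 1 \<le> mdeg \<gamma> \<and> mdeg \<gamma> \<le> d. w \<gamma> * (cmod (zpow z \<gamma>))\<^sup>2) = (1::real))"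
proof -
  have "\<forall>j. \<exists>w. (\<forall>\<gamma> :: 'n \<Rightarrow> nat. mdeg \<gamma> = j \<longrightarrow> w \<gamma> > (0::real)) \<and>
    (\<forall>z :: complex ^ 'n. (\<Sum>\<gamma> | mdeg \<gamma> = j. w \<gamma> * (cmod (zpow z \<gamma>))\<^sup>2) = (norm z) ^ (2 * j))"
    using norm_power_eq_positive_monomial_sum by blast
  from choice[OF this] obtain W where
    W: "\<forall>j. (\<forall>\<gamma> :: 'n \<Rightarrow> nat. mdeg \<gamma> = j \<longrightarrow> W j \<gamma> > (0::real)) \<and>
    (\<forall>z :: complex ^ 'n. (\<Sum>\<gamma> | mdeg \<gamma> = j. W j \<gamma> * (cmod (zpow z \<gamma>))\<^sup>2) = (norm z) ^ (2 * j))" ..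
  have fin: "finite {\<gamma> :: 'n \<Rightarrow> nat. 1 \<le> mdeg \<gamma> \<and> mdeg \<gamma> \<le> d}"
    by (rule finite_subset[OF _ finite_mdeg_le[of d]]) auto
  have "(\<Sum>\<gamma> | 1 \<le> mdeg \<gamma> \<and> mdeg \<gamma> \<le> d. W (mdeg \<gamma>) \<gamma> / d * (cmod (zpow z \<gamma>))\<^sup>2) = 1"
    if z: "norm z = 1" for z :: "complex ^ 'n"
  proof -
    have "(\<Sum>\<gamma> | 1 \<le> mdeg \<gamma> \<and> mdeg \<gamma> \<le> d. W (mdeg \<gamma>) \<gamma> / d * (cmod (zpow z \<gamma>))\<^sup>2) =
        (\<Sum>j=1..d. \<Sum>\<gamma>\<in>{\<gamma> \<in> {\<gamma>. 1 \<le> mdeg \<gamma> \<and> mdeg \<gamma> \<le> d}. mdeg \<gamma> = j}. W (mdeg \<gamma>) \<gamma> / d * (cmod (zpow z \<gamma>))\<^sup>2)"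
      by (rule sum.group[symmetric]) (use fin in auto)
    also have "\<dots> = (\<Sum>j=1..d. (\<Sum>\<gamma> | mdeg \<gamma> = j. W j \<gamma> * (cmod (zpow z \<gamma>))\<^sup>2) / d)"
      unfolding sum_divide_distrib by (intro sum.cong refl) auto
    also have "\<dots> = (\<Sum>j=1..d. 1 / d)"
      using W z by (intro sum.cong refl) simp
    also have "\<dots> = 1" using d by simp
    finally show ?thesis .
  qed
  moreover have "W (mdeg \<gamma>) \<gamma> / d > 0" for \<gamma> using W d by simp
  ultimately show ?thesis by (intro exI[of _ "\<lambda>\<gamma>. W (mdeg \<gamma>) \<gamma> / d"]) blast
qed

lemma polynomial_map_with_components:
  fixes F :: "'x \<Rightarrow> complex ^ 'n::finite \<Rightarrow> complex"
  assumes I: "finite I" and F: "\<And>x. x \<in> I \<Longrightarrow> F x \<in> polys_upto d"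
  shows "\<exists>N f. polynomial_map_upto d N f \<and> (\<forall>z. f z \<in> coord_space N) \<and>
    (\<forall>z. sqnorm N (f z) = (\<Sum>x\<in>I. (cmod (F x z))\<^sup>2))"
proof -
  obtain h where h: "bij_betw h {1..card I} I" using ex_bij_betw_nat_finite_1[OF I] by blast
  define f where "f = (\<lambda>z i. if i \<in> {1..card I} then F (h i) z else 0)"
  have "polynomial_map_upto d (card I) f"
    unfolding polynomial_map_upto_def
  proof
    fix i assume i: "i \<in> {1..card I}"
    then have "F (h i) \<in> polys_upto d" using bij_betwE[OF h] F by blast
    with i show "\<exists>p\<in>polys_upto d. \<forall>z\<in>ball 0 1. f z i = p z" by (auto simp: f_def)
  qed
  moreover have "f z \<in> coord_space (card I)" for z by (simp add: f_def coord_space_def)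
  moreover have "sqnorm (card I) (f z) = (\<Sum>x\<in>I. (cmod (F x z))\<^sup>2)" for z
  proof -
    have "sqnorm (card I) (f z) = (\<Sum>i=1..card I. (cmod (F (h i) z))\<^sup>2)"
      unfolding sqnorm_def by (rule sum.cong) (auto simp: f_def)
    also have "\<dots> = (\<Sum>x\<in>I. (cmod (F x z))\<^sup>2)" by (rule sum.reindex_bij_betw[OF h])
    finally show ?thesis .
  qed
  ultimately show ?thesis by blast
qed

text \<open>
  With a pair \<open>(\<alpha>, \<beta>)\<close> the off-diagonal entry is \<open>1 - i\<close> and with the pair \<open>(\<beta>, \<alpha>)\<close> it is \<open>1 + i\<close>. These
  numbers are linearly independent over the reals, so ordered pairs index a basis of the Hermitian forms.
\<close>

definition pencil :: "('n::finite \<Rightarrow> nat) \<times> ('n \<Rightarrow> nat) \<Rightarrow> complex ^ 'n \<Rightarrow> complex" where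
  "pencil p z = zpow z (fst p) + (1 + \<i>) * zpow z (snd p)"

lemma pencil_parallelogram:
  "(cmod (pencil p z))\<^sup>2 + (cmod (zpow z (fst p) - (1 + \<i>) * zpow z (snd p)))\<^sup>2
    = 2 * (cmod (zpow z (fst p)))\<^sup>2 + 4 * (cmod (zpow z (snd p)))\<^sup>2"
proof -
  have 1: "(cmod (x + y))\<^sup>2 + (cmod (x - y))\<^sup>2 = 2 * (cmod x)\<^sup>2 + 2 * (cmod y)\<^sup>2" for x y
    unfolding cmod_power2 by (simp add: power2_eq_square algebra_simps)
  have 2: "(cmod ((1 + \<i>) * y))\<^sup>2 = 2 * (cmod y)\<^sup>2" for y
    unfolding norm_mult power_mult_distrib cmod_power2[of "1 + \<i>"] by simp
  show ?thesis unfolding pencil_def 1 2 by simp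
qed

text \<open>
  Let \<open>x = z\<^sup>\<alpha>\<close> and \<open>y = (1 + i) z\<^sup>\<beta>\<close>. By the parallelogram law \<open>-|x + y|\<^sup>2 = |x - y|\<^sup>2 - 2|z\<^sup>\<alpha>|\<^sup>2 - 4|z\<^sup>\<beta>|\<^sup>2\<close>.
  This exhibits the function as a sum of squared moduli: the negative terms are absorbed by the diagonal,
  which has entries at least \<open>6\<epsilon>\<close> (6 rather than 4, as \<open>\<alpha> = \<beta>\<close> is possible). The remaining
  components are \<open>\<surd>\<epsilon> (x - y)\<close> and \<open>\<surd>\<epsilon> z\<^sub>i (x + y)\<close>.
\<close>

lemma tensored_map_exists:
  fixes w :: "('n::finite \<Rightarrow> nat) \<Rightarrow> real" and d :: nat
  defines "A \<equiv> {\<gamma> :: 'n \<Rightarrow> nat. 1 \<le> mdeg \<gamma> \<and> mdeg \<gamma> \<le> d}"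
  assumes \<epsilon>: "\<epsilon> \<ge> 0" "\<And>\<gamma>. \<gamma> \<in> A \<Longrightarrow> 6 * \<epsilon> \<le> w \<gamma>"
    and p: "1 \<le> mdeg (fst p)" "mdeg (fst p) < d" "1 \<le> mdeg (snd p)" "mdeg (snd p) < d"
  shows "\<exists>N f. polynomial_map_upto d N f \<and> (\<forall>z. f z \<in> coord_space N) \<and>
    (\<forall>z. sqnorm N (f z) = (\<Sum>\<gamma>\<in>A. w \<gamma> * (cmod (zpow z \<gamma>))\<^sup>2) + \<epsilon> * ((norm z)\<^sup>2 - 1) * (cmod (pencil p z))\<^sup>2)"
proof -
  have finA: "finite A" unfolding A_def by (rule finite_subset[OF _ finite_mdeg_le[of d]]) auto
  have pA: "fst p \<in> A" "snd p \<in> A" using p by (auto simp: A_def)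
  define v where "v = (\<lambda>\<gamma>. w \<gamma> - \<epsilon> * ((if \<gamma> = fst p then 2 else 0) + (if \<gamma> = snd p then 4 else 0)))"
  have v: "v \<gamma> \<ge> 0" if "\<gamma> \<in> A" for \<gamma>
    using \<epsilon>(2)[OF that] \<epsilon>(1) by (auto simp: v_def)
  define F where "F = (\<lambda>x z. case x of
      Inl \<gamma> \<Rightarrow> of_real (sqrt (v \<gamma>)) * zpow z \<gamma>
    | Inr None \<Rightarrow> of_real (sqrt \<epsilon>) * (zpow z (fst p) + - (1 + \<i>) * zpow z (snd p))
    | Inr (Some i) \<Rightarrow> of_real (sqrt \<epsilon>) * (z $ i * pencil p z))"
  have "F x \<in> polys_upto d" if x: "x \<in> A <+> (UNIV :: 'n option set)" for x
  proof (cases x)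
    case (Inl \<gamma>)
    then show ?thesis using x by (auto simp: F_def A_def intro!: polys_upto_cmult polys_upto_zpow)
  next
    case (Inr y)
    show ?thesis
    proof (cases y)
      case None
      then show ?thesis unfolding Inr F_def using p
        by (auto intro!: polys_upto_cmult polys_upto_add polys_upto_zpow)
    next
      case (Some i)
      have "pencil p \<in> polys_upto (d - 1)"
        unfolding pencil_def[abs_def] using p by (intro polys_upto_cmult polys_upto_add polys_upto_zpow) auto
      from polys_upto_mult[OF polys_upto_coord[of 1 i] this] p
      have "(\<lambda>z. z $ i * pencil p z) \<in> polys_upto d" by simp
      from polys_upto_cmult[OF this] show ?thesis by (simp add: Inr Some F_def)
    qed
  qed
  note Fp = this
  have "\<exists>N f. polynomial_map_upto d N f \<and> (\<forall>z. f z \<in> coord_space N) \<and>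
      (\<forall>z. sqnorm N (f z) = (\<Sum>x\<in>A <+> (UNIV :: 'n option set). (cmod (F x z))\<^sup>2))"
    by (rule polynomial_map_with_components[OF finite_Plus[OF finA finite]], rule Fp)
  then obtain N f where f: "polynomial_map_upto d N f" "\<forall>z. f z \<in> coord_space N"
    "\<forall>z. sqnorm N (f z) = (\<Sum>x\<in>A <+> (UNIV :: 'n option set). (cmod (F x z))\<^sup>2)"
    by (elim exE conjE)
  have "(\<Sum>x\<in>A <+> (UNIV :: 'n option set). (cmod (F x z))\<^sup>2) =
      (\<Sum>\<gamma>\<in>A. w \<gamma> * (cmod (zpow z \<gamma>))\<^sup>2) + \<epsilon> * ((norm z)\<^sup>2 - 1) * (cmod (pencil p z))\<^sup>2" for z
  proof -
    have 1: "(\<Sum>\<gamma>\<in>A. (cmod (F (Inl \<gamma>) z))\<^sup>2) =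
        (\<Sum>\<gamma>\<in>A. w \<gamma> * (cmod (zpow z \<gamma>))\<^sup>2) - \<epsilon> * (2 * (cmod (zpow z (fst p)))\<^sup>2 + 4 * (cmod (zpow z (snd p)))\<^sup>2)"
    proof -
      have "(\<Sum>\<gamma>\<in>A. (cmod (F (Inl \<gamma>) z))\<^sup>2) = (\<Sum>\<gamma>\<in>A. w \<gamma> * (cmod (zpow z \<gamma>))\<^sup>2
          - \<epsilon> * ((if \<gamma> = fst p then 2 * (cmod (zpow z \<gamma>))\<^sup>2 else 0) + (if \<gamma> = snd p then 4 * (cmod (zpow z \<gamma>))\<^sup>2 else 0)))"
      proof (rule sum.cong[OF refl])
        fix \<gamma> assume "\<gamma> \<in> A"
        then have vF: "(cmod (F (Inl \<gamma>) z))\<^sup>2 = v \<gamma> * (cmod (zpow z \<gamma>))\<^sup>2"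
          using v by (simp add: F_def norm_mult power_mult_distrib)
        show "(cmod (F (Inl \<gamma>) z))\<^sup>2 = w \<gamma> * (cmod (zpow z \<gamma>))\<^sup>2
          - \<epsilon> * ((if \<gamma> = fst p then 2 * (cmod (zpow z \<gamma>))\<^sup>2 else 0) + (if \<gamma> = snd p then 4 * (cmod (zpow z \<gamma>))\<^sup>2 else 0))"
          unfolding vF v_def
          by (cases "\<gamma> = fst p"; cases "\<gamma> = snd p") (simp_all add: algebra_simps)
      qed
      also have "\<dots> = (\<Sum>\<gamma>\<in>A. w \<gamma> * (cmod (zpow z \<gamma>))\<^sup>2) - \<epsilon> *
          ((\<Sum>\<gamma>\<in>A. if \<gamma> = fst p then 2 * (cmod (zpow z \<gamma>))\<^sup>2 else 0) + (\<Sum>\<gamma>\<in>A. if \<gamma> = snd p then 4 * (cmod (zpow z \<gamma>))\<^sup>2 else 0))"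
        by (simp only: sum_subtractf sum_distrib_left[symmetric] sum.distrib)
      finally show ?thesis using pA by (simp only: sum.delta[OF finA] if_True)
    qed
    have 2: "(cmod (F (Inr None) z))\<^sup>2 = \<epsilon> * (cmod (zpow z (fst p) - (1 + \<i>) * zpow z (snd p)))\<^sup>2"
    proof -
      have "zpow z (fst p) + - (1 + \<i>) * zpow z (snd p) = zpow z (fst p) - (1 + \<i>) * zpow z (snd p)"
        by (simp add: algebra_simps)
      then show ?thesis
        unfolding F_def sum.case option.case norm_mult power_mult_distrib using \<epsilon>(1) by simp
    qed
    have 3: "(\<Sum>i\<in>UNIV. (cmod (F (Inr (Some i)) z))\<^sup>2) = \<epsilon> * (norm z)\<^sup>2 * (cmod (pencil p z))\<^sup>2"
      unfolding norm_sq_eq_sum sum_distrib_left sum_distrib_right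
      using \<epsilon>(1) by (intro sum.cong refl) (simp add: F_def norm_mult power_mult_distrib)
    have "(\<Sum>x\<in>A <+> (UNIV :: 'n option set). (cmod (F x z))\<^sup>2) =
        (\<Sum>\<gamma>\<in>A. (cmod (F (Inl \<gamma>) z))\<^sup>2) + ((cmod (F (Inr None) z))\<^sup>2 + (\<Sum>i\<in>UNIV. (cmod (F (Inr (Some i)) z))\<^sup>2))"
    proof -
      have "(\<Sum>x\<in>(UNIV :: 'n option set). (cmod (F (Inr x) z))\<^sup>2) =
          (cmod (F (Inr None) z))\<^sup>2 + (\<Sum>i\<in>UNIV. (cmod (F (Inr (Some i)) z))\<^sup>2)"
        unfolding UNIV_option_conv by (subst sum.insert) (auto simp: sum.reindex)
      then show ?thesis using finA by (simp add: sum.Plus)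
    qed
    also have "\<dots> = (\<Sum>\<gamma>\<in>A. w \<gamma> * (cmod (zpow z \<gamma>))\<^sup>2) + \<epsilon> * ((norm z)\<^sup>2 - 1) * (cmod (pencil p z))\<^sup>2"
      unfolding 1 2 3 pencil_parallelogram[symmetric] by (simp add: algebra_simps)
    finally show ?thesis .
  qed
  with f show ?thesis by (intro exI[of _ N] exI[of _ f]) simp
qed

lemma sum_diagonal:
  fixes D :: "'x \<Rightarrow> complex"
  assumes "finite A"
  shows "(\<Sum>\<alpha>\<in>A. D \<alpha> * T \<alpha> \<alpha>) = (\<Sum>\<alpha>\<in>A. \<Sum>\<beta>\<in>A. (if \<beta> = \<alpha> then D \<alpha> else 0) * T \<alpha> \<beta>)"
proof (rule sum.cong[OF refl])
  fix \<alpha> assume "\<alpha> \<in> A"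
  have "(\<Sum>\<beta>\<in>A. (if \<beta> = \<alpha> then D \<alpha> else 0) * T \<alpha> \<beta>) = (\<Sum>\<beta>\<in>A. if \<beta> = \<alpha> then D \<alpha> * T \<alpha> \<beta> else 0)"
    by (rule sum.cong) auto
  then show "D \<alpha> * T \<alpha> \<alpha> = (\<Sum>\<beta>\<in>A. (if \<beta> = \<alpha> then D \<alpha> else 0) * T \<alpha> \<beta>)"
    using assms \<open>\<alpha> \<in> A\<close> by simp
qed

text \<open>
  The entry at \<open>(\<alpha>, \<beta>)\<close> off the diagonal is \<open>b(\<alpha>, \<beta>)(1 - i) + b(\<beta>, \<alpha>)(1 + i)\<close>; its vanishing forces both
  real numbers to be 0. Then only the pencils with \<open>\<alpha> = \<beta>\<close> are left, which contribute
  \<open>|2 + i|\<^sup>2 = 5\<close> on the diagonal.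
\<close>

lemma pencil_forms_independent:
  fixes b :: "('n::finite \<Rightarrow> nat) \<times> ('n \<Rightarrow> nat) \<Rightarrow> real"
  assumes A: "A \<subseteq> {\<gamma>. mdeg \<gamma> \<le> d}"
    and zero: "\<And>z. z \<in> ball 0 1 \<Longrightarrow> (\<Sum>p\<in>A \<times> A. b p * (cmod (pencil p z))\<^sup>2) = 0"
    and p: "p \<in> A \<times> A"
  shows "b p = 0"
proof -
  have finA: "finite A" by (rule finite_subset[OF A finite_mdeg_le])
  \<comment> \<open>\<open>D\<close> collects the contributions of the squared moduli of the single monomials to the diagonal, and
    \<open>E\<close> is the matrix of the whole combination.\<close>
  define D where "D = (\<lambda>\<alpha>. \<Sum>\<beta>\<in>A. complex_of_real (b (\<alpha>, \<beta>)) + 2 * complex_of_real (b (\<beta>, \<alpha>)))"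
  define E where "E = (\<lambda>\<alpha> \<beta>. of_real (b (\<alpha>, \<beta>)) * (1 - \<i>) + of_real (b (\<beta>, \<alpha>)) * (1 + \<i>) + (if \<beta> = \<alpha> then D \<alpha> else 0))"
  define c where "c = (\<lambda>\<alpha> \<beta>. if \<alpha> \<in> A \<and> \<beta> \<in> A then E \<alpha> \<beta> else 0)"
  have c0: "c \<alpha> \<beta> = 0" for \<alpha> \<beta>
  proof (rule hform_eq_0_imp_coeffs_0)
    show "mdeg \<alpha> \<le> d \<and> mdeg \<beta> \<le> d" if "c \<alpha> \<beta> \<noteq> 0" for \<alpha> \<beta>
      using that A by (auto simp: c_def split: if_splits)
    fix z :: "complex ^ 'n" assume z: "z \<in> ball 0 1"
    define T where "T = (\<lambda>\<alpha> \<beta>. zpow z \<alpha> * cnj (zpow z \<beta>))"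
    have "hform d c z = (\<Sum>\<alpha> | mdeg \<alpha> \<le> d. \<Sum>\<beta>\<in>A. c \<alpha> \<beta> * T \<alpha> \<beta>)"
      unfolding hform_def T_def
      by (rule sum.cong[OF refl], rule sum.mono_neutral_cong_right) (use A in \<open>auto simp: finite_mdeg_le c_def\<close>)
    also have "\<dots> = (\<Sum>\<alpha>\<in>A. \<Sum>\<beta>\<in>A. c \<alpha> \<beta> * T \<alpha> \<beta>)"
      by (rule sum.mono_neutral_right) (use A in \<open>auto simp: finite_mdeg_le c_def\<close>)
    also have "\<dots> = (\<Sum>\<alpha>\<in>A. \<Sum>\<beta>\<in>A. E \<alpha> \<beta> * T \<alpha> \<beta>)"
      by (intro sum.cong refl) (simp add: c_def)
    also have "\<dots> = (\<Sum>\<alpha>\<in>A. \<Sum>\<beta>\<in>A. of_real (b (\<alpha>, \<beta>)) * ((1 - \<i>) * T \<alpha> \<beta>))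
        + (\<Sum>\<alpha>\<in>A. \<Sum>\<beta>\<in>A. of_real (b (\<beta>, \<alpha>)) * ((1 + \<i>) * T \<alpha> \<beta>)) + (\<Sum>\<alpha>\<in>A. D \<alpha> * T \<alpha> \<alpha>)"
      unfolding sum_diagonal[OF finA] E_def by (simp only: distrib_right sum.distrib mult.assoc)
    also have "(\<Sum>\<alpha>\<in>A. \<Sum>\<beta>\<in>A. of_real (b (\<beta>, \<alpha>)) * ((1 + \<i>) * T \<alpha> \<beta>)) =
        (\<Sum>\<alpha>\<in>A. \<Sum>\<beta>\<in>A. of_real (b (\<alpha>, \<beta>)) * ((1 + \<i>) * T \<beta> \<alpha>))"
      by (rule sum.swap)
    also have "(\<Sum>\<alpha>\<in>A. D \<alpha> * T \<alpha> \<alpha>) = (\<Sum>\<alpha>\<in>A. \<Sum>\<beta>\<in>A. of_real (b (\<alpha>, \<beta>)) * T \<alpha> \<alpha>)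
        + (\<Sum>\<alpha>\<in>A. \<Sum>\<beta>\<in>A. 2 * of_real (b (\<beta>, \<alpha>)) * T \<alpha> \<alpha>)"
      unfolding D_def sum_distrib_right by (simp only: distrib_right sum.distrib)
    also have "(\<Sum>\<alpha>\<in>A. \<Sum>\<beta>\<in>A. 2 * of_real (b (\<beta>, \<alpha>)) * T \<alpha> \<alpha>) = (\<Sum>\<alpha>\<in>A. \<Sum>\<beta>\<in>A. 2 * of_real (b (\<alpha>, \<beta>)) * T \<beta> \<beta>)"
      by (rule sum.swap)
    also have "(\<Sum>\<alpha>\<in>A. \<Sum>\<beta>\<in>A. of_real (b (\<alpha>, \<beta>)) * ((1 - \<i>) * T \<alpha> \<beta>))
        + (\<Sum>\<alpha>\<in>A. \<Sum>\<beta>\<in>A. of_real (b (\<alpha>, \<beta>)) * ((1 + \<i>) * T \<beta> \<alpha>))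
        + ((\<Sum>\<alpha>\<in>A. \<Sum>\<beta>\<in>A. of_real (b (\<alpha>, \<beta>)) * T \<alpha> \<alpha>) + (\<Sum>\<alpha>\<in>A. \<Sum>\<beta>\<in>A. 2 * of_real (b (\<alpha>, \<beta>)) * T \<beta> \<beta>))
        = (\<Sum>\<alpha>\<in>A. \<Sum>\<beta>\<in>A. of_real (b (\<alpha>, \<beta>) * (cmod (pencil (\<alpha>, \<beta>) z))\<^sup>2))"
      unfolding sum.distrib[symmetric]
    proof (intro sum.cong refl)
      fix \<alpha> \<beta>
      have "complex_of_real ((cmod (pencil (\<alpha>, \<beta>) z))\<^sup>2) = (1 - \<i>) * T \<alpha> \<beta> + (1 + \<i>) * T \<beta> \<alpha> + (T \<alpha> \<alpha> + 2 * T \<beta> \<beta>)"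
        unfolding complex_norm_square pencil_def T_def
        by (simp add: algebra_simps)
      note sq = this
      show "of_real (b (\<alpha>, \<beta>)) * ((1 - \<i>) * T \<alpha> \<beta>) + of_real (b (\<alpha>, \<beta>)) * ((1 + \<i>) * T \<beta> \<alpha>)
          + (of_real (b (\<alpha>, \<beta>)) * T \<alpha> \<alpha> + 2 * of_real (b (\<alpha>, \<beta>)) * T \<beta> \<beta>)
          = complex_of_real (b (\<alpha>, \<beta>) * (cmod (pencil (\<alpha>, \<beta>) z))\<^sup>2)"
        unfolding of_real_mult sq by (simp add: algebra_simps)
    qed
    also have "\<dots> = of_real (\<Sum>p\<in>A \<times> A. b p * (cmod (pencil p z))\<^sup>2)"
      unfolding of_real_sum sum.cartesian_product by (simp add: case_prod_unfold)
    also have "\<dots> = 0" using zero[OF z] by simp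
    finally show "hform d c z = 0" .
  qed
  have off: "b (\<alpha>, \<beta>) = 0" if "\<alpha> \<in> A" "\<beta> \<in> A" "\<alpha> \<noteq> \<beta>" for \<alpha> \<beta>
  proof -
    have "E \<alpha> \<beta> = 0" using c0[of \<alpha> \<beta>] that by (simp add: c_def)
    then show ?thesis using that(3) by (simp add: E_def complex_eq_iff)
  qed
  have diag: "b (\<alpha>, \<alpha>) = 0" if \<alpha>: "\<alpha> \<in> A" for \<alpha>
  proof -
    have "D \<alpha> = (\<Sum>\<beta>\<in>A. if \<beta> = \<alpha> then 3 * complex_of_real (b (\<alpha>, \<alpha>)) else 0)"
      unfolding D_def by (rule sum.cong[OF refl]) (use off \<alpha> in auto)
    also have "\<dots> = 3 * complex_of_real (b (\<alpha>, \<alpha>))" using finA \<alpha> by simp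
    finally have "D \<alpha> = 3 * complex_of_real (b (\<alpha>, \<alpha>))" .
    moreover have "E \<alpha> \<alpha> = 0" using c0[of \<alpha> \<alpha>] \<alpha> by (simp add: c_def)
    ultimately show ?thesis by (simp add: E_def complex_eq_iff)
  qed
  obtain \<alpha> \<beta> where "p = (\<alpha>, \<beta>)" "\<alpha> \<in> A" "\<beta> \<in> A" using p by auto
  then show ?thesis using off[of \<alpha> \<beta>] diag[of \<alpha>] by (cases "\<alpha> = \<beta>") auto
qed

lemma form_rank_le:
  fixes c :: "'a \<Rightarrow> 'b \<Rightarrow> complex"
  assumes A: "finite A" and supp: "\<And>\<alpha> \<beta>. \<beta> \<notin> A \<Longrightarrow> c \<alpha> \<beta> = 0"
  shows "form_rank c \<le> card A"
proof -
  define e where "e = (\<lambda>\<beta> x :: 'b. if x = \<beta> then 1 else 0 :: complex)"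
  have "c \<alpha> \<in> fs.span (e ` A)" for \<alpha>
  proof -
    have "c \<alpha> = (\<Sum>\<beta>\<in>A. fun_scale (c \<alpha> \<beta>) (e \<beta>))"
    proof
      fix x
      have "(\<Sum>\<beta>\<in>X. fun_scale (c \<alpha> \<beta>) (e \<beta>)) x = (\<Sum>\<beta>\<in>X. c \<alpha> \<beta> * e \<beta> x)" for X
        by (induction X rule: infinite_finite_induct) (auto simp: fun_scale_def)
      then have "(\<Sum>\<beta>\<in>A. fun_scale (c \<alpha> \<beta>) (e \<beta>)) x = (\<Sum>\<beta>\<in>A. if x = \<beta> then c \<alpha> \<beta> else 0)"
        by (simp add: e_def if_distrib[of "\<lambda>y. _ * y"] cong: if_cong)
      then show "c \<alpha> x = (\<Sum>\<beta>\<in>A. fun_scale (c \<alpha> \<beta>) (e \<beta>)) x" using A supp by simp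
    qed
    also have "\<dots> \<in> fs.span (e ` A)" by (auto intro: fs.span_sum fs.span_scale fs.span_base)
    finally show ?thesis .
  qed
  then have "vector_space.dim fun_scale (range c) \<le> card (e ` A)"
    using A by (intro fs.dim_le_card) auto
  also have "\<dots> \<le> card A" by (rule card_image_le[OF A])
  finally show ?thesis by (simp add: form_rank_def)
qed

lemma form_rank_diagonal:
  fixes w :: "'a \<Rightarrow> complex"
  assumes A: "finite A" and w: "\<And>\<alpha>. \<alpha> \<in> A \<Longrightarrow> w \<alpha> \<noteq> 0"
  shows "form_rank (\<lambda>\<alpha> \<beta>. if \<beta> = \<alpha> \<and> \<alpha> \<in> A then w \<alpha> else 0) = card A"
  unfolding form_rank_def
proof (rule dim_eq_card_basis_family[OF A, where b = "\<lambda>\<alpha> \<beta>. if \<beta> = \<alpha> \<and> \<alpha> \<in> A then w \<alpha> else 0"])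
  have val: "(\<Sum>x\<in>A. c x * (if z = x \<and> x \<in> A then w x else 0)) = (if z \<in> A then c z * w z else 0)" for c z
  proof -
    have "(\<Sum>x\<in>A. c x * (if z = x \<and> x \<in> A then w x else 0)) = (\<Sum>x\<in>A. if z = x then c x * w x else 0)"
      by (rule sum.cong) auto
    then show ?thesis using A by simp
  qed
  show "c x = 0" if zero: "\<And>z. (\<Sum>x\<in>A. c x * (if z = x \<and> x \<in> A then w x else 0)) = 0" and x: "x \<in> A" for c x
    using zero[of x] x w unfolding val by auto
  fix p assume "p \<in> range (\<lambda>\<alpha> \<beta>. if \<beta> = \<alpha> \<and> \<alpha> \<in> A then w \<alpha> else 0)"
  then obtain \<alpha> where "p = (\<lambda>\<beta>. if \<beta> = \<alpha> \<and> \<alpha> \<in> A then w \<alpha> else 0)" by blast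
  then show "\<exists>c. p = (\<lambda>z. \<Sum>x\<in>A. c x * (if z = x \<and> x \<in> A then w x else 0))"
    unfolding val by (intro exI[of _ "\<lambda>x. if x = \<alpha> then 1 else 0"]) auto
qed (rule image_mono[OF subset_UNIV])

section \<open>Members of a polynomial family\<close>

lemma polynomial_map_upto_if_polynomial_form:
  assumes "holomorphic_map N g" and c: "polynomial_form d (\<lambda>z. sqnorm N (g z)) c"
  shows "polynomial_map_upto d N g"
proof -
  have "c \<alpha> \<alpha> = 0" if "d < mdeg \<alpha>" for \<alpha>
    using c that unfolding polynomial_form_def by (meson not_le)
  then show ?thesis
    using polynomial_map_upto_iff_diagonal[OF polynomial_map_if_polynomial_form[OF assms] c, of d] by simp
qed

definition family_form ::
    "nat \<Rightarrow> (nat \<Rightarrow> ('n::finite \<Rightarrow> nat) \<Rightarrow> ('n \<Rightarrow> nat) \<Rightarrow> complex) \<Rightarrow> (nat \<Rightarrow> real)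
      \<Rightarrow> ('n \<Rightarrow> nat) \<Rightarrow> ('n \<Rightarrow> nat) \<Rightarrow> complex" where
  "family_form k C lam = (\<lambda>\<alpha> \<beta>. \<Sum>i=1..k+1. of_real (weight k lam i) * C i \<alpha> \<beta>)"

lemma family_form_vertex:
  assumes "i \<in> {1..k+1}"
  shows "family_form k C (vertex k i) = C i"
proof (intro ext)
  fix \<alpha> \<beta>
  have "family_form k C (vertex k i) \<alpha> \<beta> = (\<Sum>j=1..k+1. if j = i then C j \<alpha> \<beta> else 0)"
    unfolding family_form_def by (rule sum.cong) (use weight_vertex[OF assms] in auto)
  also have "\<dots> = C i \<alpha> \<beta>" by (simp only: sum.delta finite_atLeastAtMost assms if_True)
  finally show "family_form k C (vertex k i) \<alpha> \<beta> = C i \<alpha> \<beta>" .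
qed

lemma family_form_affine:
  "family_form k C (\<lambda>i. (1 - t) * x i + t * y i) \<alpha> \<beta> =
    of_real (1 - t) * family_form k C x \<alpha> \<beta> + of_real t * family_form k C y \<alpha> \<beta>"
  unfolding family_form_def weight_affine
  by (simp only: of_real_add of_real_mult distrib_right sum.distrib sum_distrib_left mult.assoc)

text \<open>
  A member is determined up to norm equivalence by its parameter, so its form is the corresponding
  affine combination of the forms of the generating maps.
\<close>

lemma polynomial_family_members:
  assumes C: "\<And>i. i \<in> {1..k+1} \<Longrightarrow> polynomial_form d (\<lambda>z. sqnorm (N i) (f i z)) (C i)"
    and mem: "(M, g) \<in> members_at k N f lam"
  shows "polynomial_form d (\<lambda>z. sqnorm M (g z)) (family_form k C lam)"
    and "polynomial_map_upto d M g"
proof -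
  have g: "proper_holomorphic_map M g" "\<And>z. z \<in> ball 0 1 \<Longrightarrow> sqnorm M (g z) = family_R k N f lam z"
    using mem by (auto simp: members_at_def)
  show form: "polynomial_form d (\<lambda>z. sqnorm M (g z)) (family_form k C lam)"
    unfolding family_form_def by (rule polynomial_form_cong[OF family_R_form[OF C] g(2)])
  have "holomorphic_map M g" using g(1) by (simp add: proper_holomorphic_map_def)
  then show "polynomial_map_upto d M g"
    using form by (rule polynomial_map_upto_if_polynomial_form)
qed

text \<open>
  Admissibility of a parameter only provides some holomorphic map with the right squared norm. It is
  polynomial, and an affine combination of functions equal to 1 on the sphere is 1 there, so the map is
  proper once its components beyond the target dimension are set to 0.
\<close>

lemma polynomial_family_members_exist:
  fixes f :: "nat \<Rightarrow> complex ^ 'n::finite \<Rightarrow> nat \<Rightarrow> complex"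
  assumes C: "\<And>i. i \<in> {1..k+1} \<Longrightarrow> polynomial_form d (\<lambda>z. sqnorm (N i) (f i z)) (C i)"
    and sphere: "\<And>i \<zeta>. i \<in> {1..k+1} \<Longrightarrow> norm \<zeta> = 1 \<Longrightarrow> hform d (C i) \<zeta> = 1"
    and f0: "\<And>i. i \<in> {1..k+1} \<Longrightarrow> sqnorm (N i) (f i 0) = 0"
    and lam: "lam \<in> family_K k N f"
  shows "members_at k N f lam \<noteq> {}"
proof -
  obtain M g' where g': "holomorphic_map M g'" "\<And>z. z \<in> ball 0 1 \<Longrightarrow> family_R k N f lam z = sqnorm M (g' z)"
    using lam unfolding family_K_eq P_inf_def by blast
  define g where "g = (\<lambda>z i. if i \<in> {1..M} then g' z i else 0)"
  have gM: "sqnorm M (g z) = sqnorm M (g' z)" for z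
    unfolding sqnorm_def by (rule sum.cong) (auto simp: g_def)
  have hol: "holomorphic_map M g" using g'(1) by (simp add: holomorphic_map_def g_def)
  have form: "polynomial_form d (\<lambda>z. sqnorm M (g z)) (family_form k C lam)"
    unfolding family_form_def by (rule polynomial_form_cong[OF family_R_form[OF C]]) (simp_all add: gM g'(2))
  have poly: "polynomial_map_upto d M g"
    by (rule polynomial_map_upto_if_polynomial_form[OF hol form])
  have "hform d (family_form k C lam) \<zeta> = 1" if \<zeta>: "norm \<zeta> = 1" for \<zeta>
  proof -
    have "hform d (family_form k C lam) \<zeta> = (\<Sum>i=1..k+1. of_real (weight k lam i) * hform d (C i) \<zeta>)"
      unfolding family_form_def by (rule hform_sum)
    also have "\<dots> = (\<Sum>i=1..k+1. of_real (weight k lam i))"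
      by (rule sum.cong) (use sphere \<zeta> in auto)
    also have "\<dots> = of_real (\<Sum>i=1..k+1. weight k lam i)" by simp
    finally show ?thesis unfolding sum_weight by simp
  qed
  moreover have "sqnorm M (g 0) = 0"
  proof -
    have "family_R k N f lam 0 = 0"
      unfolding family_R_weight by (rule sum.neutral) (use f0 in simp)
    then show ?thesis by (simp add: gM g'(2)[symmetric])
  qed
  moreover have "g z \<in> coord_space M" for z by (simp add: g_def coord_space_def)
  ultimately have "proper_holomorphic_map M g"
    by (intro proper_if_hform_1_on_sphere[OF poly form])
  then have "(M, g) \<in> members_at k N f lam"
    by (simp add: members_at_def gM g'(2))
  then show ?thesis by blast
qed

lemma polynomial_form_diagonal_nonneg:
  assumes f: "polynomial_map_upto d N f" and c: "polynomial_form D (\<lambda>z. sqnorm N (f z)) c"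
  shows "0 \<le> Re (c \<alpha> \<alpha>)"
proof -
  obtain a where form: "polynomial_form d (\<lambda>z. sqnorm N (f z)) (\<lambda>\<alpha> \<beta>. \<Sum>i=1..N. a i \<alpha> * cnj (a i \<beta>))"
    using polynomial_map_upto_coeffs[OF f] by (elim exE conjE)
  have "c = (\<lambda>\<alpha> \<beta>. \<Sum>i=1..N. a i \<alpha> * cnj (a i \<beta>))"
    using underlying_form_polynomial[OF c] underlying_form_polynomial[OF form] by simp
  then show ?thesis by (auto intro!: sum_nonneg)
qed

text \<open>
  The diagonal entry at \<open>\<alpha>\<close> is an affine function of the parameter that is nonnegative on the parameter set
  and positive at one vertex. On the segment from any parameter to this vertex it is positive except
  possibly at the starting point.
\<close>

lemma generic_degree_if_top_coefficient:
  fixes f :: "nat \<Rightarrow> complex ^ 'n::finite \<Rightarrow> nat \<Rightarrow> complex"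
  assumes C: "\<And>i. i \<in> {1..k+1} \<Longrightarrow> polynomial_form d (\<lambda>z. sqnorm (N i) (f i z)) (C i)"
    and ex: "\<And>lam. lam \<in> family_K k N f \<Longrightarrow> members_at k N f lam \<noteq> {}"
    and l: "l \<in> {1..k+1}" "proper_holomorphic_map (N l) (f l)"
    and \<alpha>: "mdeg \<alpha> = d" "Re (C l \<alpha> \<alpha>) > 0"
  shows "has_generic_degree k N f d"
proof -
  define q where "q = (\<lambda>lam. Re (family_form k C lam \<alpha> \<alpha>))"
  define G where "G = {lam \<in> family_K k N f. 0 < q lam}"
  have contq: "continuous_on UNIV q"
    unfolding q_def family_form_def by (intro continuous_intros continuous_on_weight)
  have q_affine: "q (\<lambda>i. (1 - t) * x i + t * y i) = (1 - t) * q x + t * q y" for t x y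
    unfolding q_def family_form_affine by simp
  have q_nonneg: "0 \<le> q lam" if K: "lam \<in> family_K k N f" for lam
  proof -
    obtain M g where "(M, g) \<in> members_at k N f lam" using ex[OF K] by auto
    from polynomial_form_diagonal_nonneg[OF polynomial_family_members(2,1)[OF C this]]
    show ?thesis unfolding q_def by blast
  qed
  have vK: "vertex k l \<in> family_K k N f" by (rule vertex_member(1)[OF l(1), of N f, OF l(2)])
  have vq: "q (vertex k l) > 0" using \<alpha>(2) by (simp add: q_def family_form_vertex[OF l(1)])
  have "openin (top_of_set (family_K k N f)) G"
  proof -
    have "open {lam. 0 < q lam}" by (intro open_Collect_less contq continuous_intros)
    moreover have "G = family_K k N f \<inter> {lam. 0 < q lam}" by (auto simp: G_def)
    ultimately show ?thesis by (simp add: openin_open_Int)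
  qed
  moreover have "family_K k N f \<subseteq> closure G"
  proof
    fix lam assume K: "lam \<in> family_K k N f"
    define L where "L = (\<lambda>t i. (1 - t) * lam i + t * vertex k l i)"
    have "L t \<in> G" if t: "0 < t" "t \<le> 1" for t
    proof -
      have "L t \<in> family_K k N f"
        using convex_family_K[of k N f] K vK t unfolding convex_seqs_def L_def by auto
      moreover have "0 < q (L t)"
        unfolding L_def q_affine using q_nonneg[OF K] vq t
        by (intro add_nonneg_pos mult_nonneg_nonneg mult_pos_pos) auto
      ultimately show ?thesis by (simp add: G_def)
    qed
    then have "L (inverse (real (Suc n))) \<in> closure G" for n
      by (intro subsetD[OF closure_subset]) (simp add: field_simps)
    moreover have "(\<lambda>n. L (inverse (real (Suc n)))) \<longlonglongrightarrow> L 0"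
    proof -
      have "continuous_on UNIV L"
        unfolding L_def by (intro continuous_on_coordinatewise_then_product continuous_intros)
      then have "isCont L 0" by (simp add: continuous_on_eq_continuous_at)
      from isCont_tendsto_compose[OF this LIMSEQ_inverse_real_of_nat] show ?thesis .
    qed
    ultimately have "L 0 \<in> closure G"
      by (intro Lim_in_closed_set[OF closed_closure, of "\<lambda>n. L (inverse (real (Suc n)))"]) auto
    then show "lam \<in> closure G" by (simp add: L_def)
  qed
  moreover have "(\<lambda>(M, g). map_degree M g) ` members_at k N f lam = {d}" if lam: "lam \<in> G" for lam
  proof -
    have "map_degree M g = d" if mem: "(M, g) \<in> members_at k N f lam" for M g
    proof -
      note form = polynomial_family_members(1)[OF C mem] and up = polynomial_family_members(2)[OF C mem]
      have "\<not> polynomial_map_upto e M g" if e: "e < d" for e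
      proof
        assume "polynomial_map_upto e M g"
        then have "family_form k C lam \<alpha> \<alpha> = 0"
          using polynomial_map_upto_iff_diagonal[OF _ form, of e] \<alpha>(1) e unfolding polynomial_map_def by blast
        then show False using lam by (simp add: G_def q_def)
      qed
      then show ?thesis unfolding map_degree_def using up by (intro Least_equality) (auto simp: not_less[symmetric])
    qed
    moreover have "members_at k N f lam \<noteq> {}" using lam ex by (simp add: G_def)
    ultimately show ?thesis by fast
  qed
  ultimately show ?thesis unfolding has_generic_degree_def by blast
qed

section \<open>The extremal family\<close>

lemma continuous_on_tensored_sqnorm:
  "continuous_on S (\<lambda>z. (\<Sum>\<gamma>\<in>A. w \<gamma> * (cmod (zpow z \<gamma>))\<^sup>2) + \<epsilon> * ((norm z)\<^sup>2 - 1) * (cmod (pencil p z))\<^sup>2)"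
  unfolding pencil_def by (intro continuous_intros continuous_on_zpow)

text \<open>
  The maps \<open>f\<^sub>i\<close> with \<open>i \<le> k\<close> are the tensored maps for an enumeration \<open>h\<close> of \<open>A\<^bsub>d-1\<^esub> \<times> A\<^bsub>d-1\<^esub>\<close>, and \<open>f\<^bsub>k+1\<^esub>\<close> is
  the base map. For their independence, a relation \<open>\<Sum> a\<^sub>i R\<^sub>i = 0\<close> yields \<open>\<Sum> a\<^sub>i = 0\<close> on the sphere; then the
  base part cancels, \<open>\<parallel>z\<parallel>\<^sup>2 - 1\<close> can be divided out, and a relation between the pencil forms remains.
\<close>

theorem extremal_family_exists:
  fixes d k :: nat
  assumes d: "d \<ge> 1" and k: "k = (delta TYPE('n::finite) (d - 1))\<^sup>2"
  shows "\<exists>N (f :: nat \<Rightarrow> complex ^ 'n \<Rightarrow> nat \<Rightarrow> complex).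
    convex_family k N f \<and> polynomial_family k N f \<and>
    has_generic_degree k N f d \<and> family_rank k N f = delta TYPE('n) d"
proof -
  define A where "A = {\<gamma> :: 'n \<Rightarrow> nat. 1 \<le> mdeg \<gamma> \<and> mdeg \<gamma> \<le> d}"
  define A' where "A' = {\<gamma> :: 'n \<Rightarrow> nat. 1 \<le> mdeg \<gamma> \<and> mdeg \<gamma> \<le> d - 1}"
  have finA: "finite A" unfolding A_def by (rule finite_subset[OF _ finite_mdeg_le[of d]]) auto
  have finA': "finite A'" unfolding A'_def by (rule finite_subset[OF _ finite_mdeg_le[of "d - 1"]]) auto
  define \<alpha>0 :: "'n \<Rightarrow> nat" where "\<alpha>0 = (\<lambda>j. if j = undefined then d else 0)"
  have \<alpha>0: "mdeg \<alpha>0 = d" "\<alpha>0 \<in> A" using d by (simp_all add: A_def \<alpha>0_def mdeg_unit)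
  obtain w :: "('n \<Rightarrow> nat) \<Rightarrow> real" where
    "\<forall>\<gamma>. 1 \<le> mdeg \<gamma> \<and> mdeg \<gamma> \<le> d \<longrightarrow> w \<gamma> > 0"
    "\<forall>z :: complex ^ 'n. norm z = 1 \<longrightarrow> (\<Sum>\<gamma> | 1 \<le> mdeg \<gamma> \<and> mdeg \<gamma> \<le> d. w \<gamma> * (cmod (zpow z \<gamma>))\<^sup>2) = 1"
    using positive_diagonal_form_1_on_sphere[OF d] by (elim exE conjE)
  then have w: "\<And>\<gamma>. \<gamma> \<in> A \<Longrightarrow> w \<gamma> > 0"
    and w1: "\<And>z :: complex ^ 'n. norm z = 1 \<Longrightarrow> (\<Sum>\<gamma>\<in>A. w \<gamma> * (cmod (zpow z \<gamma>))\<^sup>2) = 1"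
    by (simp_all add: A_def)
  define \<epsilon> where "\<epsilon> = Min (w ` A) / 6"
  have "Min (w ` A) \<in> w ` A" using finA \<alpha>0(2) by (intro Min_in) auto
  then have \<epsilon>: "\<epsilon> > 0" using w by (auto simp: \<epsilon>_def)
  have \<epsilon>w: "6 * \<epsilon> \<le> w \<gamma>" if "\<gamma> \<in> A" for \<gamma>
    using finA that by (simp add: \<epsilon>_def)
  have cardk: "k = card (A' \<times> A')"
    by (simp add: k card_cartesian_product A'_def delta_eq_card power2_eq_square)
  obtain h where h: "bij_betw h {1..k} (A' \<times> A')"
    using ex_bij_betw_nat_finite_1[of "A' \<times> A'"] finA' cardk by auto
  define h' where "h' = inv_into {1..k} h"
  have h': "h' (h i) = i" if "i \<in> {1..k}" for i
    unfolding h'_def by (rule bij_betw_inv_into_left[OF h that])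
  \<comment> \<open>The value 0 beyond \<open>k\<close> lets one formula cover the base map too.\<close>
  define \<eta> where "\<eta> = (\<lambda>i. if i \<in> {1..k} then \<epsilon> else 0)"
  define R where "R = (\<lambda>i z. (\<Sum>\<gamma>\<in>A. w \<gamma> * (cmod (zpow z \<gamma>))\<^sup>2) + \<eta> i * ((norm z)\<^sup>2 - 1) * (cmod (pencil (h i) z))\<^sup>2)"
  have "\<exists>N f. polynomial_map_upto d N f \<and> (\<forall>z. f z \<in> coord_space N) \<and> (\<forall>z. sqnorm N (f z) = R i z)"
    for i
  proof (cases "i \<in> {1..k}")
    case True
    then have "h i \<in> A' \<times> A'" using bij_betwE[OF h] by blast
    then have "1 \<le> mdeg (fst (h i))" "mdeg (fst (h i)) < d" "1 \<le> mdeg (snd (h i))" "mdeg (snd (h i)) < d"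
      by (auto simp: A'_def)
    from tensored_map_exists[OF _ _ this, of \<epsilon> w] \<epsilon> \<epsilon>w True
    show ?thesis by (simp add: R_def \<eta>_def A_def)
  next
    case False
    have "\<exists>N f. polynomial_map_upto d N f \<and> (\<forall>z. f z \<in> coord_space N) \<and>
        (\<forall>z :: complex ^ 'n. sqnorm N (f z) = (\<Sum>\<gamma>\<in>A. (cmod (of_real (sqrt (w \<gamma>)) * zpow z \<gamma>))\<^sup>2))"
      by (rule polynomial_map_with_components[OF finA], rule polys_upto_cmult, rule polys_upto_zpow)
        (simp add: A_def)
    then obtain N and f :: "complex ^ 'n \<Rightarrow> nat \<Rightarrow> complex" where f: "polynomial_map_upto d N f" "\<forall>z. f z \<in> coord_space N"
      "\<forall>z. sqnorm N (f z) = (\<Sum>\<gamma>\<in>A. (cmod (of_real (sqrt (w \<gamma>)) * zpow z \<gamma>))\<^sup>2)"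
      by (elim exE conjE)
    have "(\<Sum>\<gamma>\<in>A. (cmod (of_real (sqrt (w \<gamma>)) * zpow z \<gamma>))\<^sup>2) = R i z" for z
    proof -
      have "(\<Sum>\<gamma>\<in>A. (cmod (of_real (sqrt (w \<gamma>)) * zpow z \<gamma>))\<^sup>2) = (\<Sum>\<gamma>\<in>A. w \<gamma> * (cmod (zpow z \<gamma>))\<^sup>2)"
        by (rule sum.cong[OF refl]) (use w in \<open>simp add: norm_mult power_mult_distrib less_imp_le\<close>)
      moreover have "\<eta> i = 0" unfolding \<eta>_def using False by (simp only: if_False)
      ultimately show ?thesis unfolding R_def by simp
    qed
    with f show ?thesis by (intro exI[of _ N] exI[of _ f]) simp
  qed
  then have "\<forall>i. \<exists>N f. polynomial_map_upto d N f \<and> (\<forall>z. f z \<in> coord_space N) \<and> (\<forall>z. sqnorm N (f z) = R i z)" ..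
  from choice[OF this] obtain N where "\<forall>i. \<exists>f. polynomial_map_upto d (N i) f \<and>
      (\<forall>z. f z \<in> coord_space (N i)) \<and> (\<forall>z. sqnorm (N i) (f z) = R i z)" ..
  from choice[OF this] obtain f where f: "\<forall>i. polynomial_map_upto d (N i) (f i) \<and>
      (\<forall>z. f i z \<in> coord_space (N i)) \<and> (\<forall>z. sqnorm (N i) (f i z) = R i z)" ..
  have fpoly: "polynomial_map_upto d (N i) (f i)" and fcoord: "f i z \<in> coord_space (N i)"
    and fR: "sqnorm (N i) (f i z) = R i z" for i z
    using f by simp_all
  have R_sphere: "R i \<zeta> = 1" if "norm \<zeta> = 1" for i \<zeta>
    using w1[OF that] that by (simp add: R_def)
  have contR: "continuous_on S (R i)" for S i
    unfolding R_def by (rule continuous_on_tensored_sqnorm)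
  have R_limit: "(\<lambda>n. R i ((1 - inverse (real (Suc n))) *\<^sub>R \<zeta>)) \<longlonglongrightarrow> R i \<zeta>" for i \<zeta>
  proof -
    have "isCont (R i) \<zeta>" using contR[of UNIV i] by (simp add: continuous_on_eq_continuous_at)
    from isCont_tendsto_compose[OF this approach_sphere] show ?thesis .
  qed
  have f0: "sqnorm (N i) (f i 0) = 0" for i
  proof -
    have "(\<Sum>\<gamma>\<in>A. w \<gamma> * (cmod (zpow 0 \<gamma>))\<^sup>2) = 0"
      by (rule sum.neutral) (auto simp: A_def zpow_0)
    moreover have "\<eta> i * (cmod (pencil (h i) 0))\<^sup>2 = 0"
    proof (cases "i \<in> {1..k}")
      case True
      then have "h i \<in> A' \<times> A'" using bij_betwE[OF h] by blast
      then show ?thesis by (auto simp: pencil_def zpow_0 A'_def)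
    qed (simp only: \<eta>_def if_False mult_zero_left)
    ultimately show ?thesis unfolding fR R_def by simp
  qed
  have "\<forall>i. \<exists>c. polynomial_form d (\<lambda>z. sqnorm (N i) (f i z)) c \<and> (\<forall>\<alpha> \<beta>. c \<beta> \<alpha> = cnj (c \<alpha> \<beta>)) \<and>
      (\<forall>\<alpha> \<beta>. c \<alpha> \<beta> \<noteq> 0 \<longrightarrow> 1 \<le> mdeg \<alpha> \<and> mdeg \<alpha> \<le> d \<and> 1 \<le> mdeg \<beta> \<and> mdeg \<beta> \<le> d)"
  proof
    fix i
    show "\<exists>c. polynomial_form d (\<lambda>z. sqnorm (N i) (f i z)) c \<and> (\<forall>\<alpha> \<beta>. c \<beta> \<alpha> = cnj (c \<alpha> \<beta>)) \<and>
      (\<forall>\<alpha> \<beta>. c \<alpha> \<beta> \<noteq> 0 \<longrightarrow> 1 \<le> mdeg \<alpha> \<and> mdeg \<alpha> \<le> d \<and> 1 \<le> mdeg \<beta> \<and> mdeg \<beta> \<le> d)"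
      by (rule origin_preserving_form_no_pure_terms[OF fpoly[of i] f0[of i]])
  qed
  from choice[OF this] obtain C where
    CC: "\<forall>i. polynomial_form d (\<lambda>z. sqnorm (N i) (f i z)) (C i) \<and> (\<forall>\<alpha> \<beta>. C i \<beta> \<alpha> = cnj (C i \<alpha> \<beta>)) \<and>
      (\<forall>\<alpha> \<beta>. C i \<alpha> \<beta> \<noteq> 0 \<longrightarrow> 1 \<le> mdeg \<alpha> \<and> mdeg \<alpha> \<le> d \<and> 1 \<le> mdeg \<beta> \<and> mdeg \<beta> \<le> d)" ..
  have C: "polynomial_form d (\<lambda>z. sqnorm (N i) (f i z)) (C i)" for i
    by (rule CC[rule_format, THEN conjunct1])
  have supp: "\<beta> \<in> A" if "C i \<alpha> \<beta> \<noteq> 0" for i \<alpha> \<beta>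
    using CC[rule_format, THEN conjunct2, THEN conjunct2] that unfolding A_def by blast
  have sphere: "hform d (C i) \<zeta> = 1" if \<zeta>: "norm \<zeta> = 1" for i \<zeta>
  proof -
    have "(\<lambda>n. complex_of_real (R i ((1 - inverse (real (Suc n))) *\<^sub>R \<zeta>))) \<longlonglongrightarrow> of_real (R i \<zeta>)"
      by (rule tendsto_of_real[OF R_limit])
    from LIMSEQ_unique[OF hform_sphere_limit[OF C \<zeta>, unfolded fR] this] R_sphere[OF \<zeta>]
    show ?thesis by simp
  qed
  have proper: "proper_holomorphic_map (N i) (f i)" for i
    by (rule proper_if_hform_1_on_sphere[OF fpoly C sphere f0 fcoord])
  have base: "C (k + 1) = (\<lambda>\<alpha> \<beta>. if \<beta> = \<alpha> \<and> \<alpha> \<in> A then of_real (w \<alpha>) else 0)" (is "_ = ?c")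
  proof -
    have "polynomial_form d (\<lambda>z. sqnorm (N (k + 1)) (f (k + 1) z)) ?c"
      unfolding polynomial_form_def
    proof (intro conjI ballI)
      show "\<forall>\<alpha> \<beta>. ?c \<alpha> \<beta> \<noteq> 0 \<longrightarrow> mdeg \<alpha> \<le> d \<and> mdeg \<beta> \<le> d" by (auto simp: A_def)
      fix z :: "complex ^ 'n"
      have "hform d ?c z = (\<Sum>\<alpha> | mdeg \<alpha> \<le> d. if \<alpha> \<in> A then of_real (w \<alpha>) * zpow z \<alpha> * cnj (zpow z \<alpha>) else 0)"
        unfolding hform_def
      proof (rule sum.cong[OF refl])
        fix \<alpha> :: "'n \<Rightarrow> nat" assume "\<alpha> \<in> {\<alpha>. mdeg \<alpha> \<le> d}"
        moreover have "(\<Sum>\<beta> | mdeg \<beta> \<le> d. ?c \<alpha> \<beta> * zpow z \<alpha> * cnj (zpow z \<beta>)) =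
            (\<Sum>\<beta> | mdeg \<beta> \<le> d. if \<beta> = \<alpha> then (if \<alpha> \<in> A then of_real (w \<alpha>) * zpow z \<alpha> * cnj (zpow z \<beta>) else 0) else 0)"
          by (rule sum.cong) auto
        ultimately show "(\<Sum>\<beta> | mdeg \<beta> \<le> d. ?c \<alpha> \<beta> * zpow z \<alpha> * cnj (zpow z \<beta>)) =
            (if \<alpha> \<in> A then of_real (w \<alpha>) * zpow z \<alpha> * cnj (zpow z \<alpha>) else 0)"
          by (simp add: finite_mdeg_le)
      qed
      also have "\<dots> = (\<Sum>\<alpha>\<in>A. of_real (w \<alpha>) * zpow z \<alpha> * cnj (zpow z \<alpha>))"
        by (rule sum.mono_neutral_cong_right) (auto simp: finite_mdeg_le A_def)
      also have "\<dots> = of_real (\<Sum>\<alpha>\<in>A. w \<alpha> * (cmod (zpow z \<alpha>))\<^sup>2)"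
        unfolding of_real_sum of_real_mult complex_norm_square by (simp only: mult.assoc)
      also have "(\<Sum>\<alpha>\<in>A. w \<alpha> * (cmod (zpow z \<alpha>))\<^sup>2) = sqnorm (N (k + 1)) (f (k + 1) z)"
        unfolding fR R_def \<eta>_def by simp
      finally show "of_real (sqnorm (N (k + 1)) (f (k + 1) z)) = hform d ?c z" by simp
    qed
    from underlying_form_polynomial[OF this] underlying_form_polynomial[OF C[of "k + 1"]] show ?thesis by simp
  qed
  have ex: "members_at k N f lam \<noteq> {}" if "lam \<in> family_K k N f" for lam
    by (rule polynomial_family_members_exist[OF C sphere f0 that])
  have "convex_family k N f"
    unfolding convex_family_def
  proof (intro conjI ballI allI impI proper)
    fix a :: "nat \<Rightarrow> real" and i
    assume "\<forall>\<alpha> \<beta>. (\<Sum>i=1..k+1. of_real (a i) * underlying_form (\<lambda>z. sqnorm (N i) (f i z)) \<alpha> \<beta>) = 0"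
    then have zero: "(\<lambda>\<alpha> \<beta>. \<Sum>i=1..k+1. of_real (a i) * C i \<alpha> \<beta>) = (\<lambda>\<alpha> \<beta>. 0)"
      unfolding underlying_form_polynomial[OF C] by simp
    have sumR: "(\<Sum>i=1..k+1. a i * R i z) = 0" if z: "z \<in> ball 0 1" for z
    proof -
      have "complex_of_real (\<Sum>i=1..k+1. a i * R i z) = (\<Sum>i=1..k+1. of_real (a i) * hform d (C i) z)"
        using C z unfolding of_real_sum of_real_mult fR[symmetric] polynomial_form_def
        by (intro sum.cong refl) simp
      also have "\<dots> = hform d (\<lambda>\<alpha> \<beta>. \<Sum>i=1..k+1. of_real (a i) * C i \<alpha> \<beta>) z"
        by (rule hform_sum[symmetric])
      also have "\<dots> = of_real 0" unfolding zero by (simp add: hform_def)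
      finally show ?thesis by (simp only: of_real_eq_iff)
    qed
    have suma: "(\<Sum>i=1..k+1. a i) = 0"
    proof -
      obtain \<zeta> :: "complex ^ 'n" where \<zeta>: "norm \<zeta> = 1" using vector_choose_size[of 1] by auto
      have "(\<lambda>n. \<Sum>i=1..k+1. a i * R i ((1 - inverse (real (Suc n))) *\<^sub>R \<zeta>)) \<longlonglongrightarrow> (\<Sum>i=1..k+1. a i * R i \<zeta>)"
        by (intro tendsto_sum tendsto_mult tendsto_const R_limit)
      then have "(\<Sum>i=1..k+1. a i * R i \<zeta>) = 0"
        unfolding sumR[OF approach_sphere_in_ball[OF \<zeta>]] by (simp add: LIMSEQ_const_iff)
      then show ?thesis unfolding R_sphere[OF \<zeta>] by simp
    qed
    have "(\<Sum>p\<in>A' \<times> A'. a (h' p) * (cmod (pencil p z))\<^sup>2) = 0" if z: "z \<in> ball 0 1" for z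
    proof -
      have "(\<Sum>i=1..k+1. a i * R i z) = (\<Sum>i=1..k+1. a i) * (\<Sum>\<gamma>\<in>A. w \<gamma> * (cmod (zpow z \<gamma>))\<^sup>2)
          + ((norm z)\<^sup>2 - 1) * (\<Sum>i=1..k+1. a i * (\<eta> i * (cmod (pencil (h i) z))\<^sup>2))"
        unfolding R_def distrib_left sum.distrib sum_distrib_right sum_distrib_left[of "(norm z)\<^sup>2 - 1"]
        by (intro arg_cong2[where f = "(+)"] sum.cong refl) (simp_all add: mult_ac)
      moreover have "(norm z)\<^sup>2 - 1 \<noteq> 0" using z abs_square_less_1[of "norm z"] by simp
      ultimately have "(\<Sum>i=1..k+1. a i * (\<eta> i * (cmod (pencil (h i) z))\<^sup>2)) = 0"
        using suma sumR[OF z] by simp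
      moreover have "(\<Sum>i=1..k+1. a i * (\<eta> i * (cmod (pencil (h i) z))\<^sup>2)) = \<epsilon> * (\<Sum>i=1..k. a i * (cmod (pencil (h i) z))\<^sup>2)"
      proof -
        have "(\<Sum>i=1..k+1. a i * (\<eta> i * (cmod (pencil (h i) z))\<^sup>2)) = (\<Sum>i=1..k. a i * (\<eta> i * (cmod (pencil (h i) z))\<^sup>2))"
          by (simp add: \<eta>_def)
        also have "\<dots> = \<epsilon> * (\<Sum>i=1..k. a i * (cmod (pencil (h i) z))\<^sup>2)"
          unfolding sum_distrib_left by (rule sum.cong) (auto simp: \<eta>_def)
        finally show ?thesis .
      qed
      ultimately have "(\<Sum>i=1..k. a i * (cmod (pencil (h i) z))\<^sup>2) = 0" using \<epsilon> by simp
      moreover have "(\<Sum>p\<in>A' \<times> A'. a (h' p) * (cmod (pencil p z))\<^sup>2) =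
          (\<Sum>i=1..k. a (h' (h i)) * (cmod (pencil (h i) z))\<^sup>2)"
        by (rule sum.reindex_bij_betw[OF h, symmetric])
      moreover have "\<dots> = (\<Sum>i=1..k. a i * (cmod (pencil (h i) z))\<^sup>2)"
      proof (rule sum.cong[OF refl])
        fix i assume "i \<in> {1..k}"
        then have "h' (h i) = i" by (rule h')
        then show "a (h' (h i)) * (cmod (pencil (h i) z))\<^sup>2 = a i * (cmod (pencil (h i) z))\<^sup>2" by simp
      qed
      ultimately show ?thesis by simp
    qed
    note pencil_relation = this
    have b: "a (h' p) = 0" if p: "p \<in> A' \<times> A'" for p
      by (rule pencil_forms_independent[of A' "d - 1" "\<lambda>p. a (h' p)" p, OF _ pencil_relation p])
        (auto simp: A'_def)
    have a0: "a i = 0" if "i \<in> {1..k}" for i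
    proof -
      have "h i \<in> A' \<times> A'" using bij_betwE[OF h] that by blast
      from b[OF this] show ?thesis unfolding h'[OF that] .
    qed
    then have "(\<Sum>i=1..k. a i) = 0" by (intro sum.neutral) blast
    then have "a (k + 1) = 0" using suma by simp
    moreover assume "i \<in> {1..k+1}"
    ultimately show "a i = 0" using a0[of i] by (cases "i = k + 1") auto
  qed
  moreover have "polynomial_family k N f"
  proof -
    have "polynomial_map M g" if mem: "(M, g) \<in> members k N f" for M g
    proof -
      obtain lam where "(M, g) \<in> members_at k N f lam" using mem by (auto simp: members_def)
      from polynomial_family_members(2)[OF C this] show ?thesis unfolding polynomial_map_def ..
    qed
    then show ?thesis unfolding polynomial_family_def by blast
  qed
  moreover have "has_generic_degree k N f d"
  proof (rule generic_degree_if_top_coefficient[OF C ex _ proper \<alpha>0(1)])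
    show "k + 1 \<in> {1..k+1}" by simp
    show "Re (C (k + 1) \<alpha>0 \<alpha>0) > 0" unfolding base using \<alpha>0(2) w by simp
  qed
  moreover have "family_rank k N f = delta TYPE('n) d"
  proof -
    have rank_le: "map_rank M g \<le> card A" if mem: "(M, g) \<in> members k N f" for M g
    proof -
      obtain lam where "(M, g) \<in> members_at k N f lam" using mem by (auto simp: members_def)
      from underlying_form_polynomial[OF polynomial_family_members(1)[OF C this]]
      have "map_rank M g = form_rank (family_form k C lam)" by (simp add: map_rank_def)
      also have "\<dots> \<le> card A"
      proof (rule form_rank_le[OF finA])
        fix \<alpha> \<beta> :: "'n \<Rightarrow> nat" assume "\<beta> \<notin> A"
        then have "C i \<alpha> \<beta> = 0" for i using supp by blast
        then show "family_form k C lam \<alpha> \<beta> = 0" by (simp add: family_form_def)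
      qed
      finally show ?thesis .
    qed
    have "map_rank (N (k + 1)) (f (k + 1)) = form_rank (C (k + 1))"
      using underlying_form_polynomial[OF C] by (simp add: map_rank_def)
    also have "\<dots> = card A"
      unfolding base by (rule form_rank_diagonal[OF finA]) (use w in force)
    finally have rank_base: "map_rank (N (k + 1)) (f (k + 1)) = card A" .
    have base_member: "(N (k + 1), f (k + 1)) \<in> members k N f"
      using vertex_member[of "k + 1" k N f, OF _ proper] by (auto simp: members_def)
    have "Max ((\<lambda>(M, g). map_rank M g) ` members k N f) = card A"
    proof (rule Max_eqI)
      show "finite ((\<lambda>(M, g). map_rank M g) ` members k N f)"
        by (rule finite_subset[of _ "{..card A}"]) (use rank_le in auto)
      show "y \<le> card A" if "y \<in> (\<lambda>(M, g). map_rank M g) ` members k N f" for y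
        using that rank_le by auto
      show "card A \<in> (\<lambda>(M, g). map_rank M g) ` members k N f"
        using base_member rank_base by (intro image_eqI[of _ _ "(N (k + 1), f (k + 1))"]) simp_all
    qed
    then show ?thesis by (simp add: family_rank_def delta_eq_card A_def)
  qed
  ultimately show ?thesis by blast
qed

theorem proposition3:
  fixes d k :: nat
  assumes "d \<ge> 1"
    and "k = (delta TYPE('n::finite) (d - 1))\<^sup>2"
  shows "(\<exists>N (f :: nat \<Rightarrow> complex ^ 'n \<Rightarrow> nat \<Rightarrow> complex).
            convex_family k N f \<and> polynomial_family k N f \<and>
            has_generic_degree k N f d \<and> family_rank k N f = delta TYPE('n) d)
       \<and> (\<forall>m N (f :: nat \<Rightarrow> complex ^ 'n \<Rightarrow> nat \<Rightarrow> complex).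
            convex_family m N f \<longrightarrow> polynomial_family m N f \<longrightarrow>
            origin_preserving_family m N f \<longrightarrow> has_generic_degree m N f d \<longrightarrow> m \<le> k)"
  using extremal_family_exists[OF assms] convex_family_dimension_le[OF _ _ _ _ assms(1)] assms(2)
  by blast

end
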